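(* Let $(\mathbb{C}, 0, +, \le)$ be a monoid with a preorder, let $\Sigma_{\mathbf{calf}}$ be the signature of the cost-aware logical framework $\mathbf{calf}$ over $\mathbb{C}$ given in the context, and let $\mathcal{C}$ be its category of judgments, with terminal object $\mathbf{1}_{\mathcal{C}}$. Then for every closed computation $e : \mathsf{F}(\mathsf{nat})$, i.e. for every morphism $e : \mathbf{1}_{\mathcal{C}} \to \mathsf{tm}^{\ominus}(\mathsf{F}(\mathsf{nat}))$ in $\mathcal{C}$ (equivalently, every closed term of the judgment $\mathsf{tm}^{\ominus}(\mathsf{F}(\mathsf{nat}))$ modulo judgmental equality), there exist $c \in \mathbb{C}$ and $n \in \mathbb{N}$ such that $$e = \mathsf{step}^{c}\bigl(\mathsf{ret}(\mathsf{suc}^{n}(\mathsf{zero}))\bigr),$$ where $\mathsf{suc}^n$ denotes the $n$-fold application of $\mathsf{suc}$ and equality is judgmental equality (equality of morphisms in $\mathcal{C}$).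
   Context: **Logical framework.** Signatures are written in extensional Martin-Löf type theory with a universe $\mathsf{Jdg}$ of judgments closed under the unit type, dependent products $(x:A)\to B(x)$, dependent sums $(x:A)\times B(x)$, and extensional equality types $a = b$ (with equality reflection, so framework-level equality is judgmental equality). A type theory is presented by declaring constants in this framework: binding is by framework-level functions (higher-order abstract syntax), and the equational theory is given by constants inhabiting framework-level equality types. $(\alpha,\beta): A\cong B$ declares constants $\alpha:A\to B$, $\beta:B\to A$ together with equations making them mutually inverse. Arguments in braces, or evident from the typing, are implicit; every declaration is universally quantified over its free variables. **Cost monoid.** A monoid $(\mathbb{C},0,+)$ with a preorder $\le$ is fixed (the order does not occur in the signature). $\mathsf{step}^c$ is given for each element $c$ of $\mathbb{C}$. **The signature $\Sigma_{\mathbf{calf}}$** consists of the following constants. *Judgments and the adjunction.* - $\mathsf{tp}^+ : \mathsf{Jdg}$ (value types); $\mathsf{tp}^{\ominus} : \mathsf{Jdg}$ (computation types); $\mathsf{tm}^+ : \mathsf{tp}^+\to\mathsf{Jdg}$ (terms of a value type). - $\mathsf{U}:\mathsf{tp}^{\ominus}\to\mathsf{tp}^+$; $\mathsf{F}:\mathsf{tp}^+\to\mathsf{tp}^{\ominus}$. Abbreviation: $\mathsf{tm}^{\ominus}(X) := \mathsf{tm}^+(\mathsf{U}(X))$. - $\mathsf{ret}:\{A:\mathsf{tp}^+\}\;\mathsf{tm}^+(A)\to\mathsf{tm}^{\ominus}(\mathsf{F}(A))$. - $\mathsf{bind}:\{A:\mathsf{tp}^+,X:\mathsf{tp}^{\ominus}\}\;\mathsf{tm}^{\ominus}(\mathsf{F}(A))\to(\mathsf{tm}^+(A)\to\mathsf{tm}^{\ominus}(X))\to\mathsf{tm}^{\ominus}(X)$.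 - Equations: $\mathsf{bind}(\mathsf{ret}(a);f)=f(a)$; $\mathsf{bind}(e;\mathsf{ret})=e$; $\mathsf{bind}(\mathsf{bind}(e;f);g)=\mathsf{bind}(e;\lambda a.\,\mathsf{bind}(f(a);g))$. *Cost.* - $\mathsf{step}:\{X:\mathsf{tp}^{\ominus}\}\;\mathbb{C}\to\mathsf{tm}^{\ominus}(X)\to\mathsf{tm}^{\ominus}(X)$, written $\mathsf{step}^c(e)$. - Equations: $\mathsf{step}^0(e)=e$; $\mathsf{step}^{c_1}(\mathsf{step}^{c_2}(e))=\mathsf{step}^{c_1+c_2}(e)$. *Behavioral phase.* - $\mathsf{beh}:\mathsf{Jdg}$, with an equation $u=v$ for all $u,v:\mathsf{beh}$. - $\mathsf{beh}\to(\mathsf{step}^c(e)=e)$, for all $c$, $X$, $e:\mathsf{tm}^{\ominus}(X)$. *Open modality.* - $\bigcirc^+:\mathsf{tp}^+\to\mathsf{tp}^+$ and $(\mathsf{ap}_{\bigcirc},\mathsf{lam}_{\bigcirc}):\{A\}\;\mathsf{tm}^+(\bigcirc^+(A))\cong(\mathsf{beh}\to\mathsf{tm}^+(A))$. *Closed modality.* - $\bullet^+:\mathsf{tp}^+\to\mathsf{tp}^+$; $\eta_{\bullet}:\{A\}\;\mathsf{tm}^+(A)\to\mathsf{tm}^+(\bullet^+(A))$; $\star:\{A\}\;\mathsf{beh}\to\mathsf{tm}^+(\bullet^+(A))$. - Equation: $\eta_{\bullet}(a)=\star(z)$ for all $a:\mathsf{tm}^+(A)$, $z:\mathsf{beh}$.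 - $\mathsf{ind}_{\bullet}:\{A\}\;(b:\mathsf{tm}^+(\bullet^+(A)))\to(X:\mathsf{tm}^+(\bullet^+(A))\to\mathsf{tp}^{\ominus})\to(x_0:(a:\mathsf{tm}^+(A))\to\mathsf{tm}^{\ominus}(X(\eta_{\bullet}(a))))\to(x_1:(z:\mathsf{beh})\to\mathsf{tm}^{\ominus}(X(\star(z))))\to(h:(a:\mathsf{tm}^+(A))\to(z:\mathsf{beh})\to x_0(a)=x_1(z))\to\mathsf{tm}^{\ominus}(X(b))$. - Equations: $\mathsf{ind}_{\bullet}(\eta_{\bullet}(a);X;x_0;x_1;h)=x_0(a)$; $\mathsf{ind}_{\bullet}(\star(z);X;x_0;x_1;h)=x_1(z)$. *Dependent products and sums.* - $\Pi:(A:\mathsf{tp}^+,\,X:\mathsf{tm}^+(A)\to\mathsf{tp}^{\ominus})\to\mathsf{tp}^{\ominus}$ and $(\mathsf{ap},\mathsf{lam}):\mathsf{tm}^{\ominus}(\Pi(A;X))\cong((a:\mathsf{tm}^+(A))\to\mathsf{tm}^{\ominus}(X(a)))$. - $\Sigma:(A:\mathsf{tp}^+,\,B:\mathsf{tm}^+(A)\to\mathsf{tp}^+)\to\mathsf{tp}^+$ and $(\mathsf{unpair},\mathsf{pair}):\mathsf{tm}^+(\Sigma(A;B))\cong((a:\mathsf{tm}^+(A))\times\mathsf{tm}^+(B(a)))$. *Equality types.* - $\mathsf{eq}:(A:\mathsf{tp}^+)\to\mathsf{tm}^+(A)\to\mathsf{tm}^+(A)\to\mathsf{tp}^+$ and,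 for $a,b:\mathsf{tm}^+(A)$, $(\mathsf{ref},\mathsf{self}):(a=_{\mathsf{tm}^+(A)}b)\cong\mathsf{tm}^+(\mathsf{eq}(A;a;b))$. *Natural numbers.* - $\mathsf{nat}:\mathsf{tp}^+$; $\mathsf{zero}:\mathsf{tm}^+(\mathsf{nat})$; $\mathsf{suc}:\mathsf{tm}^+(\mathsf{nat})\to\mathsf{tm}^+(\mathsf{nat})$. - $\mathsf{ind}:(n:\mathsf{tm}^+(\mathsf{nat}))\to(X:\mathsf{tm}^+(\mathsf{nat})\to\mathsf{tp}^{\ominus})\to\mathsf{tm}^{\ominus}(X(\mathsf{zero}))\to((m:\mathsf{tm}^+(\mathsf{nat}))\to\mathsf{tm}^{\ominus}(X(m))\to\mathsf{tm}^{\ominus}(X(\mathsf{suc}(m))))\to\mathsf{tm}^{\ominus}(X(n))$. - Equations: $\mathsf{ind}(\mathsf{zero};X;e_0;e_1)=e_0$; $\mathsf{ind}(\mathsf{suc}(n);X;e_0;e_1)=e_1(n)(\mathsf{ind}(n;X;e_0;e_1))$. *Interaction of step with eliminators.* - Equations: $\mathsf{ap}(\mathsf{step}^c(f))(a)=\mathsf{step}^c(\mathsf{ap}(f)(a))$; $\mathsf{bind}(\mathsf{step}^c(e);f)=\mathsf{step}^c(\mathsf{bind}(e;f))$. **Category of judgments.** $\mathcal{C}$ is the category whose objects are the (closed) judgments $\mathcal{J}:\mathsf{Jdg}$ definable in the framework extended by the constants of $\Sigma_{\mathbf{calf}}$, and whose morphisms $\mathcal{J}_1\to\mathcal{J}_2$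 are deductions (terms of $\mathcal{J}_2$ in context $\mathcal{J}_1$) modulo judgmental equality. It is a locally Cartesian closed category, whose internal language is extensional Martin-Löf type theory extended with the constants of $\Sigma_{\mathbf{calf}}$; models of $\Sigma_{\mathbf{calf}}$ in a locally Cartesian closed category $\mathcal{E}$ correspond to locally Cartesian closed functors $\mathcal{C}\to\mathcal{E}$. A closed term of value type $A$ is a morphism $\mathbf{1}_{\mathcal{C}}\to\mathsf{tm}^+(A)$; a closed computation of type $X$ is a morphism $\mathbf{1}_{\mathcal{C}}\to\mathsf{tm}^{\ominus}(X)$. *)

theory Defs
  imports Main
begin

section \<open>Raw syntax of the framework and of the constants of calf\<close>

text \<open>
  The framework is extensional Martin-Loef type theory with de Bruijn indices.  Judgments
  (elements of the universe of judgments) and terms are two syntactic classes.  The only binders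
  are those of the framework: the last argument of \<open>JPi\<close>, \<open>JSigma\<close> and \<open>Lam\<close>, and the codomain
  annotation \<open>B\<close> in \<open>Lam A B b\<close>, \<open>App A B f a\<close>, \<open>Pair A B a b\<close>, \<open>Fst A B p\<close>, \<open>Snd A B p\<close>, each
  bind one variable of judgment \<open>A\<close>.  Terms carry full annotations because \<open>JPi\<close> and \<open>JSigma\<close>
  need not be injective in the presence of equality reflection.

  \<open>J : Jdg\<close> is a form of judgment, not a typing in a large type: the signature mentions \<open>Jdg\<close> only
  to declare \<open>tp\<^sup>+\<close>, \<open>tp\<^sup>\<ominus>\<close>, \<open>tm\<^sup>+\<close> and \<open>beh\<close>, and contexts consist of judgments.

  The constants of the signature occur fully applied, with their implicit arguments
  spelled out; binding arguments (higher-order abstract syntax) are terms of framework-level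
  function judgments, so no constant binds a variable.
\<close>

datatype 'c jdg =
    JUnit
  | JPi "'c jdg" "'c jdg"
  | JSigma "'c jdg" "'c jdg"
  | JEq "'c jdg" "'c tm" "'c tm"
  | TpPos
  | TpNeg
  | TmPos "'c tm"
  | Beh
and 'c tm =
    Var nat
  | Triv
  | Lam "'c jdg" "'c jdg" "'c tm"
  | App "'c jdg" "'c jdg" "'c tm" "'c tm"
  | Pair "'c jdg" "'c jdg" "'c tm" "'c tm"
  | Fst "'c jdg" "'c jdg" "'c tm"
  | Snd "'c jdg" "'c jdg" "'c tm"
  | Refl "'c jdg" "'c tm"
  | U "'c tm"
  | F "'c tm"
  | Ret "'c tm" "'c tm"                          \<comment> \<open>\<open>A a\<close>\<close>
  | Bind "'c tm" "'c tm" "'c tm" "'c tm"         \<comment> \<open>\<open>A X e f\<close>\<close>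
  | Step "'c tm" 'c "'c tm"                      \<comment> \<open>\<open>X c e\<close>\<close>
  | Open "'c tm"
  | ApOpen "'c tm" "'c tm"                       \<comment> \<open>\<open>A u\<close>\<close>
  | LamOpen "'c tm" "'c tm"                      \<comment> \<open>\<open>A f\<close>\<close>
  | Closed "'c tm"
  | Eta "'c tm" "'c tm"                          \<comment> \<open>\<open>A a\<close>\<close>
  | Star "'c tm" "'c tm"                         \<comment> \<open>\<open>A z\<close>\<close>
  | IndClosed "'c tm" "'c tm" "'c tm" "'c tm" "'c tm" "'c tm"  \<comment> \<open>\<open>A b X x0 x1 h\<close>\<close>
  | PiT "'c tm" "'c tm"                          \<comment> \<open>\<open>A X\<close>\<close>
  | Ap "'c tm" "'c tm" "'c tm"                   \<comment> \<open>\<open>A X u\<close>, a framework function\<close>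
  | LamT "'c tm" "'c tm" "'c tm"                 \<comment> \<open>\<open>A X f\<close>, for \<open>f\<close> a framework function\<close>
  | SigmaT "'c tm" "'c tm"                       \<comment> \<open>\<open>A B\<close>\<close>
  | Unpair "'c tm" "'c tm" "'c tm"               \<comment> \<open>\<open>A B u\<close>, a framework pair\<close>
  | PairT "'c tm" "'c tm" "'c tm"                \<comment> \<open>\<open>A B p\<close>, for \<open>p\<close> a framework pair\<close>
  | EqT "'c tm" "'c tm" "'c tm"                  \<comment> \<open>\<open>A a b\<close>\<close>
  | RefT "'c tm" "'c tm" "'c tm" "'c tm"         \<comment> \<open>\<open>A a b p\<close>\<close>
  | SelfT "'c tm" "'c tm" "'c tm" "'c tm"        \<comment> \<open>\<open>A a b u\<close>\<close>
  | NatT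
  | Zero
  | Succ "'c tm"
  | IndNat "'c tm" "'c tm" "'c tm" "'c tm"       \<comment> \<open>\<open>n X e0 e1\<close>\<close>

section \<open>Renaming and substitution\<close>

definition up_ren :: "(nat \<Rightarrow> nat) \<Rightarrow> nat \<Rightarrow> nat" where
  "up_ren r = case_nat 0 (\<lambda>i. Suc (r i))"

primrec renJ :: "(nat \<Rightarrow> nat) \<Rightarrow> 'c jdg \<Rightarrow> 'c jdg"
  and renT :: "(nat \<Rightarrow> nat) \<Rightarrow> 'c tm \<Rightarrow> 'c tm" where
  "renJ r JUnit = JUnit"
| "renJ r (JPi A B) = JPi (renJ r A) (renJ (up_ren r) B)"
| "renJ r (JSigma A B) = JSigma (renJ r A) (renJ (up_ren r) B)"
| "renJ r (JEq A a b) = JEq (renJ r A) (renT r a) (renT r b)"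
| "renJ r TpPos = TpPos"
| "renJ r TpNeg = TpNeg"
| "renJ r (TmPos A) = TmPos (renT r A)"
| "renJ r Beh = Beh"
| "renT r (Var i) = Var (r i)"
| "renT r Triv = Triv"
| "renT r (Lam A B b) = Lam (renJ r A) (renJ (up_ren r) B) (renT (up_ren r) b)"
| "renT r (App A B f a) = App (renJ r A) (renJ (up_ren r) B) (renT r f) (renT r a)"
| "renT r (Pair A B a b) = Pair (renJ r A) (renJ (up_ren r) B) (renT r a) (renT r b)"
| "renT r (Fst A B p) = Fst (renJ r A) (renJ (up_ren r) B) (renT r p)"
| "renT r (Snd A B p) = Snd (renJ r A) (renJ (up_ren r) B) (renT r p)"
| "renT r (Refl A a) = Refl (renJ r A) (renT r a)"
| "renT r (U X) = U (renT r X)"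
| "renT r (F A) = F (renT r A)"
| "renT r (Ret A a) = Ret (renT r A) (renT r a)"
| "renT r (Bind A X e f) = Bind (renT r A) (renT r X) (renT r e) (renT r f)"
| "renT r (Step X c e) = Step (renT r X) c (renT r e)"
| "renT r (Open A) = Open (renT r A)"
| "renT r (ApOpen A u) = ApOpen (renT r A) (renT r u)"
| "renT r (LamOpen A f) = LamOpen (renT r A) (renT r f)"
| "renT r (Closed A) = Closed (renT r A)"
| "renT r (Eta A a) = Eta (renT r A) (renT r a)"
| "renT r (Star A z) = Star (renT r A) (renT r z)"
| "renT r (IndClosed A b X x0 x1 h) = IndClosed (renT r A) (renT r b) (renT r X) (renT r x0) (renT r x1) (renT r h)"
| "renT r (PiT A X) = PiT (renT r A) (renT r X)"
| "renT r (Ap A X u) = Ap (renT r A) (renT r X) (renT r u)"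
| "renT r (LamT A X f) = LamT (renT r A) (renT r X) (renT r f)"
| "renT r (SigmaT A B) = SigmaT (renT r A) (renT r B)"
| "renT r (Unpair A B u) = Unpair (renT r A) (renT r B) (renT r u)"
| "renT r (PairT A B p) = PairT (renT r A) (renT r B) (renT r p)"
| "renT r (EqT A a b) = EqT (renT r A) (renT r a) (renT r b)"
| "renT r (RefT A a b p) = RefT (renT r A) (renT r a) (renT r b) (renT r p)"
| "renT r (SelfT A a b u) = SelfT (renT r A) (renT r a) (renT r b) (renT r u)"
| "renT r NatT = NatT"
| "renT r Zero = Zero"
| "renT r (Succ n) = Succ (renT r n)"
| "renT r (IndNat n X e0 e1) = IndNat (renT r n) (renT r X) (renT r e0) (renT r e1)"

abbreviation wkJ :: "'c jdg \<Rightarrow> 'c jdg" where "wkJ \<equiv> renJ Suc"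
abbreviation wkT :: "'c tm \<Rightarrow> 'c tm" where "wkT \<equiv> renT Suc"

definition up_sub :: "(nat \<Rightarrow> 'c tm) \<Rightarrow> nat \<Rightarrow> 'c tm" where
  "up_sub s = case_nat (Var 0) (\<lambda>i. wkT (s i))"

primrec subJ :: "(nat \<Rightarrow> 'c tm) \<Rightarrow> 'c jdg \<Rightarrow> 'c jdg"
  and subT :: "(nat \<Rightarrow> 'c tm) \<Rightarrow> 'c tm \<Rightarrow> 'c tm" where
  "subJ s JUnit = JUnit"
| "subJ s (JPi A B) = JPi (subJ s A) (subJ (up_sub s) B)"
| "subJ s (JSigma A B) = JSigma (subJ s A) (subJ (up_sub s) B)"
| "subJ s (JEq A a b) = JEq (subJ s A) (subT s a) (subT s b)"
| "subJ s TpPos = TpPos"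
| "subJ s TpNeg = TpNeg"
| "subJ s (TmPos A) = TmPos (subT s A)"
| "subJ s Beh = Beh"
| "subT s (Var i) = s i"
| "subT s Triv = Triv"
| "subT s (Lam A B b) = Lam (subJ s A) (subJ (up_sub s) B) (subT (up_sub s) b)"
| "subT s (App A B f a) = App (subJ s A) (subJ (up_sub s) B) (subT s f) (subT s a)"
| "subT s (Pair A B a b) = Pair (subJ s A) (subJ (up_sub s) B) (subT s a) (subT s b)"
| "subT s (Fst A B p) = Fst (subJ s A) (subJ (up_sub s) B) (subT s p)"
| "subT s (Snd A B p) = Snd (subJ s A) (subJ (up_sub s) B) (subT s p)"
| "subT s (Refl A a) = Refl (subJ s A) (subT s a)"
| "subT s (U X) = U (subT s X)"
| "subT s (F A) = F (subT s A)"
| "subT s (Ret A a) = Ret (subT s A) (subT s a)"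
| "subT s (Bind A X e f) = Bind (subT s A) (subT s X) (subT s e) (subT s f)"
| "subT s (Step X c e) = Step (subT s X) c (subT s e)"
| "subT s (Open A) = Open (subT s A)"
| "subT s (ApOpen A u) = ApOpen (subT s A) (subT s u)"
| "subT s (LamOpen A f) = LamOpen (subT s A) (subT s f)"
| "subT s (Closed A) = Closed (subT s A)"
| "subT s (Eta A a) = Eta (subT s A) (subT s a)"
| "subT s (Star A z) = Star (subT s A) (subT s z)"
| "subT s (IndClosed A b X x0 x1 h) = IndClosed (subT s A) (subT s b) (subT s X) (subT s x0) (subT s x1) (subT s h)"
| "subT s (PiT A X) = PiT (subT s A) (subT s X)"
| "subT s (Ap A X u) = Ap (subT s A) (subT s X) (subT s u)"
| "subT s (LamT A X f) = LamT (subT s A) (subT s X) (subT s f)"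
| "subT s (SigmaT A B) = SigmaT (subT s A) (subT s B)"
| "subT s (Unpair A B u) = Unpair (subT s A) (subT s B) (subT s u)"
| "subT s (PairT A B p) = PairT (subT s A) (subT s B) (subT s p)"
| "subT s (EqT A a b) = EqT (subT s A) (subT s a) (subT s b)"
| "subT s (RefT A a b p) = RefT (subT s A) (subT s a) (subT s b) (subT s p)"
| "subT s (SelfT A a b u) = SelfT (subT s A) (subT s a) (subT s b) (subT s u)"
| "subT s NatT = NatT"
| "subT s Zero = Zero"
| "subT s (Succ n) = Succ (subT s n)"
| "subT s (IndNat n X e0 e1) = IndNat (subT s n) (subT s X) (subT s e0) (subT s e1)"

definition single :: "'c tm \<Rightarrow> nat \<Rightarrow> 'c tm" where
  "single a = case_nat a Var"

abbreviation instJ :: "'c jdg \<Rightarrow> 'c tm \<Rightarrow> 'c jdg" where "instJ B a \<equiv> subJ (single a) B"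
abbreviation instT :: "'c tm \<Rightarrow> 'c tm \<Rightarrow> 'c tm" where "instT b a \<equiv> subT (single a) b"

section \<open>Abbreviations used in the signature\<close>

abbreviation TmNeg :: "'c tm \<Rightarrow> 'c jdg" where
  "TmNeg X \<equiv> TmPos (U X)"

abbreviation Arr :: "'c jdg \<Rightarrow> 'c jdg \<Rightarrow> 'c jdg" where
  "Arr A B \<equiv> JPi A (wkJ B)"
abbreviation app :: "'c jdg \<Rightarrow> 'c jdg \<Rightarrow> 'c tm \<Rightarrow> 'c tm \<Rightarrow> 'c tm" where
  "app A B f a \<equiv> App A (wkJ B) f a"

text \<open>
  For a family \<open>X\<close> of computation (value) types over \<open>tm\<^sup>+(A)\<close>: the fibre of \<open>X\<close> at \<open>a\<close>,
  its judgment of terms, and the latter with \<open>a\<close> a fresh variable (one more variable in scope).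
\<close>

abbreviation atNeg :: "'c tm \<Rightarrow> 'c tm \<Rightarrow> 'c tm \<Rightarrow> 'c tm" where
  "atNeg A X a \<equiv> app (TmPos A) TpNeg X a"
abbreviation atPos :: "'c tm \<Rightarrow> 'c tm \<Rightarrow> 'c tm \<Rightarrow> 'c tm" where
  "atPos A B a \<equiv> app (TmPos A) TpPos B a"
abbreviation famNeg :: "'c tm \<Rightarrow> 'c tm \<Rightarrow> 'c jdg" where
  "famNeg A X \<equiv> TmNeg (atNeg (wkT A) (wkT X) (Var 0))"
abbreviation famPos :: "'c tm \<Rightarrow> 'c tm \<Rightarrow> 'c jdg" where
  "famPos A B \<equiv> TmPos (atPos (wkT A) (wkT B) (Var 0))"

text \<open>
  For a motive \<open>X : tm\<^sup>+(\<bullet>\<^sup>+ A) \<rightarrow> tp\<^sup>\<ominus>\<close>: the codomains \<open>tm\<^sup>\<ominus>(X(\<eta>(a)))\<close> over \<open>a : tm\<^sup>+(A)\<close> and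
  \<open>tm\<^sup>\<ominus>(X(\<star>(z)))\<close> over \<open>z : beh\<close>, and the judgment
  \<open>(a : tm\<^sup>+(A)) \<rightarrow> (z : beh) \<rightarrow> x0(a) = x1(z)\<close>.
\<close>

abbreviation atEta :: "'c tm \<Rightarrow> 'c tm \<Rightarrow> 'c jdg" where
  "atEta A X \<equiv> TmNeg (atNeg (Closed (wkT A)) (wkT X) (Eta (wkT A) (Var 0)))"
abbreviation atStar :: "'c tm \<Rightarrow> 'c tm \<Rightarrow> 'c jdg" where
  "atStar A X \<equiv> TmNeg (atNeg (Closed (wkT A)) (wkT X) (Star (wkT A) (Var 0)))"
abbreviation glueEq :: "'c tm \<Rightarrow> 'c tm \<Rightarrow> 'c tm \<Rightarrow> 'c tm \<Rightarrow> 'c tm \<Rightarrow> 'c tm \<Rightarrow> 'c jdg" where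
  "glueEq A X x0 x1 a z \<equiv>
     JEq (TmNeg (atNeg (Closed A) X (Eta A a))) (App (TmPos A) (atEta A X) x0 a) (App Beh (atStar A X) x1 z)"
abbreviation glue :: "'c tm \<Rightarrow> 'c tm \<Rightarrow> 'c tm \<Rightarrow> 'c tm \<Rightarrow> 'c jdg" where
  "glue A X x0 x1 \<equiv>
     JPi (TmPos A) (JPi Beh
       (glueEq (wkT (wkT A)) (wkT (wkT X)) (wkT (wkT x0)) (wkT (wkT x1)) (Var 1) (Var 0)))"

text \<open>
  For a motive \<open>X : tm\<^sup>+(nat) \<rightarrow> tp\<^sup>\<ominus>\<close>: the codomain \<open>tm\<^sup>\<ominus>(X(m)) \<rightarrow> tm\<^sup>\<ominus>(X(suc(m)))\<close> over
  \<open>m : tm\<^sup>+(nat)\<close>.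
\<close>

abbreviation indStep :: "'c tm \<Rightarrow> 'c jdg" where
  "indStep X \<equiv> Arr (TmNeg (atNeg NatT (wkT X) (Var 0))) (TmNeg (atNeg NatT (wkT X) (Succ (Var 0))))"

section \<open>Derivable judgments of the framework extended by the signature\<close>

text \<open>
  \<open>\<turnstile>\<^sub>C \<Gamma>\<close>: \<open>\<Gamma>\<close> is a context (most recent variable first).
  \<open>\<Gamma> \<turnstile>\<^sub>J J\<close>: \<open>J : Jdg\<close> in context \<open>\<Gamma>\<close>.
  \<open>\<Gamma> \<turnstile>\<^sub>J J \<doteq> K\<close>: \<open>J\<close> and \<open>K\<close> are judgmentally equal.
  \<open>\<Gamma> \<turnstile> t \<Colon> J\<close>: \<open>t\<close> is a term (deduction) of \<open>J\<close>.
  \<open>\<Gamma> \<turnstile> t \<doteq> u \<Colon> J\<close>: \<open>t\<close> and \<open>u\<close> are judgmentally equal terms of \<open>J\<close>.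

  By equality reflection and uniqueness of equality proofs, a constant of the signature that
  inhabits a framework-level equality amounts to a rule of judgmental equality.  The equations
  are given as such rules.
\<close>

inductive wf_ctx :: "('c::monoid_add) jdg list \<Rightarrow> bool"
      ("\<turnstile>\<^sub>C _" [50] 50)
  and is_jdg :: "'c jdg list \<Rightarrow> 'c jdg \<Rightarrow> bool"
      ("_ \<turnstile>\<^sub>J _" [50, 51] 50)
  and eq_jdg :: "'c jdg list \<Rightarrow> 'c jdg \<Rightarrow> 'c jdg \<Rightarrow> bool"
      ("_ \<turnstile>\<^sub>J _ \<doteq> _" [50, 51, 51] 50)
  and has_jdg :: "'c jdg list \<Rightarrow> 'c tm \<Rightarrow> 'c jdg \<Rightarrow> bool"
      ("_ \<turnstile> _ \<Colon> _" [50, 51, 51] 50)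
  and eq_tm :: "'c jdg list \<Rightarrow> 'c tm \<Rightarrow> 'c tm \<Rightarrow> 'c jdg \<Rightarrow> bool"
      ("_ \<turnstile> _ \<doteq> _ \<Colon> _" [50, 51, 51, 51] 50)
where
  ctx_nil: "\<turnstile>\<^sub>C []"
| ctx_cons: "\<lbrakk>\<turnstile>\<^sub>C \<Gamma>; \<Gamma> \<turnstile>\<^sub>J A\<rbrakk> \<Longrightarrow> \<turnstile>\<^sub>C A # \<Gamma>"
| var: "\<lbrakk>\<turnstile>\<^sub>C \<Gamma>; i < length \<Gamma>\<rbrakk> \<Longrightarrow> \<Gamma> \<turnstile> Var i \<Colon> renJ (\<lambda>k. k + Suc i) (\<Gamma> ! i)"

| eqJ_refl: "\<Gamma> \<turnstile>\<^sub>J A \<Longrightarrow> \<Gamma> \<turnstile>\<^sub>J A \<doteq> A"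
| eqJ_sym: "\<Gamma> \<turnstile>\<^sub>J A \<doteq> B \<Longrightarrow> \<Gamma> \<turnstile>\<^sub>J B \<doteq> A"
| eqJ_trans: "\<lbrakk>\<Gamma> \<turnstile>\<^sub>J A \<doteq> B; \<Gamma> \<turnstile>\<^sub>J B \<doteq> C\<rbrakk> \<Longrightarrow> \<Gamma> \<turnstile>\<^sub>J A \<doteq> C"
| eq_refl: "\<Gamma> \<turnstile> a \<Colon> A \<Longrightarrow> \<Gamma> \<turnstile> a \<doteq> a \<Colon> A"
| eq_sym: "\<Gamma> \<turnstile> a \<doteq> b \<Colon> A \<Longrightarrow> \<Gamma> \<turnstile> b \<doteq> a \<Colon> A"
| eq_trans: "\<lbrakk>\<Gamma> \<turnstile> a \<doteq> b \<Colon> A; \<Gamma> \<turnstile> b \<doteq> c \<Colon> A\<rbrakk> \<Longrightarrow> \<Gamma> \<turnstile> a \<doteq> c \<Colon> A"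
| conv: "\<lbrakk>\<Gamma> \<turnstile> a \<Colon> A; \<Gamma> \<turnstile>\<^sub>J A \<doteq> B\<rbrakk> \<Longrightarrow> \<Gamma> \<turnstile> a \<Colon> B"
| eq_conv: "\<lbrakk>\<Gamma> \<turnstile> a \<doteq> b \<Colon> A; \<Gamma> \<turnstile>\<^sub>J A \<doteq> B\<rbrakk> \<Longrightarrow> \<Gamma> \<turnstile> a \<doteq> b \<Colon> B"

| JUnit: "\<turnstile>\<^sub>C \<Gamma> \<Longrightarrow> \<Gamma> \<turnstile>\<^sub>J JUnit"
| Triv: "\<turnstile>\<^sub>C \<Gamma> \<Longrightarrow> \<Gamma> \<turnstile> Triv \<Colon> JUnit"
| Triv_eta: "\<Gamma> \<turnstile> t \<Colon> JUnit \<Longrightarrow> \<Gamma> \<turnstile> t \<doteq> Triv \<Colon> JUnit"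

| JPi: "\<lbrakk>\<Gamma> \<turnstile>\<^sub>J A; A # \<Gamma> \<turnstile>\<^sub>J B\<rbrakk> \<Longrightarrow> \<Gamma> \<turnstile>\<^sub>J JPi A B"
| JPi_cong: "\<lbrakk>\<Gamma> \<turnstile>\<^sub>J A; \<Gamma> \<turnstile>\<^sub>J A \<doteq> A'; A # \<Gamma> \<turnstile>\<^sub>J B \<doteq> B'\<rbrakk> \<Longrightarrow> \<Gamma> \<turnstile>\<^sub>J JPi A B \<doteq> JPi A' B'"
| Lam: "\<lbrakk>\<Gamma> \<turnstile>\<^sub>J A; A # \<Gamma> \<turnstile>\<^sub>J B; A # \<Gamma> \<turnstile> b \<Colon> B\<rbrakk> \<Longrightarrow> \<Gamma> \<turnstile> Lam A B b \<Colon> JPi A B"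
| Lam_cong: "\<lbrakk>\<Gamma> \<turnstile>\<^sub>J A; \<Gamma> \<turnstile>\<^sub>J A \<doteq> A'; A # \<Gamma> \<turnstile>\<^sub>J B \<doteq> B'; A # \<Gamma> \<turnstile> b \<doteq> b' \<Colon> B\<rbrakk>
    \<Longrightarrow> \<Gamma> \<turnstile> Lam A B b \<doteq> Lam A' B' b' \<Colon> JPi A B"
| App: "\<lbrakk>\<Gamma> \<turnstile>\<^sub>J A; A # \<Gamma> \<turnstile>\<^sub>J B; \<Gamma> \<turnstile> f \<Colon> JPi A B; \<Gamma> \<turnstile> a \<Colon> A\<rbrakk> \<Longrightarrow> \<Gamma> \<turnstile> App A B f a \<Colon> instJ B a"
| App_cong: "\<lbrakk>\<Gamma> \<turnstile>\<^sub>J A; \<Gamma> \<turnstile>\<^sub>J A \<doteq> A'; A # \<Gamma> \<turnstile>\<^sub>J B \<doteq> B'; \<Gamma> \<turnstile> f \<doteq> f' \<Colon> JPi A B; \<Gamma> \<turnstile> a \<doteq> a' \<Colon> A\<rbrakk>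
    \<Longrightarrow> \<Gamma> \<turnstile> App A B f a \<doteq> App A' B' f' a' \<Colon> instJ B a"
| App_beta: "\<lbrakk>\<Gamma> \<turnstile>\<^sub>J A; A # \<Gamma> \<turnstile>\<^sub>J B; A # \<Gamma> \<turnstile> b \<Colon> B; \<Gamma> \<turnstile> a \<Colon> A\<rbrakk>
    \<Longrightarrow> \<Gamma> \<turnstile> App A B (Lam A B b) a \<doteq> instT b a \<Colon> instJ B a"
| Lam_eta: "\<lbrakk>\<Gamma> \<turnstile>\<^sub>J A; A # \<Gamma> \<turnstile>\<^sub>J B; \<Gamma> \<turnstile> f \<Colon> JPi A B\<rbrakk>
    \<Longrightarrow> \<Gamma> \<turnstile> Lam A B (App (wkJ A) (renJ (up_ren Suc) B) (wkT f) (Var 0)) \<doteq> f \<Colon> JPi A B"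

| JSigma: "\<lbrakk>\<Gamma> \<turnstile>\<^sub>J A; A # \<Gamma> \<turnstile>\<^sub>J B\<rbrakk> \<Longrightarrow> \<Gamma> \<turnstile>\<^sub>J JSigma A B"
| JSigma_cong: "\<lbrakk>\<Gamma> \<turnstile>\<^sub>J A; \<Gamma> \<turnstile>\<^sub>J A \<doteq> A'; A # \<Gamma> \<turnstile>\<^sub>J B \<doteq> B'\<rbrakk> \<Longrightarrow> \<Gamma> \<turnstile>\<^sub>J JSigma A B \<doteq> JSigma A' B'"
| Pair: "\<lbrakk>\<Gamma> \<turnstile>\<^sub>J A; A # \<Gamma> \<turnstile>\<^sub>J B; \<Gamma> \<turnstile> a \<Colon> A; \<Gamma> \<turnstile> b \<Colon> instJ B a\<rbrakk>
    \<Longrightarrow> \<Gamma> \<turnstile> Pair A B a b \<Colon> JSigma A B"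
| Pair_cong: "\<lbrakk>\<Gamma> \<turnstile>\<^sub>J A; \<Gamma> \<turnstile>\<^sub>J A \<doteq> A'; A # \<Gamma> \<turnstile>\<^sub>J B \<doteq> B'; \<Gamma> \<turnstile> a \<doteq> a' \<Colon> A; \<Gamma> \<turnstile> b \<doteq> b' \<Colon> instJ B a\<rbrakk>
    \<Longrightarrow> \<Gamma> \<turnstile> Pair A B a b \<doteq> Pair A' B' a' b' \<Colon> JSigma A B"
| Fst: "\<lbrakk>\<Gamma> \<turnstile>\<^sub>J A; A # \<Gamma> \<turnstile>\<^sub>J B; \<Gamma> \<turnstile> p \<Colon> JSigma A B\<rbrakk> \<Longrightarrow> \<Gamma> \<turnstile> Fst A B p \<Colon> A"
| Fst_cong: "\<lbrakk>\<Gamma> \<turnstile>\<^sub>J A; \<Gamma> \<turnstile>\<^sub>J A \<doteq> A'; A # \<Gamma> \<turnstile>\<^sub>J B \<doteq> B'; \<Gamma> \<turnstile> p \<doteq> p' \<Colon> JSigma A B\<rbrakk>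
    \<Longrightarrow> \<Gamma> \<turnstile> Fst A B p \<doteq> Fst A' B' p' \<Colon> A"
| Snd: "\<lbrakk>\<Gamma> \<turnstile>\<^sub>J A; A # \<Gamma> \<turnstile>\<^sub>J B; \<Gamma> \<turnstile> p \<Colon> JSigma A B\<rbrakk> \<Longrightarrow> \<Gamma> \<turnstile> Snd A B p \<Colon> instJ B (Fst A B p)"
| Snd_cong: "\<lbrakk>\<Gamma> \<turnstile>\<^sub>J A; \<Gamma> \<turnstile>\<^sub>J A \<doteq> A'; A # \<Gamma> \<turnstile>\<^sub>J B \<doteq> B'; \<Gamma> \<turnstile> p \<doteq> p' \<Colon> JSigma A B\<rbrakk>
    \<Longrightarrow> \<Gamma> \<turnstile> Snd A B p \<doteq> Snd A' B' p' \<Colon> instJ B (Fst A B p)"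
| Fst_beta: "\<lbrakk>\<Gamma> \<turnstile>\<^sub>J A; A # \<Gamma> \<turnstile>\<^sub>J B; \<Gamma> \<turnstile> a \<Colon> A; \<Gamma> \<turnstile> b \<Colon> instJ B a\<rbrakk>
    \<Longrightarrow> \<Gamma> \<turnstile> Fst A B (Pair A B a b) \<doteq> a \<Colon> A"
| Snd_beta: "\<lbrakk>\<Gamma> \<turnstile>\<^sub>J A; A # \<Gamma> \<turnstile>\<^sub>J B; \<Gamma> \<turnstile> a \<Colon> A; \<Gamma> \<turnstile> b \<Colon> instJ B a\<rbrakk>
    \<Longrightarrow> \<Gamma> \<turnstile> Snd A B (Pair A B a b) \<doteq> b \<Colon> instJ B a"
| Pair_eta: "\<lbrakk>\<Gamma> \<turnstile>\<^sub>J A; A # \<Gamma> \<turnstile>\<^sub>J B; \<Gamma> \<turnstile> p \<Colon> JSigma A B\<rbrakk>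
    \<Longrightarrow> \<Gamma> \<turnstile> Pair A B (Fst A B p) (Snd A B p) \<doteq> p \<Colon> JSigma A B"

| JEq: "\<lbrakk>\<Gamma> \<turnstile>\<^sub>J A; \<Gamma> \<turnstile> a \<Colon> A; \<Gamma> \<turnstile> b \<Colon> A\<rbrakk> \<Longrightarrow> \<Gamma> \<turnstile>\<^sub>J JEq A a b"
| JEq_cong: "\<lbrakk>\<Gamma> \<turnstile>\<^sub>J A \<doteq> A'; \<Gamma> \<turnstile> a \<doteq> a' \<Colon> A; \<Gamma> \<turnstile> b \<doteq> b' \<Colon> A\<rbrakk> \<Longrightarrow> \<Gamma> \<turnstile>\<^sub>J JEq A a b \<doteq> JEq A' a' b'"
| Refl: "\<lbrakk>\<Gamma> \<turnstile>\<^sub>J A; \<Gamma> \<turnstile> a \<Colon> A\<rbrakk> \<Longrightarrow> \<Gamma> \<turnstile> Refl A a \<Colon> JEq A a a"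
| Refl_cong: "\<lbrakk>\<Gamma> \<turnstile>\<^sub>J A \<doteq> A'; \<Gamma> \<turnstile> a \<doteq> a' \<Colon> A\<rbrakk> \<Longrightarrow> \<Gamma> \<turnstile> Refl A a \<doteq> Refl A' a' \<Colon> JEq A a a"
| reflection: "\<lbrakk>\<Gamma> \<turnstile>\<^sub>J A; \<Gamma> \<turnstile> a \<Colon> A; \<Gamma> \<turnstile> b \<Colon> A; \<Gamma> \<turnstile> p \<Colon> JEq A a b\<rbrakk> \<Longrightarrow> \<Gamma> \<turnstile> a \<doteq> b \<Colon> A"
| Refl_eta: "\<lbrakk>\<Gamma> \<turnstile>\<^sub>J A; \<Gamma> \<turnstile> a \<Colon> A; \<Gamma> \<turnstile> b \<Colon> A; \<Gamma> \<turnstile> p \<Colon> JEq A a b\<rbrakk> \<Longrightarrow> \<Gamma> \<turnstile> p \<doteq> Refl A a \<Colon> JEq A a b"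

| TpPos: "\<turnstile>\<^sub>C \<Gamma> \<Longrightarrow> \<Gamma> \<turnstile>\<^sub>J TpPos"
| TpNeg: "\<turnstile>\<^sub>C \<Gamma> \<Longrightarrow> \<Gamma> \<turnstile>\<^sub>J TpNeg"
| TmPos: "\<Gamma> \<turnstile> A \<Colon> TpPos \<Longrightarrow> \<Gamma> \<turnstile>\<^sub>J TmPos A"
| TmPos_cong: "\<Gamma> \<turnstile> A \<doteq> A' \<Colon> TpPos \<Longrightarrow> \<Gamma> \<turnstile>\<^sub>J TmPos A \<doteq> TmPos A'"
| U: "\<Gamma> \<turnstile> X \<Colon> TpNeg \<Longrightarrow> \<Gamma> \<turnstile> U X \<Colon> TpPos"
| U_cong: "\<Gamma> \<turnstile> X \<doteq> X' \<Colon> TpNeg \<Longrightarrow> \<Gamma> \<turnstile> U X \<doteq> U X' \<Colon> TpPos"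
| F: "\<Gamma> \<turnstile> A \<Colon> TpPos \<Longrightarrow> \<Gamma> \<turnstile> F A \<Colon> TpNeg"
| F_cong: "\<Gamma> \<turnstile> A \<doteq> A' \<Colon> TpPos \<Longrightarrow> \<Gamma> \<turnstile> F A \<doteq> F A' \<Colon> TpNeg"
| Ret: "\<lbrakk>\<Gamma> \<turnstile> A \<Colon> TpPos; \<Gamma> \<turnstile> a \<Colon> TmPos A\<rbrakk> \<Longrightarrow> \<Gamma> \<turnstile> Ret A a \<Colon> TmNeg (F A)"
| Ret_cong: "\<lbrakk>\<Gamma> \<turnstile> A \<doteq> A' \<Colon> TpPos; \<Gamma> \<turnstile> a \<doteq> a' \<Colon> TmPos A\<rbrakk> \<Longrightarrow> \<Gamma> \<turnstile> Ret A a \<doteq> Ret A' a' \<Colon> TmNeg (F A)"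
| Bind: "\<lbrakk>\<Gamma> \<turnstile> A \<Colon> TpPos; \<Gamma> \<turnstile> X \<Colon> TpNeg; \<Gamma> \<turnstile> e \<Colon> TmNeg (F A); \<Gamma> \<turnstile> f \<Colon> Arr (TmPos A) (TmNeg X)\<rbrakk>
    \<Longrightarrow> \<Gamma> \<turnstile> Bind A X e f \<Colon> TmNeg X"
| Bind_cong: "\<lbrakk>\<Gamma> \<turnstile> A \<doteq> A' \<Colon> TpPos; \<Gamma> \<turnstile> X \<doteq> X' \<Colon> TpNeg; \<Gamma> \<turnstile> e \<doteq> e' \<Colon> TmNeg (F A);
      \<Gamma> \<turnstile> f \<doteq> f' \<Colon> Arr (TmPos A) (TmNeg X)\<rbrakk>
    \<Longrightarrow> \<Gamma> \<turnstile> Bind A X e f \<doteq> Bind A' X' e' f' \<Colon> TmNeg X"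
| Bind_Ret: "\<lbrakk>\<Gamma> \<turnstile> A \<Colon> TpPos; \<Gamma> \<turnstile> X \<Colon> TpNeg; \<Gamma> \<turnstile> a \<Colon> TmPos A; \<Gamma> \<turnstile> f \<Colon> Arr (TmPos A) (TmNeg X)\<rbrakk>
    \<Longrightarrow> \<Gamma> \<turnstile> Bind A X (Ret A a) f \<doteq> app (TmPos A) (TmNeg X) f a \<Colon> TmNeg X"
| Bind_eta: "\<lbrakk>\<Gamma> \<turnstile> A \<Colon> TpPos; \<Gamma> \<turnstile> e \<Colon> TmNeg (F A)\<rbrakk>
    \<Longrightarrow> \<Gamma> \<turnstile> Bind A (F A) e (Lam (TmPos A) (wkJ (TmNeg (F A))) (Ret (wkT A) (Var 0))) \<doteq> e \<Colon> TmNeg (F A)"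
| Bind_assoc: "\<lbrakk>\<Gamma> \<turnstile> A \<Colon> TpPos; \<Gamma> \<turnstile> B \<Colon> TpPos; \<Gamma> \<turnstile> X \<Colon> TpNeg; \<Gamma> \<turnstile> e \<Colon> TmNeg (F A);
      \<Gamma> \<turnstile> f \<Colon> Arr (TmPos A) (TmNeg (F B)); \<Gamma> \<turnstile> g \<Colon> Arr (TmPos B) (TmNeg X)\<rbrakk>
    \<Longrightarrow> \<Gamma> \<turnstile> Bind B X (Bind A (F B) e f) g \<doteq>
          Bind A X e (Lam (TmPos A) (wkJ (TmNeg X))
            (Bind (wkT B) (wkT X)
              (app (wkJ (TmPos A)) (wkJ (TmNeg (F B))) (wkT f) (Var 0)) (wkT g))) \<Colon> TmNeg X"

| Step: "\<lbrakk>\<Gamma> \<turnstile> X \<Colon> TpNeg; \<Gamma> \<turnstile> e \<Colon> TmNeg X\<rbrakk> \<Longrightarrow> \<Gamma> \<turnstile> Step X c e \<Colon> TmNeg X"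
| Step_cong: "\<lbrakk>\<Gamma> \<turnstile> X \<doteq> X' \<Colon> TpNeg; \<Gamma> \<turnstile> e \<doteq> e' \<Colon> TmNeg X\<rbrakk> \<Longrightarrow> \<Gamma> \<turnstile> Step X c e \<doteq> Step X' c e' \<Colon> TmNeg X"
| Step_0: "\<lbrakk>\<Gamma> \<turnstile> X \<Colon> TpNeg; \<Gamma> \<turnstile> e \<Colon> TmNeg X\<rbrakk> \<Longrightarrow> \<Gamma> \<turnstile> Step X 0 e \<doteq> e \<Colon> TmNeg X"
| Step_add: "\<lbrakk>\<Gamma> \<turnstile> X \<Colon> TpNeg; \<Gamma> \<turnstile> e \<Colon> TmNeg X\<rbrakk>
    \<Longrightarrow> \<Gamma> \<turnstile> Step X c1 (Step X c2 e) \<doteq> Step X (c1 + c2) e \<Colon> TmNeg X"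

| Beh: "\<turnstile>\<^sub>C \<Gamma> \<Longrightarrow> \<Gamma> \<turnstile>\<^sub>J Beh"
| Beh_unique: "\<lbrakk>\<Gamma> \<turnstile> u \<Colon> Beh; \<Gamma> \<turnstile> v \<Colon> Beh\<rbrakk> \<Longrightarrow> \<Gamma> \<turnstile> u \<doteq> v \<Colon> Beh"
| Step_Beh: "\<lbrakk>\<Gamma> \<turnstile> z \<Colon> Beh; \<Gamma> \<turnstile> X \<Colon> TpNeg; \<Gamma> \<turnstile> e \<Colon> TmNeg X\<rbrakk> \<Longrightarrow> \<Gamma> \<turnstile> Step X c e \<doteq> e \<Colon> TmNeg X"

| Open: "\<Gamma> \<turnstile> A \<Colon> TpPos \<Longrightarrow> \<Gamma> \<turnstile> Open A \<Colon> TpPos"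
| Open_cong: "\<Gamma> \<turnstile> A \<doteq> A' \<Colon> TpPos \<Longrightarrow> \<Gamma> \<turnstile> Open A \<doteq> Open A' \<Colon> TpPos"
| ApOpen: "\<lbrakk>\<Gamma> \<turnstile> A \<Colon> TpPos; \<Gamma> \<turnstile> u \<Colon> TmPos (Open A)\<rbrakk> \<Longrightarrow> \<Gamma> \<turnstile> ApOpen A u \<Colon> Arr Beh (TmPos A)"
| ApOpen_cong: "\<lbrakk>\<Gamma> \<turnstile> A \<doteq> A' \<Colon> TpPos; \<Gamma> \<turnstile> u \<doteq> u' \<Colon> TmPos (Open A)\<rbrakk>
    \<Longrightarrow> \<Gamma> \<turnstile> ApOpen A u \<doteq> ApOpen A' u' \<Colon> Arr Beh (TmPos A)"
| LamOpen: "\<lbrakk>\<Gamma> \<turnstile> A \<Colon> TpPos; \<Gamma> \<turnstile> f \<Colon> Arr Beh (TmPos A)\<rbrakk> \<Longrightarrow> \<Gamma> \<turnstile> LamOpen A f \<Colon> TmPos (Open A)"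
| LamOpen_cong: "\<lbrakk>\<Gamma> \<turnstile> A \<doteq> A' \<Colon> TpPos; \<Gamma> \<turnstile> f \<doteq> f' \<Colon> Arr Beh (TmPos A)\<rbrakk>
    \<Longrightarrow> \<Gamma> \<turnstile> LamOpen A f \<doteq> LamOpen A' f' \<Colon> TmPos (Open A)"
| Open_beta: "\<lbrakk>\<Gamma> \<turnstile> A \<Colon> TpPos; \<Gamma> \<turnstile> f \<Colon> Arr Beh (TmPos A)\<rbrakk>
    \<Longrightarrow> \<Gamma> \<turnstile> ApOpen A (LamOpen A f) \<doteq> f \<Colon> Arr Beh (TmPos A)"
| Open_eta: "\<lbrakk>\<Gamma> \<turnstile> A \<Colon> TpPos; \<Gamma> \<turnstile> u \<Colon> TmPos (Open A)\<rbrakk>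
    \<Longrightarrow> \<Gamma> \<turnstile> LamOpen A (ApOpen A u) \<doteq> u \<Colon> TmPos (Open A)"

| Closed: "\<Gamma> \<turnstile> A \<Colon> TpPos \<Longrightarrow> \<Gamma> \<turnstile> Closed A \<Colon> TpPos"
| Closed_cong: "\<Gamma> \<turnstile> A \<doteq> A' \<Colon> TpPos \<Longrightarrow> \<Gamma> \<turnstile> Closed A \<doteq> Closed A' \<Colon> TpPos"
| Eta: "\<lbrakk>\<Gamma> \<turnstile> A \<Colon> TpPos; \<Gamma> \<turnstile> a \<Colon> TmPos A\<rbrakk> \<Longrightarrow> \<Gamma> \<turnstile> Eta A a \<Colon> TmPos (Closed A)"
| Eta_cong: "\<lbrakk>\<Gamma> \<turnstile> A \<doteq> A' \<Colon> TpPos; \<Gamma> \<turnstile> a \<doteq> a' \<Colon> TmPos A\<rbrakk> \<Longrightarrow> \<Gamma> \<turnstile> Eta A a \<doteq> Eta A' a' \<Colon> TmPos (Closed A)"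
| Star: "\<lbrakk>\<Gamma> \<turnstile> A \<Colon> TpPos; \<Gamma> \<turnstile> z \<Colon> Beh\<rbrakk> \<Longrightarrow> \<Gamma> \<turnstile> Star A z \<Colon> TmPos (Closed A)"
| Star_cong: "\<lbrakk>\<Gamma> \<turnstile> A \<doteq> A' \<Colon> TpPos; \<Gamma> \<turnstile> z \<doteq> z' \<Colon> Beh\<rbrakk> \<Longrightarrow> \<Gamma> \<turnstile> Star A z \<doteq> Star A' z' \<Colon> TmPos (Closed A)"
| Eta_Star: "\<lbrakk>\<Gamma> \<turnstile> A \<Colon> TpPos; \<Gamma> \<turnstile> a \<Colon> TmPos A; \<Gamma> \<turnstile> z \<Colon> Beh\<rbrakk>
    \<Longrightarrow> \<Gamma> \<turnstile> Eta A a \<doteq> Star A z \<Colon> TmPos (Closed A)"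
| IndClosed: "\<lbrakk>\<Gamma> \<turnstile> A \<Colon> TpPos; \<Gamma> \<turnstile> b \<Colon> TmPos (Closed A); \<Gamma> \<turnstile> X \<Colon> Arr (TmPos (Closed A)) TpNeg;
      \<Gamma> \<turnstile> x0 \<Colon> JPi (TmPos A) (atEta A X); \<Gamma> \<turnstile> x1 \<Colon> JPi Beh (atStar A X);
      \<Gamma> \<turnstile> h \<Colon> glue A X x0 x1\<rbrakk>
    \<Longrightarrow> \<Gamma> \<turnstile> IndClosed A b X x0 x1 h \<Colon> TmNeg (atNeg (Closed A) X b)"
| IndClosed_cong: "\<lbrakk>\<Gamma> \<turnstile> A \<doteq> A' \<Colon> TpPos; \<Gamma> \<turnstile> b \<doteq> b' \<Colon> TmPos (Closed A);
      \<Gamma> \<turnstile> X \<doteq> X' \<Colon> Arr (TmPos (Closed A)) TpNeg;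
      \<Gamma> \<turnstile> x0 \<doteq> x0' \<Colon> JPi (TmPos A) (atEta A X); \<Gamma> \<turnstile> x1 \<doteq> x1' \<Colon> JPi Beh (atStar A X);
      \<Gamma> \<turnstile> h \<doteq> h' \<Colon> glue A X x0 x1\<rbrakk>
    \<Longrightarrow> \<Gamma> \<turnstile> IndClosed A b X x0 x1 h \<doteq> IndClosed A' b' X' x0' x1' h' \<Colon> TmNeg (atNeg (Closed A) X b)"
| IndClosed_Eta: "\<lbrakk>\<Gamma> \<turnstile> A \<Colon> TpPos; \<Gamma> \<turnstile> a \<Colon> TmPos A; \<Gamma> \<turnstile> X \<Colon> Arr (TmPos (Closed A)) TpNeg;
      \<Gamma> \<turnstile> x0 \<Colon> JPi (TmPos A) (atEta A X); \<Gamma> \<turnstile> x1 \<Colon> JPi Beh (atStar A X);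
      \<Gamma> \<turnstile> h \<Colon> glue A X x0 x1\<rbrakk>
    \<Longrightarrow> \<Gamma> \<turnstile> IndClosed A (Eta A a) X x0 x1 h \<doteq> App (TmPos A) (atEta A X) x0 a
          \<Colon> TmNeg (atNeg (Closed A) X (Eta A a))"
| IndClosed_Star: "\<lbrakk>\<Gamma> \<turnstile> A \<Colon> TpPos; \<Gamma> \<turnstile> z \<Colon> Beh; \<Gamma> \<turnstile> X \<Colon> Arr (TmPos (Closed A)) TpNeg;
      \<Gamma> \<turnstile> x0 \<Colon> JPi (TmPos A) (atEta A X); \<Gamma> \<turnstile> x1 \<Colon> JPi Beh (atStar A X);
      \<Gamma> \<turnstile> h \<Colon> glue A X x0 x1\<rbrakk>
    \<Longrightarrow> \<Gamma> \<turnstile> IndClosed A (Star A z) X x0 x1 h \<doteq> App Beh (atStar A X) x1 z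
          \<Colon> TmNeg (atNeg (Closed A) X (Star A z))"

| PiT: "\<lbrakk>\<Gamma> \<turnstile> A \<Colon> TpPos; \<Gamma> \<turnstile> X \<Colon> Arr (TmPos A) TpNeg\<rbrakk> \<Longrightarrow> \<Gamma> \<turnstile> PiT A X \<Colon> TpNeg"
| PiT_cong: "\<lbrakk>\<Gamma> \<turnstile> A \<doteq> A' \<Colon> TpPos; \<Gamma> \<turnstile> X \<doteq> X' \<Colon> Arr (TmPos A) TpNeg\<rbrakk> \<Longrightarrow> \<Gamma> \<turnstile> PiT A X \<doteq> PiT A' X' \<Colon> TpNeg"
| Ap: "\<lbrakk>\<Gamma> \<turnstile> A \<Colon> TpPos; \<Gamma> \<turnstile> X \<Colon> Arr (TmPos A) TpNeg; \<Gamma> \<turnstile> u \<Colon> TmNeg (PiT A X)\<rbrakk>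
    \<Longrightarrow> \<Gamma> \<turnstile> Ap A X u \<Colon> JPi (TmPos A) (famNeg A X)"
| Ap_cong: "\<lbrakk>\<Gamma> \<turnstile> A \<doteq> A' \<Colon> TpPos; \<Gamma> \<turnstile> X \<doteq> X' \<Colon> Arr (TmPos A) TpNeg; \<Gamma> \<turnstile> u \<doteq> u' \<Colon> TmNeg (PiT A X)\<rbrakk>
    \<Longrightarrow> \<Gamma> \<turnstile> Ap A X u \<doteq> Ap A' X' u' \<Colon> JPi (TmPos A) (famNeg A X)"
| LamT: "\<lbrakk>\<Gamma> \<turnstile> A \<Colon> TpPos; \<Gamma> \<turnstile> X \<Colon> Arr (TmPos A) TpNeg; \<Gamma> \<turnstile> f \<Colon> JPi (TmPos A) (famNeg A X)\<rbrakk>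
    \<Longrightarrow> \<Gamma> \<turnstile> LamT A X f \<Colon> TmNeg (PiT A X)"
| LamT_cong: "\<lbrakk>\<Gamma> \<turnstile> A \<doteq> A' \<Colon> TpPos; \<Gamma> \<turnstile> X \<doteq> X' \<Colon> Arr (TmPos A) TpNeg;
      \<Gamma> \<turnstile> f \<doteq> f' \<Colon> JPi (TmPos A) (famNeg A X)\<rbrakk>
    \<Longrightarrow> \<Gamma> \<turnstile> LamT A X f \<doteq> LamT A' X' f' \<Colon> TmNeg (PiT A X)"
| PiT_beta: "\<lbrakk>\<Gamma> \<turnstile> A \<Colon> TpPos; \<Gamma> \<turnstile> X \<Colon> Arr (TmPos A) TpNeg; \<Gamma> \<turnstile> f \<Colon> JPi (TmPos A) (famNeg A X)\<rbrakk>
    \<Longrightarrow> \<Gamma> \<turnstile> Ap A X (LamT A X f) \<doteq> f \<Colon> JPi (TmPos A) (famNeg A X)"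
| PiT_eta: "\<lbrakk>\<Gamma> \<turnstile> A \<Colon> TpPos; \<Gamma> \<turnstile> X \<Colon> Arr (TmPos A) TpNeg; \<Gamma> \<turnstile> u \<Colon> TmNeg (PiT A X)\<rbrakk>
    \<Longrightarrow> \<Gamma> \<turnstile> LamT A X (Ap A X u) \<doteq> u \<Colon> TmNeg (PiT A X)"
| SigmaT: "\<lbrakk>\<Gamma> \<turnstile> A \<Colon> TpPos; \<Gamma> \<turnstile> B \<Colon> Arr (TmPos A) TpPos\<rbrakk> \<Longrightarrow> \<Gamma> \<turnstile> SigmaT A B \<Colon> TpPos"
| SigmaT_cong: "\<lbrakk>\<Gamma> \<turnstile> A \<doteq> A' \<Colon> TpPos; \<Gamma> \<turnstile> B \<doteq> B' \<Colon> Arr (TmPos A) TpPos\<rbrakk>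
    \<Longrightarrow> \<Gamma> \<turnstile> SigmaT A B \<doteq> SigmaT A' B' \<Colon> TpPos"
| Unpair: "\<lbrakk>\<Gamma> \<turnstile> A \<Colon> TpPos; \<Gamma> \<turnstile> B \<Colon> Arr (TmPos A) TpPos; \<Gamma> \<turnstile> u \<Colon> TmPos (SigmaT A B)\<rbrakk>
    \<Longrightarrow> \<Gamma> \<turnstile> Unpair A B u \<Colon> JSigma (TmPos A) (famPos A B)"
| Unpair_cong: "\<lbrakk>\<Gamma> \<turnstile> A \<doteq> A' \<Colon> TpPos; \<Gamma> \<turnstile> B \<doteq> B' \<Colon> Arr (TmPos A) TpPos; \<Gamma> \<turnstile> u \<doteq> u' \<Colon> TmPos (SigmaT A B)\<rbrakk>
    \<Longrightarrow> \<Gamma> \<turnstile> Unpair A B u \<doteq> Unpair A' B' u' \<Colon> JSigma (TmPos A) (famPos A B)"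
| PairT: "\<lbrakk>\<Gamma> \<turnstile> A \<Colon> TpPos; \<Gamma> \<turnstile> B \<Colon> Arr (TmPos A) TpPos; \<Gamma> \<turnstile> p \<Colon> JSigma (TmPos A) (famPos A B)\<rbrakk>
    \<Longrightarrow> \<Gamma> \<turnstile> PairT A B p \<Colon> TmPos (SigmaT A B)"
| PairT_cong: "\<lbrakk>\<Gamma> \<turnstile> A \<doteq> A' \<Colon> TpPos; \<Gamma> \<turnstile> B \<doteq> B' \<Colon> Arr (TmPos A) TpPos;
      \<Gamma> \<turnstile> p \<doteq> p' \<Colon> JSigma (TmPos A) (famPos A B)\<rbrakk>
    \<Longrightarrow> \<Gamma> \<turnstile> PairT A B p \<doteq> PairT A' B' p' \<Colon> TmPos (SigmaT A B)"
| SigmaT_beta: "\<lbrakk>\<Gamma> \<turnstile> A \<Colon> TpPos; \<Gamma> \<turnstile> B \<Colon> Arr (TmPos A) TpPos; \<Gamma> \<turnstile> p \<Colon> JSigma (TmPos A) (famPos A B)\<rbrakk>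
    \<Longrightarrow> \<Gamma> \<turnstile> Unpair A B (PairT A B p) \<doteq> p \<Colon> JSigma (TmPos A) (famPos A B)"
| SigmaT_eta: "\<lbrakk>\<Gamma> \<turnstile> A \<Colon> TpPos; \<Gamma> \<turnstile> B \<Colon> Arr (TmPos A) TpPos; \<Gamma> \<turnstile> u \<Colon> TmPos (SigmaT A B)\<rbrakk>
    \<Longrightarrow> \<Gamma> \<turnstile> PairT A B (Unpair A B u) \<doteq> u \<Colon> TmPos (SigmaT A B)"

| EqT: "\<lbrakk>\<Gamma> \<turnstile> A \<Colon> TpPos; \<Gamma> \<turnstile> a \<Colon> TmPos A; \<Gamma> \<turnstile> b \<Colon> TmPos A\<rbrakk> \<Longrightarrow> \<Gamma> \<turnstile> EqT A a b \<Colon> TpPos"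
| EqT_cong: "\<lbrakk>\<Gamma> \<turnstile> A \<doteq> A' \<Colon> TpPos; \<Gamma> \<turnstile> a \<doteq> a' \<Colon> TmPos A; \<Gamma> \<turnstile> b \<doteq> b' \<Colon> TmPos A\<rbrakk>
    \<Longrightarrow> \<Gamma> \<turnstile> EqT A a b \<doteq> EqT A' a' b' \<Colon> TpPos"
| RefT: "\<lbrakk>\<Gamma> \<turnstile> A \<Colon> TpPos; \<Gamma> \<turnstile> a \<Colon> TmPos A; \<Gamma> \<turnstile> b \<Colon> TmPos A; \<Gamma> \<turnstile> p \<Colon> JEq (TmPos A) a b\<rbrakk>
    \<Longrightarrow> \<Gamma> \<turnstile> RefT A a b p \<Colon> TmPos (EqT A a b)"
| RefT_cong: "\<lbrakk>\<Gamma> \<turnstile> A \<doteq> A' \<Colon> TpPos; \<Gamma> \<turnstile> a \<doteq> a' \<Colon> TmPos A; \<Gamma> \<turnstile> b \<doteq> b' \<Colon> TmPos A;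
      \<Gamma> \<turnstile> p \<doteq> p' \<Colon> JEq (TmPos A) a b\<rbrakk>
    \<Longrightarrow> \<Gamma> \<turnstile> RefT A a b p \<doteq> RefT A' a' b' p' \<Colon> TmPos (EqT A a b)"
| SelfT: "\<lbrakk>\<Gamma> \<turnstile> A \<Colon> TpPos; \<Gamma> \<turnstile> a \<Colon> TmPos A; \<Gamma> \<turnstile> b \<Colon> TmPos A; \<Gamma> \<turnstile> u \<Colon> TmPos (EqT A a b)\<rbrakk>
    \<Longrightarrow> \<Gamma> \<turnstile> SelfT A a b u \<Colon> JEq (TmPos A) a b"
| SelfT_cong: "\<lbrakk>\<Gamma> \<turnstile> A \<doteq> A' \<Colon> TpPos; \<Gamma> \<turnstile> a \<doteq> a' \<Colon> TmPos A; \<Gamma> \<turnstile> b \<doteq> b' \<Colon> TmPos A;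
      \<Gamma> \<turnstile> u \<doteq> u' \<Colon> TmPos (EqT A a b)\<rbrakk>
    \<Longrightarrow> \<Gamma> \<turnstile> SelfT A a b u \<doteq> SelfT A' a' b' u' \<Colon> JEq (TmPos A) a b"
| EqT_beta: "\<lbrakk>\<Gamma> \<turnstile> A \<Colon> TpPos; \<Gamma> \<turnstile> a \<Colon> TmPos A; \<Gamma> \<turnstile> b \<Colon> TmPos A; \<Gamma> \<turnstile> p \<Colon> JEq (TmPos A) a b\<rbrakk>
    \<Longrightarrow> \<Gamma> \<turnstile> SelfT A a b (RefT A a b p) \<doteq> p \<Colon> JEq (TmPos A) a b"
| EqT_eta: "\<lbrakk>\<Gamma> \<turnstile> A \<Colon> TpPos; \<Gamma> \<turnstile> a \<Colon> TmPos A; \<Gamma> \<turnstile> b \<Colon> TmPos A; \<Gamma> \<turnstile> u \<Colon> TmPos (EqT A a b)\<rbrakk>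
    \<Longrightarrow> \<Gamma> \<turnstile> RefT A a b (SelfT A a b u) \<doteq> u \<Colon> TmPos (EqT A a b)"

| NatT: "\<turnstile>\<^sub>C \<Gamma> \<Longrightarrow> \<Gamma> \<turnstile> NatT \<Colon> TpPos"
| Zero: "\<turnstile>\<^sub>C \<Gamma> \<Longrightarrow> \<Gamma> \<turnstile> Zero \<Colon> TmPos NatT"
| Succ: "\<Gamma> \<turnstile> n \<Colon> TmPos NatT \<Longrightarrow> \<Gamma> \<turnstile> Succ n \<Colon> TmPos NatT"
| Succ_cong: "\<Gamma> \<turnstile> n \<doteq> n' \<Colon> TmPos NatT \<Longrightarrow> \<Gamma> \<turnstile> Succ n \<doteq> Succ n' \<Colon> TmPos NatT"
| IndNat: "\<lbrakk>\<Gamma> \<turnstile> n \<Colon> TmPos NatT; \<Gamma> \<turnstile> X \<Colon> Arr (TmPos NatT) TpNeg; \<Gamma> \<turnstile> e0 \<Colon> TmNeg (atNeg NatT X Zero);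
      \<Gamma> \<turnstile> e1 \<Colon> JPi (TmPos NatT) (indStep X)\<rbrakk>
    \<Longrightarrow> \<Gamma> \<turnstile> IndNat n X e0 e1 \<Colon> TmNeg (atNeg NatT X n)"
| IndNat_cong: "\<lbrakk>\<Gamma> \<turnstile> n \<doteq> n' \<Colon> TmPos NatT; \<Gamma> \<turnstile> X \<doteq> X' \<Colon> Arr (TmPos NatT) TpNeg;
      \<Gamma> \<turnstile> e0 \<doteq> e0' \<Colon> TmNeg (atNeg NatT X Zero); \<Gamma> \<turnstile> e1 \<doteq> e1' \<Colon> JPi (TmPos NatT) (indStep X)\<rbrakk>
    \<Longrightarrow> \<Gamma> \<turnstile> IndNat n X e0 e1 \<doteq> IndNat n' X' e0' e1' \<Colon> TmNeg (atNeg NatT X n)"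
| IndNat_Zero: "\<lbrakk>\<Gamma> \<turnstile> X \<Colon> Arr (TmPos NatT) TpNeg; \<Gamma> \<turnstile> e0 \<Colon> TmNeg (atNeg NatT X Zero);
      \<Gamma> \<turnstile> e1 \<Colon> JPi (TmPos NatT) (indStep X)\<rbrakk>
    \<Longrightarrow> \<Gamma> \<turnstile> IndNat Zero X e0 e1 \<doteq> e0 \<Colon> TmNeg (atNeg NatT X Zero)"
| IndNat_Succ: "\<lbrakk>\<Gamma> \<turnstile> n \<Colon> TmPos NatT; \<Gamma> \<turnstile> X \<Colon> Arr (TmPos NatT) TpNeg; \<Gamma> \<turnstile> e0 \<Colon> TmNeg (atNeg NatT X Zero);
      \<Gamma> \<turnstile> e1 \<Colon> JPi (TmPos NatT) (indStep X)\<rbrakk>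
    \<Longrightarrow> \<Gamma> \<turnstile> IndNat (Succ n) X e0 e1 \<doteq>
          app (TmNeg (atNeg NatT X n)) (TmNeg (atNeg NatT X (Succ n)))
            (App (TmPos NatT) (indStep X) e1 n) (IndNat n X e0 e1)
          \<Colon> TmNeg (atNeg NatT X (Succ n))"

| Ap_Step: "\<lbrakk>\<Gamma> \<turnstile> A \<Colon> TpPos; \<Gamma> \<turnstile> X \<Colon> Arr (TmPos A) TpNeg; \<Gamma> \<turnstile> f \<Colon> TmNeg (PiT A X); \<Gamma> \<turnstile> a \<Colon> TmPos A\<rbrakk>
    \<Longrightarrow> \<Gamma> \<turnstile> App (TmPos A) (famNeg A X) (Ap A X (Step (PiT A X) c f)) a \<doteq>
          Step (atNeg A X a) c (App (TmPos A) (famNeg A X) (Ap A X f) a) \<Colon> TmNeg (atNeg A X a)"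
| Bind_Step: "\<lbrakk>\<Gamma> \<turnstile> A \<Colon> TpPos; \<Gamma> \<turnstile> X \<Colon> TpNeg; \<Gamma> \<turnstile> e \<Colon> TmNeg (F A); \<Gamma> \<turnstile> f \<Colon> Arr (TmPos A) (TmNeg X)\<rbrakk>
    \<Longrightarrow> \<Gamma> \<turnstile> Bind A X (Step (F A) c e) f \<doteq> Step X c (Bind A X e f) \<Colon> TmNeg X"

section \<open>The category of judgments\<close>

text \<open>
  Objects are the closed judgments, i.e. the \<open>J\<close> with \<open>[] \<turnstile>\<^sub>J J\<close>, with terminal object
  \<open>JUnit\<close>.  A morphism from \<open>J1\<close> to \<open>J2\<close> is an equivalence class, under judgmental equality, of
  terms of \<open>J2\<close> in the context of one variable of \<open>J1\<close>.
\<close>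

definition judgmental_eq :: "('c::monoid_add) jdg \<Rightarrow> 'c jdg \<Rightarrow> ('c tm \<times> 'c tm) set" where
  "judgmental_eq J1 J2 = {(t, u). [J1] \<turnstile> t \<doteq> u \<Colon> wkJ J2}"

definition hom :: "('c::monoid_add) jdg \<Rightarrow> 'c jdg \<Rightarrow> 'c tm set set" where
  "hom J1 J2 = {t. [J1] \<turnstile> t \<Colon> wkJ J2} // judgmental_eq J1 J2"

definition morphism :: "('c::monoid_add) jdg \<Rightarrow> 'c jdg \<Rightarrow> 'c tm \<Rightarrow> 'c tm set" where
  "morphism J1 J2 t = judgmental_eq J1 J2 `` {t}"

end

theory Submission
  imports Defs
begin

text \<open>
  The proof is by a logical relation on closed raw terms.  A closed value or computation type is assigned
  a predicate on closed terms: an element of \<open>F A\<close> is computable if it is judgmentally equal to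
  \<open>step\<^sup>c(ret(a))\<close> with \<open>a\<close> computable, an element of \<open>nat\<close> if it is equal to a numeral.  Equality reflection
  rules out injectivity of type constructors, so that the predicate is attached to the result of evaluating the
  raw type expression; this is possible because the signature has no large elimination.  The predicates
  extend to a partial equivalence relation on every closed judgment, by recursion on its shape, with
  \<open>Beh\<close> empty.  Every derivation is valid for this relation under related closing substitutions; in
  particular \<open>Beh\<close> has no closed element.  For a term of a judgment that contains no types, validity only depends on
  its class under judgmental equality, so the equations of calf are valid as soon as one of their sides is.
\<close>

section \<open>Substitution\<close>

text \<open>Preservation of typing by evaluation is nowhere available: in
  \<open>App A B (Lam A' B' b) a\<close> the annotations need not match, and equality of two
  \<open>JPi\<close> judgments does not yield equality of their domains. Hence every clause of
  \<open>redP\<close> and \<open>redN\<close> demands judgmental equality with the evaluated type,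
  every clause of \<open>rel\<close> except the empty one at \<open>Beh\<close> contains a
  judgmental equality, and expansion along \<open>ev_le\<close> always comes with an equation. The
  predicate of a dependent type is built from predicates indexed by the computable elements of its
  domain. This inductive-recursive definition is represented by its graph \<open>redP A R\<close>,
  which determinism of evaluation makes functional. The relation is binary because a family of types
  must send equal arguments to types with one and the same predicate. The congruence rules state few
  typings of their right-hand sides. That both sides of an equation are well typed is therefore a
  theorem, and it rests on functionality of substitution. The form step^c(ret(a)) persists because
  costs add up in the monoid and \<open>step\<close> commutes with \<open>bind\<close> and
  \<open>ap\<close>.\<close>

lemma up_ren_simps [simp]: "up_ren r 0 = 0" "up_ren r (Suc i) = Suc (r i)"
  by (simp_all add: up_ren_def)

lemma up_sub_simps [simp]: "up_sub s 0 = Var 0" "up_sub s (Suc i) = wkT (s i)"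
  by (simp_all add: up_sub_def)

lemma single_simps [simp]: "single a 0 = a" "single a (Suc i) = Var i"
  by (simp_all add: single_def)

lemma nat_fun_eqI: "f 0 = g 0 \<Longrightarrow> (\<And>i. f (Suc i) = g (Suc i)) \<Longrightarrow> f = g"
  by (rule ext) (metis not0_implies_Suc)

lemma up_sub_Var: "up_sub (\<lambda>i. Var (r i)) = (\<lambda>i. Var (up_ren r i))"
  by (rule nat_fun_eqI) simp_all

text \<open>Makes composition of renamings an instance of \<open>sub_ren\<close>. The order
  \<open>sub_ren\<close>, \<open>ren_ren\<close>, \<open>ren_sub\<close>, \<open>sub_sub\<close> is
  that of dependence: each law after the first passes through earlier ones, mostly to cross a
  binder.\<close>

lemma ren_as_sub:
  fixes A :: "'c jdg" and t :: "'c tm"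
  shows "renJ r A = subJ (\<lambda>i. Var (r i)) A" and "renT r t = subT (\<lambda>i. Var (r i)) t"
  by (induct A and t arbitrary: r and r) (simp_all add: up_sub_Var)

lemma up_sub_up_ren: "(\<lambda>i. up_sub s (up_ren r i)) = up_sub (\<lambda>i. s (r i))"
  by (rule nat_fun_eqI) simp_all

lemma sub_ren:
  shows "subJ s (renJ r A) = subJ (\<lambda>i. s (r i)) A" and "subT s (renT r t) = subT (\<lambda>i. s (r i)) t"
  by (induct A and t arbitrary: s r and s r) (simp_all add: up_sub_up_ren)

lemma ren_ren:
  "renJ q (renJ r A) = renJ (\<lambda>i. q (r i)) A" "renT q (renT r t) = renT (\<lambda>i. q (r i)) t"
  by (simp_all add: ren_as_sub(1)[of q] ren_as_sub(2)[of q] sub_ren)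
    (simp_all add: ren_as_sub)

lemma up_ren_up_sub: "(\<lambda>i. renT (up_ren r) (up_sub s i)) = up_sub (\<lambda>i. renT r (s i))"
  by (rule nat_fun_eqI) (simp_all add: ren_ren)

lemma ren_sub:
  shows "renJ r (subJ s A) = subJ (\<lambda>i. renT r (s i)) A" and "renT r (subT s t) = subT (\<lambda>i. renT r (s i)) t"
  by (induct A and t arbitrary: s r and s r) (simp_all add: up_ren_up_sub)

lemma up_sub_up_sub: "(\<lambda>i. subT (up_sub s) (up_sub q i)) = up_sub (\<lambda>i. subT s (q i))"
  by (rule nat_fun_eqI) (simp_all add: sub_ren ren_sub)

lemma sub_sub:
  shows "subJ s (subJ q A) = subJ (\<lambda>i. subT s (q i)) A" and "subT s (subT q t) = subT (\<lambda>i. subT s (q i)) t"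
  by (induct A and t arbitrary: s q and s q) (simp_all add: up_sub_up_sub)

lemma up_sub_Var_id: "up_sub Var = Var"
  by (rule nat_fun_eqI) simp_all

lemma sub_Var [simp]:
  fixes A :: "'c jdg" and t :: "'c tm"
  shows "subJ Var A = A" and "subT Var t = t"
  by (induct A and t) (simp_all add: up_sub_Var_id)

lemma sub_case_nat_wk [simp]:
  "subJ (case_nat a s) (wkJ A) = subJ s A" "subT (case_nat a s) (wkT t) = subT s t"
  by (simp_all add: sub_ren)

lemma inst_wk [simp]: "instJ (wkJ A) a = A" "instT (wkT t) a = t"
  by (simp_all add: sub_ren)

lemma sub_up_wk [simp]:
  "subJ (up_sub s) (wkJ A) = wkJ (subJ s A)" "subT (up_sub s) (wkT t) = wkT (subT s t)"
  by (simp_all add: sub_ren ren_sub)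

lemma sub_up_up_wk [simp]:
  "subJ (up_sub (up_sub s)) (renJ (up_ren Suc) A) = renJ (up_ren Suc) (subJ (up_sub s) A)"
  by (simp add: sub_ren ren_sub up_sub_up_ren up_ren_up_sub)

lemma sub_inst:
  "subJ s (instJ B a) = instJ (subJ (up_sub s) B) (subT s a)"
  "subT s (instT b a) = instT (subT (up_sub s) b) (subT s a)"
  by (simp_all add: sub_sub) (rule arg_cong[where f="\<lambda>s. subJ s B"] arg_cong[where f="\<lambda>s. subT s b"],
      rule nat_fun_eqI, simp_all)+

text \<open>Bridge between two presentations of an argument: \<open>rel\<close> and
  \<open>val\<close> instantiate a substituted codomain, while closing substitutions are extended by
  \<open>case_nat\<close>.\<close>

lemma inst_up:
  "instJ (subJ (up_sub s) B) a = subJ (case_nat a s) B"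
  "instT (subT (up_sub s) b) a = subT (case_nat a s) b"
  by (simp_all add: sub_sub) (rule arg_cong[where f="\<lambda>s. subJ s B"] arg_cong[where f="\<lambda>s. subT s b"],
      rule nat_fun_eqI, simp_all)+

lemma inst_up_wk_Var [simp]:
  "instJ (renJ (up_ren Suc) B) (Var 0) = B"
proof -
  have "(\<lambda>i. single (Var 0) (up_ren Suc i)) = Var"
    by (rule nat_fun_eqI) simp_all
  then show ?thesis
    unfolding sub_ren by (metis sub_Var(1))
qed

section \<open>Stability of derivations under a class of substitutions\<close>

text \<open>The invariant \<open>OK\<close> is instantiated first with renamings and then with arbitrary typed
  substitutions, so that one induction over derivations serves both.\<close>

lemmas cg_rules = JUnit Triv Triv_eta JPi JPi_cong Lam Lam_cong App App_cong App_beta Lam_eta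
  JSigma JSigma_cong Pair Pair_cong Fst Fst_cong Snd Snd_cong Fst_beta Snd_beta Pair_eta
  JEq JEq_cong Refl Refl_cong Refl_eta TpPos TpNeg TmPos TmPos_cong U U_cong F F_cong
  Ret Ret_cong Bind Bind_cong Bind_Ret Bind_eta Bind_assoc Step Step_cong Step_0 Step_add
  Beh Beh_unique Open Open_cong ApOpen ApOpen_cong LamOpen LamOpen_cong Open_beta Open_eta
  Closed Closed_cong Eta Eta_cong Star Star_cong Eta_Star IndClosed IndClosed_cong IndClosed_Eta
  IndClosed_Star PiT PiT_cong Ap Ap_cong LamT LamT_cong PiT_beta PiT_eta SigmaT SigmaT_cong
  Unpair Unpair_cong PairT PairT_cong SigmaT_beta SigmaT_eta EqT EqT_cong RefT RefT_cong
  SelfT SelfT_cong EqT_beta EqT_eta NatT Zero Succ Succ_cong IndNat IndNat_cong IndNat_Zero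
  IndNat_Succ Ap_Step Bind_Step

text \<open>Simplified goals have renamings pushed through all constructors; the rules must be in
  the same form to unify with them.\<close>

lemmas cg_simps = cg_rules[unfolded renJ.simps renT.simps up_ren_simps]

locale stable_subst =
  fixes OK :: "('c::monoid_add) jdg list \<Rightarrow> (nat \<Rightarrow> 'c tm) \<Rightarrow> 'c jdg list \<Rightarrow> bool"
  assumes OK_ctx: "OK \<Delta> s \<Gamma> \<Longrightarrow> \<turnstile>\<^sub>C \<Delta>"
    and OK_var: "\<lbrakk>OK \<Delta> s \<Gamma>; i < length \<Gamma>\<rbrakk> \<Longrightarrow> \<Delta> \<turnstile> s i \<Colon> subJ s (renJ (\<lambda>k. k + Suc i) (\<Gamma> ! i))"
    and OK_up: "\<lbrakk>OK \<Delta> s \<Gamma>; \<Delta> \<turnstile>\<^sub>J subJ s A\<rbrakk> \<Longrightarrow> OK (subJ s A # \<Delta>) (up_sub s) (A # \<Gamma>)"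
begin

text \<open>Each rule is applied again to its substituted premises. Every rule that extends a
  context also has the domain as a premise, so the induction hypothesis supplies what
  \<open>OK_up\<close> asks for. \<open>reflection\<close> and \<open>Step_Beh\<close> are solved
  separately, since they have a premise whose term does not occur in the conclusion.\<close>

lemma stable:
  shows "\<turnstile>\<^sub>C \<Gamma> \<Longrightarrow> True"
    and "\<Gamma> \<turnstile>\<^sub>J J \<Longrightarrow> OK \<Delta> s \<Gamma> \<Longrightarrow> \<Delta> \<turnstile>\<^sub>J subJ s J"
    and "\<Gamma> \<turnstile>\<^sub>J J \<doteq> K \<Longrightarrow> OK \<Delta> s \<Gamma> \<Longrightarrow> \<Delta> \<turnstile>\<^sub>J subJ s J \<doteq> subJ s K"
    and "\<Gamma> \<turnstile> t \<Colon> J \<Longrightarrow> OK \<Delta> s \<Gamma> \<Longrightarrow> \<Delta> \<turnstile> subT s t \<Colon> subJ s J"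
    and "\<Gamma> \<turnstile> t \<doteq> u \<Colon> J \<Longrightarrow> OK \<Delta> s \<Gamma> \<Longrightarrow> \<Delta> \<turnstile> subT s t \<doteq> subT s u \<Colon> subJ s J"
  apply (induct arbitrary: \<Delta> s and \<Delta> s and \<Delta> s and \<Delta> s and \<Delta> s rule: wf_ctx_is_jdg_eq_jdg_has_jdg_eq_tm.inducts)
  apply (simp_all only: OK_var True_implies_equals subT.simps(1))
  apply (((simp only: sub_inst)?; simp?; (rule cg_simps; (simp add: OK_up OK_ctx sub_inst[symmetric]; fail)))[1] | (blast intro: eqJ_refl eqJ_sym eqJ_trans eq_refl eq_sym eq_trans conv eq_conv)[1] | (simp, metis reflection Step_Beh)[1])+
  done
end

section \<open>Renamings, weakening and typed substitutions\<close>

lemma ctx_of: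
  shows "\<turnstile>\<^sub>C \<Gamma> \<Longrightarrow> True"
    and "\<Gamma> \<turnstile>\<^sub>J J \<Longrightarrow> \<turnstile>\<^sub>C \<Gamma>"
    and "\<Gamma> \<turnstile>\<^sub>J J \<doteq> K \<Longrightarrow> \<turnstile>\<^sub>C \<Gamma>"
    and "\<Gamma> \<turnstile> t \<Colon> J \<Longrightarrow> \<turnstile>\<^sub>C \<Gamma>"
    and "\<Gamma> \<turnstile> t \<doteq> u \<Colon> J \<Longrightarrow> \<turnstile>\<^sub>C \<Gamma>"
  by (induct rule: wf_ctx_is_jdg_eq_jdg_has_jdg_eq_tm.inducts) (simp_all (no_asm_use))

lemma ctx_of_Cons: "\<turnstile>\<^sub>C A # \<Gamma> \<longleftrightarrow> \<turnstile>\<^sub>C \<Gamma> \<and> \<Gamma> \<turnstile>\<^sub>J A"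
  by (auto intro: ctx_cons elim: wf_ctx.cases)

text \<open>Written as a substitution by variables in order to fit the locale. Declared judgments
  are matched syntactically, so the variable rule alone gives \<open>OK_var\<close>.\<close>

definition typed_ren :: "('c::monoid_add) jdg list \<Rightarrow> (nat \<Rightarrow> 'c tm) \<Rightarrow> 'c jdg list \<Rightarrow> bool" where
  "typed_ren \<Delta> s \<Gamma> \<longleftrightarrow> \<turnstile>\<^sub>C \<Delta> \<and> (\<exists>r. s = (\<lambda>i. Var (r i)) \<and> (\<forall>i<length \<Gamma>. r i < length \<Delta> \<and>
     renJ (\<lambda>k. k + Suc (r i)) (\<Delta> ! r i) = renJ r (renJ (\<lambda>k. k + Suc i) (\<Gamma> ! i))))"

definition typed_sub :: "('c::monoid_add) jdg list \<Rightarrow> (nat \<Rightarrow> 'c tm) \<Rightarrow> 'c jdg list \<Rightarrow> bool" where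
  "typed_sub \<Delta> s \<Gamma> \<longleftrightarrow> \<turnstile>\<^sub>C \<Delta> \<and>
     (\<forall>i<length \<Gamma>. \<Delta> \<turnstile> s i \<Colon> subJ s (renJ (\<lambda>k. k + Suc i) (\<Gamma> ! i)))"

interpretation ren: stable_subst typed_ren
proof
  fix \<Delta> \<Gamma> :: "'c::monoid_add jdg list" and s A i
  assume ok: "typed_ren \<Delta> s \<Gamma>"
  then show "\<turnstile>\<^sub>C \<Delta>" by (simp add: typed_ren_def)
  from ok obtain r where s: "s = (\<lambda>i. Var (r i))"
    and r: "\<And>i. i < length \<Gamma> \<Longrightarrow> r i < length \<Delta> \<and>
        renJ (\<lambda>k. k + Suc (r i)) (\<Delta> ! r i) = renJ r (renJ (\<lambda>k. k + Suc i) (\<Gamma> ! i))"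
    and c: "\<turnstile>\<^sub>C \<Delta>"
    unfolding typed_ren_def by blast
  {
    assume "i < length \<Gamma>"
    then show "\<Delta> \<turnstile> s i \<Colon> subJ s (renJ (\<lambda>k. k + Suc i) (\<Gamma> ! i))"
      using r[of i] var[OF c, of "r i"] by (simp add: s ren_as_sub(1)[of r])
  }
  assume A: "\<Delta> \<turnstile>\<^sub>J subJ s A"
  have "up_ren r i < length (subJ s A # \<Delta>) \<and> renJ (\<lambda>k. k + Suc (up_ren r i)) ((subJ s A # \<Delta>) ! up_ren r i)
      = renJ (up_ren r) (renJ (\<lambda>k. k + Suc i) ((A # \<Gamma>) ! i))" if "i < length (A # \<Gamma>)" for i
  proof (cases i)
    case 0
    then show ?thesis by (simp add: s ren_as_sub(1)[of r, symmetric] ren_ren)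
  next
    case (Suc j)
    with that r[of j] have "r j < length \<Delta>"
      and *: "renJ (\<lambda>k. k + Suc (r j)) (\<Delta> ! r j) = renJ r (renJ (\<lambda>k. k + Suc j) (\<Gamma> ! j))" by auto
    moreover from arg_cong[OF *, of wkJ]
    have "renJ (\<lambda>k. k + Suc (Suc (r j))) (\<Delta> ! r j) = renJ (up_ren r) (renJ (\<lambda>k. k + Suc (Suc j)) (\<Gamma> ! j))"
      by (simp add: ren_ren)
    ultimately show ?thesis using Suc by simp
  qed
  then show "typed_ren (subJ s A # \<Delta>) (up_sub s) (A # \<Gamma>)"
    unfolding typed_ren_def using ctx_cons[OF c A] by (auto simp: s up_sub_Var)
qed

lemma typed_ren_wk: "\<turnstile>\<^sub>C A # \<Gamma> \<Longrightarrow> typed_ren (A # \<Gamma>) (\<lambda>i. Var (Suc i)) \<Gamma>"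
  unfolding typed_ren_def by (auto simp: ren_ren intro!: exI[of _ Suc])

lemma weakening:
  assumes "\<Gamma> \<turnstile>\<^sub>J A"
  shows "\<Gamma> \<turnstile>\<^sub>J J \<Longrightarrow> A # \<Gamma> \<turnstile>\<^sub>J wkJ J"
    and "\<Gamma> \<turnstile>\<^sub>J J \<doteq> K \<Longrightarrow> A # \<Gamma> \<turnstile>\<^sub>J wkJ J \<doteq> wkJ K"
    and "\<Gamma> \<turnstile> t \<Colon> J \<Longrightarrow> A # \<Gamma> \<turnstile> wkT t \<Colon> wkJ J"
    and "\<Gamma> \<turnstile> t \<doteq> u \<Colon> J \<Longrightarrow> A # \<Gamma> \<turnstile> wkT t \<doteq> wkT u \<Colon> wkJ J"
proof -
  have "typed_ren (A # \<Gamma>) (\<lambda>i. Var (Suc i)) \<Gamma>"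
    using assms by (blast intro: typed_ren_wk ctx_cons ctx_of)
  note * = ren.stable(2-)[OF _ this, folded ren_as_sub]
  show "\<Gamma> \<turnstile>\<^sub>J J \<Longrightarrow> A # \<Gamma> \<turnstile>\<^sub>J wkJ J" "\<Gamma> \<turnstile>\<^sub>J J \<doteq> K \<Longrightarrow> A # \<Gamma> \<turnstile>\<^sub>J wkJ J \<doteq> wkJ K"
    "\<Gamma> \<turnstile> t \<Colon> J \<Longrightarrow> A # \<Gamma> \<turnstile> wkT t \<Colon> wkJ J" "\<Gamma> \<turnstile> t \<doteq> u \<Colon> J \<Longrightarrow> A # \<Gamma> \<turnstile> wkT t \<doteq> wkT u \<Colon> wkJ J"
    by (fact *)+
qed

lemma renJ_add_Suc: "renJ (\<lambda>k. k + Suc (Suc i)) A = wkJ (renJ (\<lambda>k. k + Suc i) A)"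
  by (simp add: ren_ren)

lemma wk_add_0: "renJ (\<lambda>k. k + Suc 0) A = wkJ A"
  by (rule arg_cong[where f="\<lambda>r. renJ r A"]) (rule ext, simp)

lemma var_0: "\<Gamma> \<turnstile>\<^sub>J A \<Longrightarrow> A # \<Gamma> \<turnstile> Var 0 \<Colon> wkJ A"
  using var[of "A # \<Gamma>" 0] by (simp add: wk_add_0[simplified] ctx_of_Cons ctx_of)

text \<open>Under a binder the substituted terms are weakened; this is why renamings precede general
  substitutions.\<close>

lemma typed_sub_up:
  assumes "typed_sub \<Delta> s \<Gamma>" "\<Delta> \<turnstile>\<^sub>J subJ s A"
  shows "typed_sub (subJ s A # \<Delta>) (up_sub s) (A # \<Gamma>)"
  unfolding typed_sub_def
proof (intro conjI allI impI)
  show "\<turnstile>\<^sub>C subJ s A # \<Delta>" using assms by (simp add: typed_sub_def ctx_cons)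
  fix i assume i: "i < length (A # \<Gamma>)"
  show "subJ s A # \<Delta> \<turnstile> up_sub s i \<Colon> subJ (up_sub s) (renJ (\<lambda>k. k + Suc i) ((A # \<Gamma>) ! i))"
  proof (cases i)
    case 0
    then show ?thesis using var_0[OF assms(2)] by (simp only: wk_add_0 up_sub_simps nth_Cons_0 sub_up_wk)
  next
    case (Suc j)
    with assms i have "\<Delta> \<turnstile> s j \<Colon> subJ s (renJ (\<lambda>k. k + Suc j) (\<Gamma> ! j))" by (simp add: typed_sub_def)
    from weakening(3)[OF assms(2) this] show ?thesis
      by (simp only: Suc renJ_add_Suc up_sub_simps nth_Cons_Suc sub_up_wk)
  qed
qed

interpretation sub: stable_subst typed_sub
  by standard (auto simp: typed_sub_up, auto simp: typed_sub_def)

section \<open>Judgmentally equal substitutions\<close>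

definition eq_sub :: "('c::monoid_add) jdg list \<Rightarrow> (nat \<Rightarrow> 'c tm) \<Rightarrow> (nat \<Rightarrow> 'c tm) \<Rightarrow> 'c jdg list \<Rightarrow> bool" where
  "eq_sub \<Delta> s q \<Gamma> \<longleftrightarrow> typed_sub \<Delta> s \<Gamma> \<and>
     (\<forall>i<length \<Gamma>. \<Delta> \<turnstile> s i \<doteq> q i \<Colon> subJ s (renJ (\<lambda>k. k + Suc i) (\<Gamma> ! i)))"

lemma eq_sub_stable:
  assumes "eq_sub \<Delta> s q \<Gamma>"
  shows "\<Gamma> \<turnstile>\<^sub>J A \<Longrightarrow> \<Delta> \<turnstile>\<^sub>J subJ s A"
    and "\<Gamma> \<turnstile>\<^sub>J J \<doteq> K \<Longrightarrow> \<Delta> \<turnstile>\<^sub>J subJ s J \<doteq> subJ s K"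
  using assms by (simp_all add: eq_sub_def sub.stable)

lemma eq_sub_up:
  assumes "\<Gamma> \<turnstile>\<^sub>J A" "eq_sub \<Delta> s q \<Gamma>"
  shows "eq_sub (subJ s A # \<Delta>) (up_sub s) (up_sub q) (A # \<Gamma>)"
  unfolding eq_sub_def
proof (intro conjI allI impI)
  have A: "\<Delta> \<turnstile>\<^sub>J subJ s A" using assms eq_sub_stable by blast
  then show "typed_sub (subJ s A # \<Delta>) (up_sub s) (A # \<Gamma>)"
    using assms typed_sub_up by (auto simp: eq_sub_def)
  fix i assume i: "i < length (A # \<Gamma>)"
  show "subJ s A # \<Delta> \<turnstile> up_sub s i \<doteq> up_sub q i \<Colon> subJ (up_sub s) (renJ (\<lambda>k. k + Suc i) ((A # \<Gamma>) ! i))"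
  proof (cases i)
    case 0
    then show ?thesis using eq_refl[OF var_0[OF A]] by (simp only: wk_add_0 up_sub_simps nth_Cons_0 sub_up_wk)
  next
    case (Suc j)
    with assms i have "\<Delta> \<turnstile> s j \<doteq> q j \<Colon> subJ s (renJ (\<lambda>k. k + Suc j) (\<Gamma> ! j))" by (simp add: eq_sub_def)
    from weakening(4)[OF A this] show ?thesis
      by (simp only: Suc renJ_add_Suc up_sub_simps nth_Cons_Suc sub_up_wk)
  qed
qed

lemma eq_sub_var:
  "\<lbrakk>eq_sub \<Delta> s q \<Gamma>; i < length \<Gamma>\<rbrakk> \<Longrightarrow> \<Delta> \<turnstile> s i \<doteq> q i \<Colon> subJ s (renJ (\<lambda>k. k + Suc i) (\<Gamma> ! i))"
  by (simp add: eq_sub_def)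

lemma eq_sub_ctx: "eq_sub \<Delta> s q \<Gamma> \<Longrightarrow> \<turnstile>\<^sub>C \<Delta>"
  by (simp add: eq_sub_def typed_sub_def)

text \<open>Each formation or typing rule is answered by its congruence rule. It has to precede
  presuppositions, because the judgment \<open>instJ B a\<close> of an application varies with the
  argument. For the same reason \<open>eq_sub\<close> asks for typing of \<open>s\<close> only:
  typing of \<open>q\<close> would already be a presupposition. The version with two equal terms is
  obtained later by transitivity with \<open>sub.stable\<close>.\<close>

lemma functionality:
  shows "\<turnstile>\<^sub>C \<Gamma> \<Longrightarrow> True"
    and "\<Gamma> \<turnstile>\<^sub>J J \<Longrightarrow> eq_sub \<Delta> s q \<Gamma> \<Longrightarrow> \<Delta> \<turnstile>\<^sub>J subJ s J \<doteq> subJ q J"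
    and "\<Gamma> \<turnstile>\<^sub>J J \<doteq> K \<Longrightarrow> True"
    and "\<Gamma> \<turnstile> t \<Colon> J \<Longrightarrow> eq_sub \<Delta> s q \<Gamma> \<Longrightarrow> \<Delta> \<turnstile> subT s t \<doteq> subT q t \<Colon> subJ s J"
    and "\<Gamma> \<turnstile> t \<doteq> u \<Colon> J \<Longrightarrow> True"
  apply (induct arbitrary: and \<Delta> s q and and \<Delta> s q and rule: wf_ctx_is_jdg_eq_jdg_has_jdg_eq_tm.inducts)
  apply (simp_all only: eq_sub_var subT.simps(1))
  apply (((simp only: sub_inst)?; simp?; (rule cg_simps; ((blast intro: eq_sub_stable(1))[1] | (simp add: eq_sub_up sub_inst[symmetric]; fail))))[1] | (simp?; blast intro: eqJ_refl eq_refl TpPos TpNeg JUnit Beh Triv NatT Zero eq_sub_stable eq_sub_ctx eq_conv)[1])+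
  done

section \<open>Presuppositions\<close>

lemma typed_sub_Cons:
  "typed_sub \<Delta> (case_nat a s) (A # \<Gamma>) \<longleftrightarrow> typed_sub \<Delta> s \<Gamma> \<and> \<Delta> \<turnstile> a \<Colon> subJ s A"
  unfolding typed_sub_def
  by (auto simp: nth_Cons All_less_Suc2 renJ_add_Suc[simplified] wk_add_0[simplified])

lemma eq_sub_Cons:
  "eq_sub \<Delta> (case_nat a s) (case_nat b q) (A # \<Gamma>)
    \<longleftrightarrow> eq_sub \<Delta> s q \<Gamma> \<and> \<Delta> \<turnstile> a \<Colon> subJ s A \<and> \<Delta> \<turnstile> a \<doteq> b \<Colon> subJ s A"
  unfolding eq_sub_def typed_sub_Cons
  by (auto simp: nth_Cons All_less_Suc2 renJ_add_Suc[simplified] wk_add_0[simplified])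

lemma typed_sub_Var: "\<turnstile>\<^sub>C \<Gamma> \<Longrightarrow> typed_sub \<Gamma> Var \<Gamma>"
  unfolding typed_sub_def by (simp del: add_Suc_right add: var)

lemma eq_sub_Var: "\<turnstile>\<^sub>C \<Gamma> \<Longrightarrow> eq_sub \<Gamma> Var Var \<Gamma>"
  unfolding eq_sub_def using typed_sub_Var by (auto simp: typed_sub_def intro: eq_refl)

lemma typed_sub_single: "\<Gamma> \<turnstile> a \<Colon> A \<Longrightarrow> typed_sub \<Gamma> (single a) (A # \<Gamma>)"
  by (simp add: single_def typed_sub_Cons typed_sub_Var ctx_of)

lemma eq_sub_single: "\<lbrakk>\<Gamma> \<turnstile> a \<Colon> A; \<Gamma> \<turnstile> a \<doteq> b \<Colon> A\<rbrakk> \<Longrightarrow> eq_sub \<Gamma> (single a) (single b) (A # \<Gamma>)"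
  by (simp add: single_def eq_sub_Cons eq_sub_Var ctx_of)

lemma inst:
  assumes "\<Gamma> \<turnstile> a \<Colon> A"
  shows "A # \<Gamma> \<turnstile>\<^sub>J B \<Longrightarrow> \<Gamma> \<turnstile>\<^sub>J instJ B a"
    and "A # \<Gamma> \<turnstile>\<^sub>J B \<doteq> B' \<Longrightarrow> \<Gamma> \<turnstile>\<^sub>J instJ B a \<doteq> instJ B' a"
    and "A # \<Gamma> \<turnstile> b \<Colon> B \<Longrightarrow> \<Gamma> \<turnstile> instT b a \<Colon> instJ B a"
    and "A # \<Gamma> \<turnstile> b \<doteq> b' \<Colon> B \<Longrightarrow> \<Gamma> \<turnstile> instT b a \<doteq> instT b' a \<Colon> instJ B a"
  using sub.stable(2-)[OF _ typed_sub_single[OF assms]] by blast+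

lemma inst_eqJ: "\<lbrakk>\<Gamma> \<turnstile> a \<Colon> A; \<Gamma> \<turnstile> a \<doteq> a' \<Colon> A; A # \<Gamma> \<turnstile>\<^sub>J B\<rbrakk> \<Longrightarrow> \<Gamma> \<turnstile>\<^sub>J instJ B a \<doteq> instJ B a'"
  by (rule functionality(2)[OF _ eq_sub_single])

lemma inst_eqJ2:
  "\<lbrakk>\<Gamma> \<turnstile> a \<Colon> A; \<Gamma> \<turnstile> a \<doteq> a' \<Colon> A; A # \<Gamma> \<turnstile>\<^sub>J B; A # \<Gamma> \<turnstile>\<^sub>J B \<doteq> B'; \<Gamma> \<turnstile> a' \<Colon> A\<rbrakk>
    \<Longrightarrow> \<Gamma> \<turnstile>\<^sub>J instJ B a \<doteq> instJ B' a'"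
  by (rule eqJ_trans[OF inst_eqJ inst(2)])

text \<open>Replacing a declared judgment by an equal one is substitution along the identity, with
  variable 0 retyped by \<open>conv\<close>; \<open>ctx_conv\<close> is then an instance of
  stability.\<close>

lemma typed_sub_conv:
  assumes "\<Gamma> \<turnstile>\<^sub>J A \<doteq> A'" "\<Gamma> \<turnstile>\<^sub>J A'"
  shows "typed_sub (A' # \<Gamma>) Var (A # \<Gamma>)"
proof -
  have V: "(\<lambda>i. Var (Suc i)) = (\<lambda>i. wkT (Var i))" "Var = case_nat (Var 0) (\<lambda>i. Var (Suc i))"
    by (rule nat_fun_eqI; simp)+
  have c: "\<turnstile>\<^sub>C A' # \<Gamma>" using assms by (simp add: ctx_of_Cons ctx_of)
  have "A' # \<Gamma> \<turnstile> Var 0 \<Colon> wkJ A"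
    using var_0[OF assms(2)] weakening(2)[OF assms(2) eqJ_sym[OF assms(1)]] by (rule conv)
  moreover have "typed_sub (A' # \<Gamma>) (\<lambda>i. Var (Suc i)) \<Gamma>"
    unfolding typed_sub_def
  proof (intro conjI allI impI c)
    fix i assume "i < length \<Gamma>"
    then show "A' # \<Gamma> \<turnstile> Var (Suc i) \<Colon> subJ (\<lambda>i. Var (Suc i)) (renJ (\<lambda>k. k + Suc i) (\<Gamma> ! i))"
      using weakening(3)[OF assms(2) var[of \<Gamma> i]] c
      by (simp add: ctx_of_Cons ren_as_sub(1)[of Suc] del: add_Suc_right)
  qed
  ultimately show ?thesis
    by (subst V(2)) (simp add: typed_sub_Cons ren_as_sub(1)[of Suc])
qed

lemma ctx_conv:
  assumes "\<Gamma> \<turnstile>\<^sub>J A \<doteq> A'" "\<Gamma> \<turnstile>\<^sub>J A'"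
  shows "A # \<Gamma> \<turnstile>\<^sub>J J \<Longrightarrow> A' # \<Gamma> \<turnstile>\<^sub>J J"
    and "A # \<Gamma> \<turnstile>\<^sub>J J \<doteq> K \<Longrightarrow> A' # \<Gamma> \<turnstile>\<^sub>J J \<doteq> K"
    and "A # \<Gamma> \<turnstile> t \<Colon> J \<Longrightarrow> A' # \<Gamma> \<turnstile> t \<Colon> J"
    and "A # \<Gamma> \<turnstile> t \<doteq> u \<Colon> J \<Longrightarrow> A' # \<Gamma> \<turnstile> t \<doteq> u \<Colon> J"
  using sub.stable(2-)[OF _ typed_sub_conv[OF assms]] by simp_all

section \<open>Derived rules for the judgments occurring in the signature\<close>

lemma Arr: "\<lbrakk>\<Gamma> \<turnstile>\<^sub>J A; \<Gamma> \<turnstile>\<^sub>J B\<rbrakk> \<Longrightarrow> \<Gamma> \<turnstile>\<^sub>J Arr A B"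
  by (blast intro: JPi weakening)

lemma Arr_cong: "\<lbrakk>\<Gamma> \<turnstile>\<^sub>J A; \<Gamma> \<turnstile>\<^sub>J A \<doteq> A'; \<Gamma> \<turnstile>\<^sub>J B \<doteq> B'\<rbrakk> \<Longrightarrow> \<Gamma> \<turnstile>\<^sub>J Arr A B \<doteq> Arr A' B'"
  by (blast intro: JPi_cong weakening)

lemma app_type: "\<lbrakk>\<Gamma> \<turnstile>\<^sub>J A; \<Gamma> \<turnstile>\<^sub>J B; \<Gamma> \<turnstile> f \<Colon> Arr A B; \<Gamma> \<turnstile> a \<Colon> A\<rbrakk> \<Longrightarrow> \<Gamma> \<turnstile> app A B f a \<Colon> B"
  using App[of \<Gamma> A "wkJ B" f a] weakening(1)[of \<Gamma> A B] by simp

lemma app_cong: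
  "\<lbrakk>\<Gamma> \<turnstile>\<^sub>J A; \<Gamma> \<turnstile>\<^sub>J A \<doteq> A'; \<Gamma> \<turnstile>\<^sub>J B \<doteq> B'; \<Gamma> \<turnstile> f \<doteq> f' \<Colon> Arr A B; \<Gamma> \<turnstile> a \<doteq> a' \<Colon> A\<rbrakk>
    \<Longrightarrow> \<Gamma> \<turnstile> app A B f a \<doteq> app A' B' f' a' \<Colon> B"
  using App_cong[of \<Gamma> A A' "wkJ B" "wkJ B'" f f' a a'] weakening(2)[of \<Gamma> A B B'] by simp

lemma atNeg: "\<lbrakk>\<Gamma> \<turnstile> A \<Colon> TpPos; \<Gamma> \<turnstile> X \<Colon> Arr (TmPos A) TpNeg; \<Gamma> \<turnstile> a \<Colon> TmPos A\<rbrakk> \<Longrightarrow> \<Gamma> \<turnstile> atNeg A X a \<Colon> TpNeg"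
  by (rule app_type) (auto intro: TmPos TpNeg ctx_of)

lemma atNeg_cong:
  "\<lbrakk>\<Gamma> \<turnstile> A \<Colon> TpPos; \<Gamma> \<turnstile> A \<doteq> A' \<Colon> TpPos; \<Gamma> \<turnstile> X \<doteq> X' \<Colon> Arr (TmPos A) TpNeg; \<Gamma> \<turnstile> a \<doteq> a' \<Colon> TmPos A\<rbrakk>
    \<Longrightarrow> \<Gamma> \<turnstile> atNeg A X a \<doteq> atNeg A' X' a' \<Colon> TpNeg"
  by (rule app_cong) (auto intro: TmPos TmPos_cong TpNeg ctx_of eqJ_refl)

lemma atPos: "\<lbrakk>\<Gamma> \<turnstile> A \<Colon> TpPos; \<Gamma> \<turnstile> X \<Colon> Arr (TmPos A) TpPos; \<Gamma> \<turnstile> a \<Colon> TmPos A\<rbrakk> \<Longrightarrow> \<Gamma> \<turnstile> atPos A X a \<Colon> TpPos"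
  by (rule app_type) (auto intro: TmPos TpPos ctx_of)

lemma atPos_cong:
  "\<lbrakk>\<Gamma> \<turnstile> A \<Colon> TpPos; \<Gamma> \<turnstile> A \<doteq> A' \<Colon> TpPos; \<Gamma> \<turnstile> X \<doteq> X' \<Colon> Arr (TmPos A) TpPos; \<Gamma> \<turnstile> a \<doteq> a' \<Colon> TmPos A\<rbrakk>
    \<Longrightarrow> \<Gamma> \<turnstile> atPos A X a \<doteq> atPos A' X' a' \<Colon> TpPos"
  by (rule app_cong) (auto intro: TmPos TmPos_cong TpPos ctx_of eqJ_refl)

lemma TmNeg: "\<Gamma> \<turnstile> X \<Colon> TpNeg \<Longrightarrow> \<Gamma> \<turnstile>\<^sub>J TmNeg X"
  by (blast intro: TmPos U)

lemma TmNeg_cong: "\<Gamma> \<turnstile> X \<doteq> X' \<Colon> TpNeg \<Longrightarrow> \<Gamma> \<turnstile>\<^sub>J TmNeg X \<doteq> TmNeg X'"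
  by (blast intro: TmPos_cong U_cong)

lemma wk_Arr_TpNeg:
  assumes "\<Gamma> \<turnstile>\<^sub>J B"
  shows "\<Gamma> \<turnstile> X \<Colon> Arr (TmPos A) TpNeg \<Longrightarrow> B # \<Gamma> \<turnstile> wkT X \<Colon> Arr (TmPos (wkT A)) TpNeg"
    and "\<Gamma> \<turnstile> X \<doteq> X' \<Colon> Arr (TmPos A) TpNeg \<Longrightarrow> B # \<Gamma> \<turnstile> wkT X \<doteq> wkT X' \<Colon> Arr (TmPos (wkT A)) TpNeg"
    and "\<Gamma> \<turnstile> X \<Colon> Arr (TmPos A) TpPos \<Longrightarrow> B # \<Gamma> \<turnstile> wkT X \<Colon> Arr (TmPos (wkT A)) TpPos"
    and "\<Gamma> \<turnstile> X \<doteq> X' \<Colon> Arr (TmPos A) TpPos \<Longrightarrow> B # \<Gamma> \<turnstile> wkT X \<doteq> wkT X' \<Colon> Arr (TmPos (wkT A)) TpPos"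
  using weakening(3,4)[OF assms, where J="Arr (TmPos A) TpNeg"] weakening(3,4)[OF assms, where J="Arr (TmPos A) TpPos"]
  by fastforce+

lemma wk_TpPos:
  assumes "\<Gamma> \<turnstile>\<^sub>J B"
  shows "\<Gamma> \<turnstile> A \<Colon> TpPos \<Longrightarrow> B # \<Gamma> \<turnstile> wkT A \<Colon> TpPos"
    and "\<Gamma> \<turnstile> A \<doteq> A' \<Colon> TpPos \<Longrightarrow> B # \<Gamma> \<turnstile> wkT A \<doteq> wkT A' \<Colon> TpPos"
  using weakening(3,4)[OF assms, where J=TpPos] by fastforce+

lemma var_0_TmPos: "\<Gamma> \<turnstile> A \<Colon> TpPos \<Longrightarrow> TmPos A # \<Gamma> \<turnstile> Var 0 \<Colon> TmPos (wkT A)"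
  using var_0[OF TmPos] by fastforce

lemma var_0_Beh: "\<turnstile>\<^sub>C \<Gamma> \<Longrightarrow> Beh # \<Gamma> \<turnstile> Var 0 \<Colon> Beh"
  using var_0[OF Beh] by fastforce

lemma famNeg: "\<lbrakk>\<Gamma> \<turnstile> A \<Colon> TpPos; \<Gamma> \<turnstile> X \<Colon> Arr (TmPos A) TpNeg\<rbrakk> \<Longrightarrow> TmPos A # \<Gamma> \<turnstile>\<^sub>J famNeg A X"
  by (intro TmNeg atNeg) (simp_all add: wk_TpPos wk_Arr_TpNeg[simplified] TmPos var_0_TmPos)

lemma famNeg_cong:
  "\<lbrakk>\<Gamma> \<turnstile> A \<Colon> TpPos; \<Gamma> \<turnstile> A \<doteq> A' \<Colon> TpPos; \<Gamma> \<turnstile> X \<doteq> X' \<Colon> Arr (TmPos A) TpNeg\<rbrakk>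
    \<Longrightarrow> TmPos A # \<Gamma> \<turnstile>\<^sub>J famNeg A X \<doteq> famNeg A' X'"
  by (intro TmNeg_cong atNeg_cong) (simp_all add: wk_TpPos wk_Arr_TpNeg[simplified] TmPos var_0_TmPos eq_refl)

lemma famPos: "\<lbrakk>\<Gamma> \<turnstile> A \<Colon> TpPos; \<Gamma> \<turnstile> X \<Colon> Arr (TmPos A) TpPos\<rbrakk> \<Longrightarrow> TmPos A # \<Gamma> \<turnstile>\<^sub>J famPos A X"
  by (intro TmPos atPos) (simp_all add: wk_TpPos wk_Arr_TpNeg[simplified] TmPos var_0_TmPos)

lemma famPos_cong:
  "\<lbrakk>\<Gamma> \<turnstile> A \<Colon> TpPos; \<Gamma> \<turnstile> A \<doteq> A' \<Colon> TpPos; \<Gamma> \<turnstile> X \<doteq> X' \<Colon> Arr (TmPos A) TpPos\<rbrakk>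
    \<Longrightarrow> TmPos A # \<Gamma> \<turnstile>\<^sub>J famPos A X \<doteq> famPos A' X'"
  by (intro TmPos_cong atPos_cong) (simp_all add: wk_TpPos wk_Arr_TpNeg[simplified] TmPos var_0_TmPos eq_refl)

lemma wk_Arr_Closed:
  assumes "\<Gamma> \<turnstile>\<^sub>J B"
  shows "\<Gamma> \<turnstile> X \<Colon> Arr (TmPos (Closed A)) TpNeg \<Longrightarrow> B # \<Gamma> \<turnstile> wkT X \<Colon> Arr (TmPos (Closed (wkT A))) TpNeg"
    and "\<Gamma> \<turnstile> X \<doteq> X' \<Colon> Arr (TmPos (Closed A)) TpNeg
      \<Longrightarrow> B # \<Gamma> \<turnstile> wkT X \<doteq> wkT X' \<Colon> Arr (TmPos (Closed (wkT A))) TpNeg"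
  using wk_Arr_TpNeg(1,2)[OF assms, where A="Closed A"] by fastforce+

lemma atEta: "\<lbrakk>\<Gamma> \<turnstile> A \<Colon> TpPos; \<Gamma> \<turnstile> X \<Colon> Arr (TmPos (Closed A)) TpNeg\<rbrakk> \<Longrightarrow> TmPos A # \<Gamma> \<turnstile>\<^sub>J atEta A X"
  by (intro TmNeg atNeg Closed Eta)
    (simp_all add: wk_TpPos wk_Arr_Closed[simplified] TmPos var_0_TmPos)

lemma atEta_cong:
  "\<lbrakk>\<Gamma> \<turnstile> A \<Colon> TpPos; \<Gamma> \<turnstile> A \<doteq> A' \<Colon> TpPos; \<Gamma> \<turnstile> X \<doteq> X' \<Colon> Arr (TmPos (Closed A)) TpNeg\<rbrakk>
    \<Longrightarrow> TmPos A # \<Gamma> \<turnstile>\<^sub>J atEta A X \<doteq> atEta A' X'"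
  by (intro TmNeg_cong atNeg_cong Closed Closed_cong Eta_cong)
    (simp_all add: wk_TpPos wk_Arr_Closed[simplified] TmPos var_0_TmPos eq_refl)

lemma atStar: "\<lbrakk>\<Gamma> \<turnstile> A \<Colon> TpPos; \<Gamma> \<turnstile> X \<Colon> Arr (TmPos (Closed A)) TpNeg\<rbrakk> \<Longrightarrow> Beh # \<Gamma> \<turnstile>\<^sub>J atStar A X"
  by (intro TmNeg atNeg Closed Star)
    (simp_all add: wk_TpPos wk_Arr_Closed[simplified] Beh var_0_Beh ctx_of)

lemma atStar_cong:
  "\<lbrakk>\<Gamma> \<turnstile> A \<Colon> TpPos; \<Gamma> \<turnstile> A \<doteq> A' \<Colon> TpPos; \<Gamma> \<turnstile> X \<doteq> X' \<Colon> Arr (TmPos (Closed A)) TpNeg\<rbrakk>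
    \<Longrightarrow> Beh # \<Gamma> \<turnstile>\<^sub>J atStar A X \<doteq> atStar A' X'"
  by (intro TmNeg_cong atNeg_cong Closed Closed_cong Star_cong)
    (simp_all add: wk_TpPos wk_Arr_Closed[simplified] Beh var_0_Beh ctx_of eq_refl)

lemma indStep: "\<Gamma> \<turnstile> X \<Colon> Arr (TmPos NatT) TpNeg \<Longrightarrow> TmPos NatT # \<Gamma> \<turnstile>\<^sub>J indStep X"
  using wk_Arr_TpNeg(1)[of \<Gamma> "TmPos NatT" X NatT] var_0_TmPos[OF NatT, of \<Gamma>]
  by (intro Arr TmNeg atNeg NatT Succ) (auto simp: ctx_of_Cons ctx_of intro!: TmPos NatT intro: ctx_of)

lemma indStep_cong:
  "\<Gamma> \<turnstile> X \<doteq> X' \<Colon> Arr (TmPos NatT) TpNeg \<Longrightarrow> \<Gamma> \<turnstile> X \<Colon> Arr (TmPos NatT) TpNeg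
    \<Longrightarrow> TmPos NatT # \<Gamma> \<turnstile>\<^sub>J indStep X \<doteq> indStep X'"
  using wk_Arr_TpNeg(1,2)[where B="TmPos NatT" and A=NatT and X=X and \<Gamma>=\<Gamma>] var_0_TmPos[OF NatT, of \<Gamma>]
  by (intro Arr_cong TmNeg TmNeg_cong atNeg atNeg_cong NatT Succ Succ_cong eq_refl)
    (auto simp: ctx_of_Cons ctx_of intro!: TmPos NatT intro: ctx_of)

lemma App_atEta:
  "\<lbrakk>\<Gamma> \<turnstile> A \<Colon> TpPos; \<Gamma> \<turnstile> X \<Colon> Arr (TmPos (Closed A)) TpNeg; \<Gamma> \<turnstile> x0 \<Colon> JPi (TmPos A) (atEta A X); \<Gamma> \<turnstile> a \<Colon> TmPos A\<rbrakk>
    \<Longrightarrow> \<Gamma> \<turnstile> App (TmPos A) (atEta A X) x0 a \<Colon> TmNeg (atNeg (Closed A) X (Eta A a))"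
  using App[OF TmPos atEta, of \<Gamma> A X x0 a] by simp

lemma App_atStar:
  "\<lbrakk>\<Gamma> \<turnstile> A \<Colon> TpPos; \<Gamma> \<turnstile> X \<Colon> Arr (TmPos (Closed A)) TpNeg; \<Gamma> \<turnstile> x1 \<Colon> JPi Beh (atStar A X); \<Gamma> \<turnstile> z \<Colon> Beh\<rbrakk>
    \<Longrightarrow> \<Gamma> \<turnstile> App Beh (atStar A X) x1 z \<Colon> TmNeg (atNeg (Closed A) X (Star A z))"
  using App[OF Beh atStar, of \<Gamma> A X x1 z] by (simp add: ctx_of)

lemma atNeg_Eta_Star:
  "\<lbrakk>\<Gamma> \<turnstile> A \<Colon> TpPos; \<Gamma> \<turnstile> X \<Colon> Arr (TmPos (Closed A)) TpNeg; \<Gamma> \<turnstile> a \<Colon> TmPos A; \<Gamma> \<turnstile> z \<Colon> Beh\<rbrakk>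
    \<Longrightarrow> \<Gamma> \<turnstile>\<^sub>J TmNeg (atNeg (Closed A) X (Eta A a)) \<doteq> TmNeg (atNeg (Closed A) X (Star A z))"
  by (intro TmNeg_cong atNeg_cong Closed eq_refl Eta_Star)

text \<open>The two sides naturally live in the fibres over \<open>Eta A a\<close> and
  \<open>Star A z\<close>. These fibres are equal by \<open>Eta_Star\<close> in the presence of
  \<open>z\<close>, so the right side can be converted to the fibre of the left.\<close>

lemma glueEq:
  assumes "\<Gamma> \<turnstile> A \<Colon> TpPos" "\<Gamma> \<turnstile> X \<Colon> Arr (TmPos (Closed A)) TpNeg" "\<Gamma> \<turnstile> x0 \<Colon> JPi (TmPos A) (atEta A X)"
    "\<Gamma> \<turnstile> x1 \<Colon> JPi Beh (atStar A X)" "\<Gamma> \<turnstile> a \<Colon> TmPos A" "\<Gamma> \<turnstile> z \<Colon> Beh"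
  shows "\<Gamma> \<turnstile>\<^sub>J glueEq A X x0 x1 a z"
  using assms by (intro JEq TmNeg atNeg Closed Eta App_atEta
      conv[OF App_atStar eqJ_sym[OF atNeg_Eta_Star]])

lemma glueEq_cong:
  assumes "\<Gamma> \<turnstile> A \<Colon> TpPos" "\<Gamma> \<turnstile> A \<doteq> A' \<Colon> TpPos"
    "\<Gamma> \<turnstile> X \<Colon> Arr (TmPos (Closed A)) TpNeg" "\<Gamma> \<turnstile> X \<doteq> X' \<Colon> Arr (TmPos (Closed A)) TpNeg"
    "\<Gamma> \<turnstile> x0 \<doteq> x0' \<Colon> JPi (TmPos A) (atEta A X)"
    "\<Gamma> \<turnstile> x1 \<doteq> x1' \<Colon> JPi Beh (atStar A X)" "\<Gamma> \<turnstile> a \<Colon> TmPos A" "\<Gamma> \<turnstile> z \<Colon> Beh"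
  shows "\<Gamma> \<turnstile>\<^sub>J glueEq A X x0 x1 a z \<doteq> glueEq A' X' x0' x1' a z"
proof (rule JEq_cong)
  show "\<Gamma> \<turnstile>\<^sub>J TmNeg (atNeg (Closed A) X (Eta A a)) \<doteq> TmNeg (atNeg (Closed A') X' (Eta A' a))"
    using assms by (intro TmNeg_cong atNeg_cong Closed Closed_cong Eta_cong eq_refl)
  show "\<Gamma> \<turnstile> App (TmPos A) (atEta A X) x0 a \<doteq> App (TmPos A') (atEta A' X') x0' a \<Colon> TmNeg (atNeg (Closed A) X (Eta A a))"
  proof -
    have "\<Gamma> \<turnstile> App (TmPos A) (atEta A X) x0 a \<doteq> App (TmPos A') (atEta A' X') x0' a \<Colon> instJ (atEta A X) a"
      using assms by (intro App_cong TmPos TmPos_cong atEta_cong eq_refl)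
    then show ?thesis by simp
  qed
  have "\<Gamma> \<turnstile> App Beh (atStar A X) x1 z \<doteq> App Beh (atStar A' X') x1' z \<Colon> TmNeg (atNeg (Closed A) X (Star A z))"
  proof -
    have "\<Gamma> \<turnstile> App Beh (atStar A X) x1 z \<doteq> App Beh (atStar A' X') x1' z \<Colon> instJ (atStar A X) z"
      using assms by (intro App_cong Beh eqJ_refl atStar_cong eq_refl) (auto intro: ctx_of)
    then show ?thesis by simp
  qed
  then show "\<Gamma> \<turnstile> App Beh (atStar A X) x1 z \<doteq> App Beh (atStar A' X') x1' z \<Colon> TmNeg (atNeg (Closed A) X (Eta A a))"
    using assms by (blast intro: eq_conv eqJ_sym atNeg_Eta_Star)
qed

lemma wk_JPi_atEta:
  assumes "\<Gamma> \<turnstile>\<^sub>J B"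
  shows "\<Gamma> \<turnstile> x0 \<Colon> JPi (TmPos A) (atEta A X) \<Longrightarrow> B # \<Gamma> \<turnstile> wkT x0 \<Colon> JPi (TmPos (wkT A)) (atEta (wkT A) (wkT X))"
    and "\<Gamma> \<turnstile> x0 \<doteq> x0' \<Colon> JPi (TmPos A) (atEta A X)
      \<Longrightarrow> B # \<Gamma> \<turnstile> wkT x0 \<doteq> wkT x0' \<Colon> JPi (TmPos (wkT A)) (atEta (wkT A) (wkT X))"
    and "\<Gamma> \<turnstile> x1 \<Colon> JPi Beh (atStar A X) \<Longrightarrow> B # \<Gamma> \<turnstile> wkT x1 \<Colon> JPi Beh (atStar (wkT A) (wkT X))"
    and "\<Gamma> \<turnstile> x1 \<doteq> x1' \<Colon> JPi Beh (atStar A X)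
      \<Longrightarrow> B # \<Gamma> \<turnstile> wkT x1 \<doteq> wkT x1' \<Colon> JPi Beh (atStar (wkT A) (wkT X))"
  using weakening(3)[OF assms, where J="JPi (TmPos A) (atEta A X)"]
    weakening(4)[OF assms, where J="JPi (TmPos A) (atEta A X)"]
    weakening(3)[OF assms, where J="JPi Beh (atStar A X)"]
    weakening(4)[OF assms, where J="JPi Beh (atStar A X)"]
  by (simp_all add: ren_ren)

lemma glue_ctx:
  assumes "\<Gamma> \<turnstile> A \<Colon> TpPos"
  shows "TmPos A # \<Gamma> \<turnstile>\<^sub>J Beh" "Beh # TmPos A # \<Gamma> \<turnstile> Var 1 \<Colon> TmPos (wkT (wkT A))"
    "Beh # TmPos A # \<Gamma> \<turnstile> Var 0 \<Colon> Beh"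
proof -
  have v: "TmPos A # \<Gamma> \<turnstile> Var 0 \<Colon> TmPos (wkT A)" by (rule var_0_TmPos[OF assms])
  then show B: "TmPos A # \<Gamma> \<turnstile>\<^sub>J Beh" by (blast intro: Beh ctx_of)
  from weakening(3)[OF B v] show "Beh # TmPos A # \<Gamma> \<turnstile> Var 1 \<Colon> TmPos (wkT (wkT A))" by simp
  show "Beh # TmPos A # \<Gamma> \<turnstile> Var 0 \<Colon> Beh" using v by (blast intro: var_0_Beh ctx_of)
qed

lemma glue_cong:
  assumes "\<Gamma> \<turnstile> A \<Colon> TpPos" "\<Gamma> \<turnstile> A \<doteq> A' \<Colon> TpPos"
    "\<Gamma> \<turnstile> X \<Colon> Arr (TmPos (Closed A)) TpNeg" "\<Gamma> \<turnstile> X \<doteq> X' \<Colon> Arr (TmPos (Closed A)) TpNeg"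
    "\<Gamma> \<turnstile> x0 \<doteq> x0' \<Colon> JPi (TmPos A) (atEta A X)"
    "\<Gamma> \<turnstile> x1 \<doteq> x1' \<Colon> JPi Beh (atStar A X)"
  shows "\<Gamma> \<turnstile>\<^sub>J glue A X x0 x1 \<doteq> glue A' X' x0' x1'"
  by (intro JPi_cong TmPos TmPos_cong eqJ_refl glueEq_cong assms glue_ctx wk_TpPos wk_JPi_atEta wk_Arr_Closed)

lemma ctx_nth: "\<turnstile>\<^sub>C \<Gamma> \<Longrightarrow> i < length \<Gamma> \<Longrightarrow> \<Gamma> \<turnstile>\<^sub>J renJ (\<lambda>k. k + Suc i) (\<Gamma> ! i)"
proof (induct \<Gamma> arbitrary: i)
  case (Cons A \<Gamma>)
  then have A: "\<Gamma> \<turnstile>\<^sub>J A" and c: "\<turnstile>\<^sub>C \<Gamma>" by (auto simp: ctx_of_Cons)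
  show ?case
  proof (cases i)
    case 0
    then show ?thesis using weakening(1)[OF A A] by (simp only: wk_add_0 nth_Cons_0)
  next
    case (Suc j)
    with Cons c have "\<Gamma> \<turnstile>\<^sub>J renJ (\<lambda>k. k + Suc j) (\<Gamma> ! j)" by simp
    from weakening(1)[OF A this] Suc show ?thesis by (simp only: renJ_add_Suc nth_Cons_Suc)
  qed
qed simp

lemma JPi_famNeg_cong:
  "\<lbrakk>\<Gamma> \<turnstile> A \<Colon> TpPos; \<Gamma> \<turnstile> A \<doteq> A' \<Colon> TpPos; \<Gamma> \<turnstile> X \<doteq> X' \<Colon> Arr (TmPos A) TpNeg\<rbrakk>
    \<Longrightarrow> \<Gamma> \<turnstile>\<^sub>J JPi (TmPos A) (famNeg A X) \<doteq> JPi (TmPos A') (famNeg A' X')"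
  by (intro JPi_cong TmPos TmPos_cong famNeg_cong)

lemma JSigma_famPos_cong:
  "\<lbrakk>\<Gamma> \<turnstile> A \<Colon> TpPos; \<Gamma> \<turnstile> A \<doteq> A' \<Colon> TpPos; \<Gamma> \<turnstile> X \<doteq> X' \<Colon> Arr (TmPos A) TpPos\<rbrakk>
    \<Longrightarrow> \<Gamma> \<turnstile>\<^sub>J JSigma (TmPos A) (famPos A X) \<doteq> JSigma (TmPos A') (famPos A' X')"
  by (intro JSigma_cong TmPos TmPos_cong famPos_cong)

lemma JPi_atEta_cong:
  "\<lbrakk>\<Gamma> \<turnstile> A \<Colon> TpPos; \<Gamma> \<turnstile> A \<doteq> A' \<Colon> TpPos; \<Gamma> \<turnstile> X \<doteq> X' \<Colon> Arr (TmPos (Closed A)) TpNeg\<rbrakk>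
    \<Longrightarrow> \<Gamma> \<turnstile>\<^sub>J JPi (TmPos A) (atEta A X) \<doteq> JPi (TmPos A') (atEta A' X')"
  by (intro JPi_cong TmPos TmPos_cong atEta_cong)

lemma JPi_atStar_cong:
  "\<lbrakk>\<Gamma> \<turnstile> A \<Colon> TpPos; \<Gamma> \<turnstile> A \<doteq> A' \<Colon> TpPos; \<Gamma> \<turnstile> X \<doteq> X' \<Colon> Arr (TmPos (Closed A)) TpNeg\<rbrakk>
    \<Longrightarrow> \<Gamma> \<turnstile>\<^sub>J JPi Beh (atStar A X) \<doteq> JPi Beh (atStar A' X')"
  by (intro JPi_cong Beh eqJ_refl atStar_cong) (auto intro: ctx_of)

lemma JPi_indStep_cong:
  "\<lbrakk>\<Gamma> \<turnstile> X \<Colon> Arr (TmPos NatT) TpNeg; \<Gamma> \<turnstile> X \<doteq> X' \<Colon> Arr (TmPos NatT) TpNeg\<rbrakk>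
    \<Longrightarrow> \<Gamma> \<turnstile>\<^sub>J JPi (TmPos NatT) (indStep X) \<doteq> JPi (TmPos NatT) (indStep X')"
  by (intro JPi_cong TmPos NatT eqJ_refl indStep_cong) (auto intro: ctx_of)

lemma Arr_TpNeg_cong:
  "\<lbrakk>\<Gamma> \<turnstile> A \<Colon> TpPos; \<Gamma> \<turnstile> A \<doteq> A' \<Colon> TpPos\<rbrakk> \<Longrightarrow> \<Gamma> \<turnstile>\<^sub>J Arr (TmPos A) TpNeg \<doteq> Arr (TmPos A') TpNeg"
  by (intro Arr_cong TmPos TmPos_cong TpNeg eqJ_refl) (auto intro: ctx_of)

lemma Arr_TpPos_cong:
  "\<lbrakk>\<Gamma> \<turnstile> A \<Colon> TpPos; \<Gamma> \<turnstile> A \<doteq> A' \<Colon> TpPos\<rbrakk> \<Longrightarrow> \<Gamma> \<turnstile>\<^sub>J Arr (TmPos A) TpPos \<doteq> Arr (TmPos A') TpPos"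
  by (intro Arr_cong TmPos TmPos_cong TpPos eqJ_refl) (auto intro: ctx_of)

lemma Arr_TmNeg_cong:
  "\<lbrakk>\<Gamma> \<turnstile> A \<Colon> TpPos; \<Gamma> \<turnstile> A \<doteq> A' \<Colon> TpPos; \<Gamma> \<turnstile> X \<doteq> X' \<Colon> TpNeg\<rbrakk>
    \<Longrightarrow> \<Gamma> \<turnstile>\<^sub>J Arr (TmPos A) (TmNeg X) \<doteq> Arr (TmPos A') (TmNeg X')"
  by (intro Arr_cong TmPos TmPos_cong TmNeg_cong)

lemma Arr_Beh_cong: "\<Gamma> \<turnstile> A \<doteq> A' \<Colon> TpPos \<Longrightarrow> \<Gamma> \<turnstile>\<^sub>J Arr Beh (TmPos A) \<doteq> Arr Beh (TmPos A')"
  by (intro Arr_cong TmPos_cong Beh eqJ_refl) (auto intro: ctx_of)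

lemmas typing_rules = JUnit Triv JPi Lam App JSigma Pair Fst Snd JEq Refl TpPos TpNeg TmPos U F
  Ret Bind Step Beh Open ApOpen LamOpen Closed Eta Star IndClosed PiT Ap LamT SigmaT
  Unpair PairT EqT RefT SelfT NatT Zero Succ IndNat app_type

lemmas jdg_rules = JPi[OF TmPos famNeg] JSigma[OF TmPos famPos] Arr TmPos TmNeg JPi JSigma JEq atNeg atPos

lemma App_famNeg:
  "\<lbrakk>\<Gamma> \<turnstile> A \<Colon> TpPos; \<Gamma> \<turnstile> X \<Colon> Arr (TmPos A) TpNeg; \<Gamma> \<turnstile> f \<Colon> JPi (TmPos A) (famNeg A X); \<Gamma> \<turnstile> a \<Colon> TmPos A\<rbrakk>
    \<Longrightarrow> \<Gamma> \<turnstile> App (TmPos A) (famNeg A X) f a \<Colon> TmNeg (atNeg A X a)"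
  using App[OF TmPos famNeg, of \<Gamma> A X f a] by simp

section \<open>Typing of right-hand sides at the judgment of the left-hand side\<close>

context
  fixes \<Gamma> :: "('c::monoid_add) jdg list" and A A' B B'
  assumes A: "\<Gamma> \<turnstile>\<^sub>J A" and AA': "\<Gamma> \<turnstile>\<^sub>J A \<doteq> A'" and A': "\<Gamma> \<turnstile>\<^sub>J A'"
    and B: "A # \<Gamma> \<turnstile>\<^sub>J B" and BB': "A # \<Gamma> \<turnstile>\<^sub>J B \<doteq> B'" and B': "A # \<Gamma> \<turnstile>\<^sub>J B'"
begin

text \<open>A right-hand side carries the annotations \<open>A'\<close> and \<open>B'\<close>, and
  its typing rule wants \<open>B'\<close> over \<open>A'\<close>. The induction hypothesis of
  \<open>presup\<close> gives \<open>B'\<close> over \<open>A\<close>, so the context is converted.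
  The lemmas below then convert the resulting primed judgment back.\<close>

private lemma cod: "A' # \<Gamma> \<turnstile>\<^sub>J B'"
  by (rule ctx_conv(1)[OF AA' A' B'])

lemma JPi_retype: "\<Gamma> \<turnstile>\<^sub>J JPi A' B'"
  by (rule JPi[OF A' cod])

lemma JSigma_retype: "\<Gamma> \<turnstile>\<^sub>J JSigma A' B'"
  by (rule JSigma[OF A' cod])

lemma Lam_retype: "A # \<Gamma> \<turnstile> b' \<Colon> B \<Longrightarrow> \<Gamma> \<turnstile> Lam A' B' b' \<Colon> JPi A B"
  by (rule conv[OF Lam[OF A' cod ctx_conv(3)[OF AA' A' conv[OF _ BB']]] eqJ_sym[OF JPi_cong[OF A AA' BB']]])

lemma App_retype:
  assumes "\<Gamma> \<turnstile> f' \<Colon> JPi A B" "\<Gamma> \<turnstile> a \<Colon> A" "\<Gamma> \<turnstile> a \<doteq> a' \<Colon> A" "\<Gamma> \<turnstile> a' \<Colon> A"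
  shows "\<Gamma> \<turnstile> App A' B' f' a' \<Colon> instJ B a"
  by (rule conv[OF App[OF A' cod conv[OF assms(1) JPi_cong[OF A AA' BB']] conv[OF assms(4) AA']]
        eqJ_sym[OF inst_eqJ2[OF assms(2,3) B BB' assms(4)]]])

lemma Pair_retype:
  assumes "\<Gamma> \<turnstile> a \<Colon> A" "\<Gamma> \<turnstile> a \<doteq> a' \<Colon> A" "\<Gamma> \<turnstile> a' \<Colon> A" "\<Gamma> \<turnstile> b' \<Colon> instJ B a"
  shows "\<Gamma> \<turnstile> Pair A' B' a' b' \<Colon> JSigma A B"
  by (rule conv[OF Pair[OF A' cod conv[OF assms(3) AA'] conv[OF assms(4) inst_eqJ2[OF assms(1,2) B BB' assms(3)]]]
        eqJ_sym[OF JSigma_cong[OF A AA' BB']]])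

lemma Fst_retype: "\<Gamma> \<turnstile> p' \<Colon> JSigma A B \<Longrightarrow> \<Gamma> \<turnstile> Fst A' B' p' \<Colon> A"
  by (rule conv[OF Fst[OF A' cod conv[OF _ JSigma_cong[OF A AA' BB']]] eqJ_sym[OF AA']])

lemma Snd_retype:
  assumes "\<Gamma> \<turnstile> p \<Colon> JSigma A B" "\<Gamma> \<turnstile> p \<doteq> p' \<Colon> JSigma A B" "\<Gamma> \<turnstile> p' \<Colon> JSigma A B"
  shows "\<Gamma> \<turnstile> Snd A' B' p' \<Colon> instJ B (Fst A B p)"
  by (rule conv[OF Snd[OF A' cod conv[OF assms(3) JSigma_cong[OF A AA' BB']]]
        eqJ_sym[OF inst_eqJ2[OF Fst[OF A B assms(1)] Fst_cong[OF A AA' BB' assms(2)] B BB' Fst_retype[OF assms(3)]]]])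

end

lemma JEq_retype:
  "\<lbrakk>\<Gamma> \<turnstile>\<^sub>J A \<doteq> A'; \<Gamma> \<turnstile>\<^sub>J A'; \<Gamma> \<turnstile> a' \<Colon> A; \<Gamma> \<turnstile> b' \<Colon> A\<rbrakk> \<Longrightarrow> \<Gamma> \<turnstile>\<^sub>J JEq A' a' b'"
  by (rule JEq[OF _ conv conv])

lemma Refl_retype:
  assumes "\<Gamma> \<turnstile>\<^sub>J A \<doteq> A'" "\<Gamma> \<turnstile>\<^sub>J A'" "\<Gamma> \<turnstile> a \<doteq> a' \<Colon> A" "\<Gamma> \<turnstile> a' \<Colon> A"
  shows "\<Gamma> \<turnstile> Refl A' a' \<Colon> JEq A a a"
  by (rule conv[OF Refl[OF assms(2) conv[OF assms(4,1)]] eqJ_sym[OF JEq_cong[OF assms(1,3,3)]]])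

text \<open>The inhabitant \<open>p\<close> is what makes this typable: it reflects to an equation
  between \<open>a\<close> and \<open>b\<close>, which turns \<open>JEq A a a\<close> into
  \<open>JEq A a b\<close>.\<close>

lemma Refl_eta_type:
  "\<lbrakk>\<Gamma> \<turnstile>\<^sub>J A; \<Gamma> \<turnstile> a \<Colon> A; \<Gamma> \<turnstile> b \<Colon> A; \<Gamma> \<turnstile> p \<Colon> JEq A a b\<rbrakk> \<Longrightarrow> \<Gamma> \<turnstile> Refl A a \<Colon> JEq A a b"
  by (rule conv[OF Refl JEq_cong[OF eqJ_refl eq_refl reflection]])

lemma Snd_beta_type:
  assumes "\<Gamma> \<turnstile>\<^sub>J A" "A # \<Gamma> \<turnstile>\<^sub>J B" "\<Gamma> \<turnstile> a \<Colon> A" "\<Gamma> \<turnstile> b \<Colon> instJ B a"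
  shows "\<Gamma> \<turnstile> Snd A B (Pair A B a b) \<Colon> instJ B a"
  by (rule conv[OF Snd[OF assms(1,2) Pair[OF assms]] inst_eqJ[OF Fst[OF assms(1,2) Pair[OF assms]] Fst_beta[OF assms] assms(2)]])

lemma wk_up:
  assumes "A # \<Gamma> \<turnstile>\<^sub>J B" "\<Gamma> \<turnstile>\<^sub>J A"
  shows "wkJ A # A # \<Gamma> \<turnstile>\<^sub>J renJ (up_ren Suc) B"
proof -
  have "typed_ren (wkJ A # A # \<Gamma>) (up_sub (\<lambda>i. Var (Suc i))) (A # \<Gamma>)"
    using ren.OK_up[OF typed_ren_wk, of A \<Gamma> A] weakening(1)[OF assms(2,2)] assms
    by (simp add: ctx_of ren_as_sub(1)[of Suc])
  from ren.stable(2)[OF assms(1) this] show ?thesis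
    by (simp add: up_sub_Var ren_as_sub(1)[of "up_ren Suc"])
qed

lemma Lam_eta_type:
  assumes "\<Gamma> \<turnstile>\<^sub>J A" "A # \<Gamma> \<turnstile>\<^sub>J B" "\<Gamma> \<turnstile> f \<Colon> JPi A B"
  shows "\<Gamma> \<turnstile> Lam A B (App (wkJ A) (renJ (up_ren Suc) B) (wkT f) (Var 0)) \<Colon> JPi A B"
  using Lam[OF assms(1,2)] App[OF weakening(1)[OF assms(1,1)] wk_up[OF assms(2,1)], of "wkT f" "Var 0"]
    weakening(3)[OF assms(1,3)] var_0[OF assms(1)] by simp

lemma Bind_eta_type:
  assumes "\<Gamma> \<turnstile> A \<Colon> TpPos" "\<Gamma> \<turnstile> e \<Colon> TmNeg (F A)"
  shows "\<Gamma> \<turnstile> Bind A (F A) e (Lam (TmPos A) (wkJ (TmNeg (F A))) (Ret (wkT A) (Var 0))) \<Colon> TmNeg (F A)"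
proof -
  have "TmPos A # \<Gamma> \<turnstile> Ret (wkT A) (Var 0) \<Colon> wkJ (TmNeg (F A))"
    using Ret[OF wk_TpPos(1)[OF TmPos[OF assms(1)] assms(1)] var_0_TmPos[OF assms(1)]] by simp
  then show ?thesis
    using assms weakening(1)[OF TmPos[OF assms(1)] TmNeg[OF F[OF assms(1)]]] by (blast intro: Bind F Lam TmPos)
qed

lemma Bind_assoc_type:
  assumes "\<Gamma> \<turnstile> A \<Colon> TpPos" "\<Gamma> \<turnstile> B \<Colon> TpPos" "\<Gamma> \<turnstile> X \<Colon> TpNeg" "\<Gamma> \<turnstile> e \<Colon> TmNeg (F A)"
    "\<Gamma> \<turnstile> f \<Colon> Arr (TmPos A) (TmNeg (F B))" "\<Gamma> \<turnstile> g \<Colon> Arr (TmPos B) (TmNeg X)"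
  shows "\<Gamma> \<turnstile> Bind A X e (Lam (TmPos A) (wkJ (TmNeg X)) (Bind (wkT B) (wkT X)
      (app (wkJ (TmPos A)) (wkJ (TmNeg (F B))) (wkT f) (Var 0)) (wkT g))) \<Colon> TmNeg X"
proof -
  note A = TmPos[OF assms(1)]
  have "TmPos A # \<Gamma> \<turnstile> wkT B \<Colon> TpPos" "TmPos A # \<Gamma> \<turnstile> wkT X \<Colon> TpNeg"
    using weakening(3)[OF A assms(2)] weakening(3)[OF A assms(3)] by simp_all
  moreover have "TmPos A # \<Gamma> \<turnstile> app (wkJ (TmPos A)) (wkJ (TmNeg (F B))) (wkT f) (Var 0) \<Colon> TmNeg (F (wkT B))"
    using app_type[OF weakening(1)[OF A A] weakening(1)[OF A TmNeg[OF F[OF assms(2)]]], of "wkT f" "Var 0"]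
      weakening(3)[OF A assms(5)] var_0[OF A] by (simp add: ren_ren)
  moreover have "TmPos A # \<Gamma> \<turnstile> wkT g \<Colon> Arr (TmPos (wkT B)) (TmNeg (wkT X))"
    using weakening(3)[OF A assms(6)] by (simp add: ren_ren)
  ultimately have "TmPos A # \<Gamma> \<turnstile> Bind (wkT B) (wkT X)
      (app (wkJ (TmPos A)) (wkJ (TmNeg (F B))) (wkT f) (Var 0)) (wkT g) \<Colon> wkJ (TmNeg X)"
    by (simp add: Bind)
  then show ?thesis
    by (intro Bind assms Lam A weakening(1)[OF A TmNeg[OF assms(3)]])
qed

context
  fixes \<Gamma> :: "('c::monoid_add) jdg list" and A A'
  assumes A: "\<Gamma> \<turnstile> A \<Colon> TpPos" and AA': "\<Gamma> \<turnstile> A \<doteq> A' \<Colon> TpPos" and A': "\<Gamma> \<turnstile> A' \<Colon> TpPos"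
begin

lemma Ret_retype: "\<Gamma> \<turnstile> a' \<Colon> TmPos A \<Longrightarrow> \<Gamma> \<turnstile> Ret A' a' \<Colon> TmNeg (F A)"
  by (rule conv[OF Ret[OF A' conv[OF _ TmPos_cong[OF AA']]] eqJ_sym[OF TmNeg_cong[OF F_cong[OF AA']]]])

lemma Bind_retype:
  assumes "\<Gamma> \<turnstile> X \<doteq> X' \<Colon> TpNeg" "\<Gamma> \<turnstile> X' \<Colon> TpNeg" "\<Gamma> \<turnstile> e' \<Colon> TmNeg (F A)"
    "\<Gamma> \<turnstile> f' \<Colon> Arr (TmPos A) (TmNeg X)"
  shows "\<Gamma> \<turnstile> Bind A' X' e' f' \<Colon> TmNeg X"
  by (rule conv[OF Bind[OF A' assms(2) conv[OF assms(3) TmNeg_cong[OF F_cong[OF AA']]]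
          conv[OF assms(4) Arr_TmNeg_cong[OF A AA' assms(1)]]] eqJ_sym[OF TmNeg_cong[OF assms(1)]]])

lemma ApOpen_retype: "\<Gamma> \<turnstile> u' \<Colon> TmPos (Open A) \<Longrightarrow> \<Gamma> \<turnstile> ApOpen A' u' \<Colon> Arr Beh (TmPos A)"
  by (rule conv[OF ApOpen[OF A' conv[OF _ TmPos_cong[OF Open_cong[OF AA']]]] eqJ_sym[OF Arr_Beh_cong[OF AA']]])

lemma LamOpen_retype: "\<Gamma> \<turnstile> f' \<Colon> Arr Beh (TmPos A) \<Longrightarrow> \<Gamma> \<turnstile> LamOpen A' f' \<Colon> TmPos (Open A)"
  by (rule conv[OF LamOpen[OF A' conv[OF _ Arr_Beh_cong[OF AA']]] eqJ_sym[OF TmPos_cong[OF Open_cong[OF AA']]]])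

lemma Eta_retype: "\<Gamma> \<turnstile> a' \<Colon> TmPos A \<Longrightarrow> \<Gamma> \<turnstile> Eta A' a' \<Colon> TmPos (Closed A)"
  by (rule conv[OF Eta[OF A' conv[OF _ TmPos_cong[OF AA']]] eqJ_sym[OF TmPos_cong[OF Closed_cong[OF AA']]]])

lemma Star_retype: "\<Gamma> \<turnstile> z' \<Colon> Beh \<Longrightarrow> \<Gamma> \<turnstile> Star A' z' \<Colon> TmPos (Closed A)"
  by (rule conv[OF Star[OF A'] eqJ_sym[OF TmPos_cong[OF Closed_cong[OF AA']]]])

lemma IndClosed_retype:
  assumes "\<Gamma> \<turnstile> b \<doteq> b' \<Colon> TmPos (Closed A)" "\<Gamma> \<turnstile> b' \<Colon> TmPos (Closed A)"
    "\<Gamma> \<turnstile> X \<Colon> Arr (TmPos (Closed A)) TpNeg" "\<Gamma> \<turnstile> X \<doteq> X' \<Colon> Arr (TmPos (Closed A)) TpNeg"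
    "\<Gamma> \<turnstile> X' \<Colon> Arr (TmPos (Closed A)) TpNeg"
    "\<Gamma> \<turnstile> x0 \<doteq> x0' \<Colon> JPi (TmPos A) (atEta A X)" "\<Gamma> \<turnstile> x0' \<Colon> JPi (TmPos A) (atEta A X)"
    "\<Gamma> \<turnstile> x1 \<doteq> x1' \<Colon> JPi Beh (atStar A X)" "\<Gamma> \<turnstile> x1' \<Colon> JPi Beh (atStar A X)"
    "\<Gamma> \<turnstile> h' \<Colon> glue A X x0 x1"
  shows "\<Gamma> \<turnstile> IndClosed A' b' X' x0' x1' h' \<Colon> TmNeg (atNeg (Closed A) X b)"
  by (rule conv[OF IndClosed[OF A' conv[OF assms(2) TmPos_cong[OF Closed_cong[OF AA']]]
          conv[OF assms(5) Arr_TpNeg_cong[OF Closed[OF A] Closed_cong[OF AA']]]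
          conv[OF assms(7) JPi_atEta_cong[OF A AA' assms(4)]] conv[OF assms(9) JPi_atStar_cong[OF A AA' assms(4)]]
          conv[OF assms(10) glue_cong[OF A AA' assms(3,4,6,8)]]]
        eqJ_sym[OF TmNeg_cong[OF atNeg_cong[OF Closed[OF A] Closed_cong[OF AA'] assms(4,1)]]]])

lemma EqT_retype: "\<lbrakk>\<Gamma> \<turnstile> a' \<Colon> TmPos A; \<Gamma> \<turnstile> b' \<Colon> TmPos A\<rbrakk> \<Longrightarrow> \<Gamma> \<turnstile> EqT A' a' b' \<Colon> TpPos"
  by (rule EqT[OF A' conv[OF _ TmPos_cong[OF AA']] conv[OF _ TmPos_cong[OF AA']]])

context
  fixes a a' b b'
  assumes a: "\<Gamma> \<turnstile> a \<doteq> a' \<Colon> TmPos A" "\<Gamma> \<turnstile> a' \<Colon> TmPos A" and b: "\<Gamma> \<turnstile> b \<doteq> b' \<Colon> TmPos A" "\<Gamma> \<turnstile> b' \<Colon> TmPos A"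
begin

lemma RefT_retype: "\<Gamma> \<turnstile> p' \<Colon> JEq (TmPos A) a b \<Longrightarrow> \<Gamma> \<turnstile> RefT A' a' b' p' \<Colon> TmPos (EqT A a b)"
  by (rule conv[OF RefT[OF A' conv[OF a(2) TmPos_cong[OF AA']] conv[OF b(2) TmPos_cong[OF AA']]
          conv[OF _ JEq_cong[OF TmPos_cong[OF AA'] a(1) b(1)]]] eqJ_sym[OF TmPos_cong[OF EqT_cong[OF AA' a(1) b(1)]]]])

lemma SelfT_retype: "\<Gamma> \<turnstile> u' \<Colon> TmPos (EqT A a b) \<Longrightarrow> \<Gamma> \<turnstile> SelfT A' a' b' u' \<Colon> JEq (TmPos A) a b"
  by (rule conv[OF SelfT[OF A' conv[OF a(2) TmPos_cong[OF AA']] conv[OF b(2) TmPos_cong[OF AA']]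
          conv[OF _ TmPos_cong[OF EqT_cong[OF AA' a(1) b(1)]]]] eqJ_sym[OF JEq_cong[OF TmPos_cong[OF AA'] a(1) b(1)]]])

end

context
  fixes X X'
  assumes XX': "\<Gamma> \<turnstile> X \<doteq> X' \<Colon> Arr (TmPos A) TpNeg" and X': "\<Gamma> \<turnstile> X' \<Colon> Arr (TmPos A) TpNeg"
begin

private lemma X'': "\<Gamma> \<turnstile> X' \<Colon> Arr (TmPos A') TpNeg"
  by (rule conv[OF X' Arr_TpNeg_cong[OF A AA']])

lemma PiT_retype: "\<Gamma> \<turnstile> PiT A' X' \<Colon> TpNeg"
  by (rule PiT[OF A' X''])

lemma Ap_retype: "\<Gamma> \<turnstile> u' \<Colon> TmNeg (PiT A X) \<Longrightarrow> \<Gamma> \<turnstile> Ap A' X' u' \<Colon> JPi (TmPos A) (famNeg A X)"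
  by (rule conv[OF Ap[OF A' X'' conv[OF _ TmNeg_cong[OF PiT_cong[OF AA' XX']]]] eqJ_sym[OF JPi_famNeg_cong[OF A AA' XX']]])

lemma LamT_retype: "\<Gamma> \<turnstile> f' \<Colon> JPi (TmPos A) (famNeg A X) \<Longrightarrow> \<Gamma> \<turnstile> LamT A' X' f' \<Colon> TmNeg (PiT A X)"
  by (rule conv[OF LamT[OF A' X'' conv[OF _ JPi_famNeg_cong[OF A AA' XX']]] eqJ_sym[OF TmNeg_cong[OF PiT_cong[OF AA' XX']]]])

end

context
  fixes B B'
  assumes BB': "\<Gamma> \<turnstile> B \<doteq> B' \<Colon> Arr (TmPos A) TpPos" and B': "\<Gamma> \<turnstile> B' \<Colon> Arr (TmPos A) TpPos"
begin

private lemma B'': "\<Gamma> \<turnstile> B' \<Colon> Arr (TmPos A') TpPos"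
  by (rule conv[OF B' Arr_TpPos_cong[OF A AA']])

lemma SigmaT_retype: "\<Gamma> \<turnstile> SigmaT A' B' \<Colon> TpPos"
  by (rule SigmaT[OF A' B''])

lemma Unpair_retype: "\<Gamma> \<turnstile> u' \<Colon> TmPos (SigmaT A B) \<Longrightarrow> \<Gamma> \<turnstile> Unpair A' B' u' \<Colon> JSigma (TmPos A) (famPos A B)"
  by (rule conv[OF Unpair[OF A' B'' conv[OF _ TmPos_cong[OF SigmaT_cong[OF AA' BB']]]] eqJ_sym[OF JSigma_famPos_cong[OF A AA' BB']]])

lemma PairT_retype: "\<Gamma> \<turnstile> p' \<Colon> JSigma (TmPos A) (famPos A B) \<Longrightarrow> \<Gamma> \<turnstile> PairT A' B' p' \<Colon> TmPos (SigmaT A B)"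
  by (rule conv[OF PairT[OF A' B'' conv[OF _ JSigma_famPos_cong[OF A AA' BB']]] eqJ_sym[OF TmPos_cong[OF SigmaT_cong[OF AA' BB']]]])

end

end

lemma Step_retype:
  assumes "\<Gamma> \<turnstile> X \<doteq> X' \<Colon> TpNeg" "\<Gamma> \<turnstile> X' \<Colon> TpNeg" "\<Gamma> \<turnstile> e' \<Colon> TmNeg X"
  shows "\<Gamma> \<turnstile> Step X' c e' \<Colon> TmNeg X"
  by (rule conv[OF Step[OF assms(2) conv[OF assms(3) TmNeg_cong[OF assms(1)]]] eqJ_sym[OF TmNeg_cong[OF assms(1)]]])

lemma IndNat_retype:
  assumes "\<Gamma> \<turnstile> n \<doteq> n' \<Colon> TmPos NatT" "\<Gamma> \<turnstile> n' \<Colon> TmPos NatT"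
    "\<Gamma> \<turnstile> X \<Colon> Arr (TmPos NatT) TpNeg" "\<Gamma> \<turnstile> X \<doteq> X' \<Colon> Arr (TmPos NatT) TpNeg" "\<Gamma> \<turnstile> X' \<Colon> Arr (TmPos NatT) TpNeg"
    "\<Gamma> \<turnstile> e0' \<Colon> TmNeg (atNeg NatT X Zero)" "\<Gamma> \<turnstile> e1' \<Colon> JPi (TmPos NatT) (indStep X)"
  shows "\<Gamma> \<turnstile> IndNat n' X' e0' e1' \<Colon> TmNeg (atNeg NatT X n)"
proof -
  note N = NatT[OF ctx_of(4)[OF assms(2)]] and Z = Zero[OF ctx_of(4)[OF assms(2)]]
  show ?thesis
    by (rule conv[OF IndNat[OF assms(2,5) conv[OF assms(6) TmNeg_cong[OF atNeg_cong[OF N eq_refl[OF N] assms(4) eq_refl[OF Z]]]]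
            conv[OF assms(7) JPi_indStep_cong[OF assms(3,4)]]]
          eqJ_sym[OF TmNeg_cong[OF atNeg_cong[OF N eq_refl[OF N] assms(4,1)]]]])
qed

lemma IndNat_Succ_type:
  assumes "\<Gamma> \<turnstile> n \<Colon> TmPos NatT" "\<Gamma> \<turnstile> X \<Colon> Arr (TmPos NatT) TpNeg"
    "\<Gamma> \<turnstile> e0 \<Colon> TmNeg (atNeg NatT X Zero)" "\<Gamma> \<turnstile> e1 \<Colon> JPi (TmPos NatT) (indStep X)"
  shows "\<Gamma> \<turnstile> app (TmNeg (atNeg NatT X n)) (TmNeg (atNeg NatT X (Succ n)))
            (App (TmPos NatT) (indStep X) e1 n) (IndNat n X e0 e1) \<Colon> TmNeg (atNeg NatT X (Succ n))"
proof (rule app_type)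
  note N = NatT[OF ctx_of(4)[OF assms(1)]]
  show "\<Gamma> \<turnstile>\<^sub>J TmNeg (atNeg NatT X n)" "\<Gamma> \<turnstile>\<^sub>J TmNeg (atNeg NatT X (Succ n))"
    by (intro TmNeg atNeg N Succ assms)+
  show "\<Gamma> \<turnstile> App (TmPos NatT) (indStep X) e1 n \<Colon> Arr (TmNeg (atNeg NatT X n)) (TmNeg (atNeg NatT X (Succ n)))"
    using App[OF TmPos[OF N] indStep[OF assms(2)] assms(4,1)] by simp
  show "\<Gamma> \<turnstile> IndNat n X e0 e1 \<Colon> TmNeg (atNeg NatT X n)"
    by (rule IndNat[OF assms])
qed

lemmas retype_rules = JPi_retype JSigma_retype Lam_retype App_retype Pair_retype Fst_retype Snd_retype JEq_retype
  Refl_retype Refl_eta_type Snd_beta_type Lam_eta_type Bind_eta_type Bind_assoc_type Ret_retype Bind_retype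
  ApOpen_retype LamOpen_retype Eta_retype Star_retype IndClosed_retype EqT_retype RefT_retype SelfT_retype
  PiT_retype Ap_retype LamT_retype SigmaT_retype Unpair_retype PairT_retype Step_retype IndNat_retype
  IndNat_Succ_type App_atEta App_atStar App_famNeg conv inst(3) inst(1)

text \<open>Congruences are settled by the retyping lemmas, computation rules by typing both sides.
  From here on an equation alone suffices to recover the typing of its sides and the formation of
  its judgment.\<close>

lemma presup:
  shows "\<turnstile>\<^sub>C \<Gamma> \<Longrightarrow> True"
    and "\<Gamma> \<turnstile>\<^sub>J J \<Longrightarrow> True"
    and "\<Gamma> \<turnstile>\<^sub>J J \<doteq> K \<Longrightarrow> \<Gamma> \<turnstile>\<^sub>J J \<and> \<Gamma> \<turnstile>\<^sub>J K"
    and "\<Gamma> \<turnstile> t \<Colon> J \<Longrightarrow> \<Gamma> \<turnstile>\<^sub>J J"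
    and "\<Gamma> \<turnstile> t \<doteq> u \<Colon> J \<Longrightarrow> \<Gamma> \<turnstile>\<^sub>J J \<and> \<Gamma> \<turnstile> t \<Colon> J \<and> \<Gamma> \<turnstile> u \<Colon> J"
  by (induct rule: wf_ctx_is_jdg_eq_jdg_has_jdg_eq_tm.inducts)
    (((elim conjE)?; (intro TrueI conjI)?;
    (assumption | (rule ctx_nth, assumption, assumption) | (rule retype_rules; (assumption | (rule typing_rules App_famNeg Step[OF PiT]; (assumption | rule ctx_of, assumption)))) | (rule typing_rules App_famNeg inst(1); (assumption | rule ctx_of, assumption | (rule typing_rules App_famNeg atNeg; (assumption | rule ctx_of, assumption | (rule typing_rules App_famNeg Step[OF PiT]; (assumption | rule ctx_of, assumption)))))) | (rule jdg_rules typing_rules; (assumption | rule ctx_of, assumption | (rule jdg_rules typing_rules; (assumption | rule ctx_of, assumption | (rule jdg_rules typing_rules; (assumption | rule ctx_of, assumption | (rule jdg_rules typing_rules; (assumption | rule ctx_of, assumption))))))))))[1])+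

lemmas presups = presup(3)[THEN conjunct1] presup(3)[THEN conjunct2] presup(4) presup(5)[THEN conjunct1]
  presup(5)[THEN conjunct2, THEN conjunct1] presup(5)[THEN conjunct2, THEN conjunct2]

section \<open>Computability predicates on closed types\<close>

fun is_elim :: "'c tm \<Rightarrow> bool" where
  "is_elim (App A B f a) = True"
| "is_elim (Fst A B p) = True"
| "is_elim (Snd A B p) = True"
| "is_elim t = False"

text \<open>No constant of the signature eliminates into \<open>TpPos\<close> or \<open>TpNeg\<close>, so closed types are computed by
  framework-level reduction alone, and every constant counts as a value.\<close>

inductive ev :: "'c tm \<Rightarrow> 'c tm \<Rightarrow> bool" where
  ev_val: "\<not> is_elim t \<Longrightarrow> ev t t"
| ev_App: "\<lbrakk>ev f (Lam A' B' b); ev (instT b a) v\<rbrakk> \<Longrightarrow> ev (App A B f a) v"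
| ev_Fst: "\<lbrakk>ev p (Pair A' B' a b); ev a v\<rbrakk> \<Longrightarrow> ev (Fst A B p) v"
| ev_Snd: "\<lbrakk>ev p (Pair A' B' a b); ev b v\<rbrakk> \<Longrightarrow> ev (Snd A B p) v"

inductive_cases ev_AppE: "ev (App A B f a) v"
inductive_cases ev_FstE: "ev (Fst A B p) v"
inductive_cases ev_SndE: "ev (Snd A B p) v"

text \<open>Uniqueness of values is what makes the predicate attached to a raw type expression
  unique.\<close>

lemma ev_det: "ev t v \<Longrightarrow> ev t w \<Longrightarrow> v = w"
proof (induct arbitrary: w rule: ev.induct)
  case (ev_val t)
  from ev_val(2,1) show ?case by cases auto
next
  case (ev_App f A' B' b a v A B)
  from ev_App(5) show ?case by (rule ev_AppE) (use ev_App(2,4) in auto)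
next
  case (ev_Fst p A' B' a b v A B)
  from ev_Fst(5) show ?case by (rule ev_FstE) (use ev_Fst(2,4) in auto)
next
  case (ev_Snd p A' B' a b v A B)
  from ev_Snd(5) show ?case by (rule ev_SndE) (use ev_Snd(2,4) in auto)
qed

text \<open>Abstract form of head expansion. It covers a redex over its contractum, and also two
  eliminations that differ in their annotations, since \<open>ev\<close> does not look at
  those.\<close>

definition ev_le :: "'c tm \<Rightarrow> 'c tm \<Rightarrow> bool" where
  "ev_le t u \<longleftrightarrow> (\<forall>v. ev t v \<longrightarrow> ev u v)"

lemma ev_le_refl: "ev_le t t"
  by (simp add: ev_le_def)

lemma ev_le_App: "ev_le f g \<Longrightarrow> ev_le (App A B f a) (App A' B' g a)"
  unfolding ev_le_def by (auto elim!: ev_AppE intro: ev_App)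

lemma ev_le_Fst: "ev_le p q \<Longrightarrow> ev_le (Fst A B p) (Fst A' B' q)"
  unfolding ev_le_def by (auto elim!: ev_FstE intro: ev_Fst)

lemma ev_le_Snd: "ev_le p q \<Longrightarrow> ev_le (Snd A B p) (Snd A' B' q)"
  unfolding ev_le_def by (auto elim!: ev_SndE intro: ev_Snd)

section \<open>The predicates: uniqueness, expansion, closure under equality and step\<close>

abbreviation fstT :: "'c tm \<Rightarrow> 'c tm \<Rightarrow> 'c tm \<Rightarrow> 'c tm" where
  "fstT A B t \<equiv> Fst (TmPos A) (famPos A B) (Unpair A B t)"
abbreviation sndT :: "'c tm \<Rightarrow> 'c tm \<Rightarrow> 'c tm \<Rightarrow> 'c tm" where
  "sndT A B t \<equiv> Snd (TmPos A) (famPos A B) (Unpair A B t)"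
abbreviation apT :: "'c tm \<Rightarrow> 'c tm \<Rightarrow> 'c tm \<Rightarrow> 'c tm \<Rightarrow> 'c tm" where
  "apT A X t a \<equiv> App (TmPos A) (famNeg A X) (Ap A X t) a"

text \<open>\<open>redP A R\<close>: the closed value type \<open>A\<close> has the set \<open>R\<close> of computable closed terms; likewise
  \<open>redN X R\<close> for computation types.  There will be no closed term of \<open>Beh\<close>, so \<open>Open\<close> imposes nothing and
  \<open>Star\<close> does not occur in \<open>Closed\<close>.\<close>

inductive redP :: "('c::monoid_add) tm \<Rightarrow> ('c tm \<Rightarrow> bool) \<Rightarrow> bool"
  and redN :: "('c::monoid_add) tm \<Rightarrow> ('c tm \<Rightarrow> bool) \<Rightarrow> bool" where
  redP_U: "\<lbrakk>ev A (U X); [] \<turnstile> A \<doteq> U X \<Colon> TpPos; redN X R\<rbrakk> \<Longrightarrow> redP A R"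
| redP_Open: "\<lbrakk>ev A (Open B); [] \<turnstile> A \<doteq> Open B \<Colon> TpPos\<rbrakk> \<Longrightarrow> redP A (\<lambda>t. [] \<turnstile> t \<Colon> TmPos A)"
| redP_Closed: "\<lbrakk>ev A (Closed B); [] \<turnstile> A \<doteq> Closed B \<Colon> TpPos; [] \<turnstile> B \<Colon> TpPos; redP B S\<rbrakk>
    \<Longrightarrow> redP A (\<lambda>t. \<exists>a. S a \<and> [] \<turnstile> t \<doteq> Eta B a \<Colon> TmPos A)"
| redP_Sigma: "\<lbrakk>ev A (SigmaT B C); [] \<turnstile> A \<doteq> SigmaT B C \<Colon> TpPos; [] \<turnstile> B \<Colon> TpPos; [] \<turnstile> C \<Colon> Arr (TmPos B) TpPos;
      redP B S; \<And>a. S a \<Longrightarrow> redP (atPos B C a) (T a); \<And>a a'. \<lbrakk>S a; [] \<turnstile> a \<doteq> a' \<Colon> TmPos B\<rbrakk> \<Longrightarrow> T a = T a'\<rbrakk>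
    \<Longrightarrow> redP A (\<lambda>t. [] \<turnstile> t \<Colon> TmPos A \<and> S (fstT B C t) \<and> T (fstT B C t) (sndT B C t))"
| redP_Eq: "\<lbrakk>ev A (EqT B a b); [] \<turnstile> A \<doteq> EqT B a b \<Colon> TpPos\<rbrakk> \<Longrightarrow> redP A (\<lambda>t. [] \<turnstile> t \<Colon> TmPos A)"
| redP_Nat: "\<lbrakk>ev A NatT; [] \<turnstile> A \<doteq> NatT \<Colon> TpPos\<rbrakk> \<Longrightarrow> redP A (\<lambda>t. \<exists>n. [] \<turnstile> t \<doteq> (Succ ^^ n) Zero \<Colon> TmPos A)"
| redN_F: "\<lbrakk>ev X (F B); [] \<turnstile> X \<doteq> F B \<Colon> TpNeg; [] \<turnstile> B \<Colon> TpPos; redP B S\<rbrakk>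
    \<Longrightarrow> redN X (\<lambda>t. \<exists>c a. S a \<and> [] \<turnstile> t \<doteq> Step (F B) c (Ret B a) \<Colon> TmNeg X)"
| redN_Pi: "\<lbrakk>ev X (PiT B Y); [] \<turnstile> X \<doteq> PiT B Y \<Colon> TpNeg; [] \<turnstile> B \<Colon> TpPos; [] \<turnstile> Y \<Colon> Arr (TmPos B) TpNeg;
      redP B S; \<And>a. S a \<Longrightarrow> redN (atNeg B Y a) (T a); \<And>a a'. \<lbrakk>S a; [] \<turnstile> a \<doteq> a' \<Colon> TmPos B\<rbrakk> \<Longrightarrow> T a = T a'\<rbrakk>
    \<Longrightarrow> redN X (\<lambda>t. [] \<turnstile> t \<Colon> TmNeg X \<and> (\<forall>a. S a \<longrightarrow> T a (apT B Y t a)))"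

lemma red_typed:
  shows "redP A R \<Longrightarrow> [] \<turnstile> A \<Colon> TpPos \<and> (\<forall>t. R t \<longrightarrow> [] \<turnstile> t \<Colon> TmPos A)"
    and "redN X R \<Longrightarrow> [] \<turnstile> X \<Colon> TpNeg \<and> (\<forall>t. R t \<longrightarrow> [] \<turnstile> t \<Colon> TmNeg X)"
proof (induct rule: redP_redN.inducts)
  case (redP_U A X R)
  then show ?case by (blast intro: presups conv eqJ_sym TmPos_cong)
qed (blast intro: presups)+

text \<open>By determinism of evaluation both derivations end with the same clause and the same
  components. In the dependent cases the two families of predicates are known to agree only on
  computable elements of the domain, which suffices because the resulting predicate consults them
  only there.\<close>

lemma red_unique:
  fixes A X :: "('c::monoid_add) tm"
  shows "redP A R \<Longrightarrow> redP A R' \<Longrightarrow> R = R'" and "redN X R \<Longrightarrow> redN X R' \<Longrightarrow> R = R'"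
proof (induct arbitrary: R' and R' rule: redP_redN.inducts)
  case (redP_U A X R)
  from redP_U(5) show ?case by cases (use redP_U ev_det in blast)+
next
  case (redP_Open A B)
  from redP_Open(3) show ?case by cases (use redP_Open ev_det in blast)+
next
  case (redP_Closed A B S)
  note outer = redP_Closed
  from redP_Closed(6) show ?case
  proof cases
    case (redP_Closed B' S')
    with ev_det[OF outer(1) this(2)] outer(5) show ?thesis by auto
  qed (use ev_det[OF redP_Closed(1)] in blast)+
next
  case (redP_Sigma A B C S T)
  note outer = redP_Sigma
  from redP_Sigma(10) show ?case
  proof cases
    case (redP_Sigma B' C' S' T')
    from ev_det[OF outer(1) this(2)] have eq: "B' = B" "C' = C" by auto
    with redP_Sigma outer(6) have S: "S' = S" by auto
    have "T a = T' a" if "S a" for a using outer(8)[OF that] redP_Sigma S eq that by auto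
    with redP_Sigma(1) S eq show ?thesis by auto
  qed (use ev_det[OF redP_Sigma(1)] in blast)+
next
  case (redP_Eq A B a b)
  from redP_Eq(3) show ?case by cases (use redP_Eq ev_det in blast)+
next
  case (redP_Nat A)
  from redP_Nat(3) show ?case by cases (use redP_Nat ev_det in blast)+
next
  case (redN_F X B S)
  note outer = redN_F
  from redN_F(6) show ?case
  proof cases
    case (redN_F B' S')
    with ev_det[OF outer(1) this(2)] outer(5) show ?thesis by auto
  qed (use ev_det[OF redN_F(1)] in blast)+
next
  case (redN_Pi X B Y S T)
  note outer = redN_Pi
  from redN_Pi(10) show ?case
  proof cases
    case (redN_Pi B' Y' S' T')
    from ev_det[OF outer(1) this(2)] have eq: "B' = B" "Y' = Y" by auto
    with redN_Pi outer(6) have S: "S' = S" by auto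
    have "T a = T' a" if "S a" for a using outer(8)[OF that] redN_Pi S eq that by auto
    with redN_Pi(1) S eq show ?thesis by auto
  qed (use ev_det[OF redN_Pi(1)] in blast)+
qed

lemma fstT_cong:
  assumes "\<Gamma> \<turnstile> A \<Colon> TpPos" "\<Gamma> \<turnstile> B \<Colon> Arr (TmPos A) TpPos" "\<Gamma> \<turnstile> t \<doteq> u \<Colon> TmPos (SigmaT A B)"
  shows "\<Gamma> \<turnstile> fstT A B t \<doteq> fstT A B u \<Colon> TmPos A"
  by (rule Fst_cong[OF TmPos[OF assms(1)] eqJ_refl[OF TmPos[OF assms(1)]] eqJ_refl[OF famPos[OF assms(1,2)]]
        Unpair_cong[OF eq_refl[OF assms(1)] eq_refl[OF assms(2)] assms(3)]])

lemma sndT_cong: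
  assumes "\<Gamma> \<turnstile> A \<Colon> TpPos" "\<Gamma> \<turnstile> B \<Colon> Arr (TmPos A) TpPos" "\<Gamma> \<turnstile> t \<doteq> u \<Colon> TmPos (SigmaT A B)"
  shows "\<Gamma> \<turnstile> sndT A B t \<doteq> sndT A B u \<Colon> TmPos (atPos A B (fstT A B t))"
  using Snd_cong[OF TmPos[OF assms(1)] eqJ_refl[OF TmPos[OF assms(1)]] eqJ_refl[OF famPos[OF assms(1,2)]]
        Unpair_cong[OF eq_refl[OF assms(1)] eq_refl[OF assms(2)] assms(3)]] by simp

lemma apT_cong:
  assumes "\<Gamma> \<turnstile> A \<Colon> TpPos" "\<Gamma> \<turnstile> X \<Colon> Arr (TmPos A) TpNeg" "\<Gamma> \<turnstile> t \<doteq> u \<Colon> TmNeg (PiT A X)" "\<Gamma> \<turnstile> a \<doteq> b \<Colon> TmPos A"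
  shows "\<Gamma> \<turnstile> apT A X t a \<doteq> apT A X u b \<Colon> TmNeg (atNeg A X a)"
  using App_cong[OF TmPos[OF assms(1)] eqJ_refl[OF TmPos[OF assms(1)]] eqJ_refl[OF famNeg[OF assms(1,2)]]
        Ap_cong[OF eq_refl[OF assms(1)] eq_refl[OF assms(2)] assms(3)] assms(4)] by simp

lemma jdg_conv_iff:
  assumes "\<Gamma> \<turnstile>\<^sub>J J \<doteq> K"
  shows "\<Gamma> \<turnstile> t \<Colon> J \<longleftrightarrow> \<Gamma> \<turnstile> t \<Colon> K" and "\<Gamma> \<turnstile> t \<doteq> u \<Colon> J \<longleftrightarrow> \<Gamma> \<turnstile> t \<doteq> u \<Colon> K"
  using assms by (blast intro: conv eqJ_sym, blast intro: eq_conv eqJ_sym)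

text \<open>\<open>ev_le\<close> keeps the value, hence the clause. The separate equation supplies
  the judgmental premise of that clause and identifies \<open>TmPos A'\<close> with
  \<open>TmPos A\<close> inside the predicate.\<close>

lemma red_expand:
  shows "\<lbrakk>redP A R; ev_le A A'; [] \<turnstile> A' \<doteq> A \<Colon> TpPos\<rbrakk> \<Longrightarrow> redP A' R"
    and "\<lbrakk>redN X R; ev_le X X'; [] \<turnstile> X' \<doteq> X \<Colon> TpNeg\<rbrakk> \<Longrightarrow> redN X' R"
proof -
  assume le: "ev_le A A'" and eq: "[] \<turnstile> A' \<doteq> A \<Colon> TpPos"
  note [simp] = jdg_conv_iff[OF TmPos_cong[OF eq]]
  assume "redP A R"
  then show "redP A' R"
  proof cases
    case (redP_U X)
    with le eq show ?thesis by (blast intro: redP_redN.redP_U eq_trans ev_le_def[THEN iffD1, rule_format])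
  next
    case (redP_Open B)
    with le eq redP_redN.redP_Open[of A' B] show ?thesis by (auto simp: ev_le_def intro: eq_trans)
  next
    case (redP_Closed B S)
    with le eq redP_redN.redP_Closed[of A' B S] show ?thesis by (auto simp: ev_le_def intro: eq_trans)
  next
    case (redP_Sigma B C S T)
    with le eq redP_redN.redP_Sigma[of A' B C S T] show ?thesis by (auto simp: ev_le_def intro: eq_trans)
  next
    case (redP_Eq B a b)
    with le eq redP_redN.redP_Eq[of A' B a b] show ?thesis by (auto simp: ev_le_def intro: eq_trans)
  next
    case redP_Nat
    with le eq redP_redN.redP_Nat[of A'] show ?thesis by (auto simp: ev_le_def intro: eq_trans)
  qed
next
  assume le: "ev_le X X'" and eq: "[] \<turnstile> X' \<doteq> X \<Colon> TpNeg"
  note [simp] = jdg_conv_iff[OF TmNeg_cong[OF eq]]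
  assume "redN X R"
  then show "redN X' R"
  proof cases
    case (redN_F B S)
    with le eq redP_redN.redN_F[of X' B S] show ?thesis by (auto simp: ev_le_def intro: eq_trans)
  next
    case (redN_Pi B Y S T)
    with le eq redP_redN.redN_Pi[of X' B Y S T] show ?thesis by (auto simp: ev_le_def intro: eq_trans)
  qed
qed

text \<open>In the Sigma case the first projection of \<open>u\<close> is a different term, equal to
  that of \<open>t\<close>. The requirement that \<open>T\<close> agree on equal elements lets the
  second projection be judged by the predicate over the new one.\<close>

lemma red_closed:
  fixes A X :: "('c::monoid_add) tm"
  shows "redP A R \<Longrightarrow> R t \<Longrightarrow> [] \<turnstile> t \<doteq> u \<Colon> TmPos A \<Longrightarrow> R u"
    and "redN X R \<Longrightarrow> R t \<Longrightarrow> [] \<turnstile> t \<doteq> u \<Colon> TmNeg X \<Longrightarrow> R u"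
proof (induct arbitrary: t u and t u rule: redP_redN.inducts)
  case (redP_U A X R)
  then show ?case by (blast intro: eq_conv TmPos_cong)
next
  case (redP_Closed A B S)
  then show ?case by (blast intro: eq_sym eq_trans)
next
  case (redP_Sigma A B C S T)
  from redP_Sigma(11) eq_conv[OF _ TmPos_cong[OF redP_Sigma(2)]]
  have tu: "[] \<turnstile> t \<doteq> u \<Colon> TmPos (SigmaT B C)" using redP_Sigma by blast
  have f: "[] \<turnstile> fstT B C t \<doteq> fstT B C u \<Colon> TmPos B" by (rule fstT_cong[OF redP_Sigma(3,4) tu])
  have s: "[] \<turnstile> sndT B C t \<doteq> sndT B C u \<Colon> TmPos (atPos B C (fstT B C t))"
    by (rule sndT_cong[OF redP_Sigma(3,4) tu])
  from redP_Sigma have S: "S (fstT B C t)" "T (fstT B C t) (sndT B C t)" by auto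
  with redP_Sigma(6) f have "S (fstT B C u)" by blast
  moreover from redP_Sigma(8) S s have "T (fstT B C t) (sndT B C u)" by blast
  moreover from redP_Sigma(9) S f have "T (fstT B C t) = T (fstT B C u)" by blast
  ultimately show ?case using redP_Sigma(11) by (auto intro: presups)
next
  case (redP_Nat A)
  then show ?case by (blast intro: eq_sym eq_trans)
next
  case (redN_F X B S)
  then show ?case by (blast intro: eq_sym eq_trans)
next
  case (redN_Pi X B Y S T)
  from redN_Pi(11) have tu: "[] \<turnstile> t \<doteq> u \<Colon> TmNeg (PiT B Y)"
    by (rule eq_conv[OF _ TmNeg_cong[OF redN_Pi(2)]])
  show ?case
  proof (intro conjI allI impI)
    show "[] \<turnstile> u \<Colon> TmNeg X" using redN_Pi(11) by (rule presups)
    fix a assume a: "S a"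
    then have "[] \<turnstile> a \<Colon> TmPos B" using redN_Pi(5) red_typed(1) by blast
    from apT_cong[OF redN_Pi(3,4) tu eq_refl[OF this]] redN_Pi(8)[OF a] redN_Pi(10) a
    show "T a (apT B Y u a)" by blast
  qed
qed (blast intro: presups)+

text \<open>At \<open>F\<close> the costs are combined by \<open>Step_add\<close>; at
  \<open>PiT\<close> the equation \<open>Ap_Step\<close> moves the step to the value at each
  argument. Validity of \<open>Step\<close> and of \<open>Bind\<close> at an arbitrary computation
  type depends on this.\<close>

lemma red_step:
  fixes A X :: "('c::monoid_add) tm"
  shows "redP A R \<Longrightarrow> True" and "redN X R \<Longrightarrow> R t \<Longrightarrow> R (Step X c t)"
proof (induct arbitrary: and t rule: redP_redN.inducts)
  case (redN_F X B S)
  then obtain d a where a: "S a" and t: "[] \<turnstile> t \<doteq> Step (F B) d (Ret B a) \<Colon> TmNeg X" by blast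
  have B: "[] \<turnstile> B \<Colon> TpPos" "[] \<turnstile> a \<Colon> TmPos B" using redN_F(4) a red_typed(1) by blast+
  have "[] \<turnstile> Step X c t \<doteq> Step (F B) c (Step (F B) d (Ret B a)) \<Colon> TmNeg X"
    using redN_F(2) t by (rule Step_cong)
  moreover have "[] \<turnstile> Step (F B) c (Step (F B) d (Ret B a)) \<doteq> Step (F B) (c + d) (Ret B a) \<Colon> TmNeg X"
    by (rule eq_conv[OF Step_add[OF F[OF B(1)] Ret[OF B]] eqJ_sym[OF TmNeg_cong[OF redN_F(2)]]])
  ultimately show ?case using a eq_trans by blast
next
  case (redN_Pi X B Y S T)
  from redN_Pi(10) have t: "[] \<turnstile> t \<Colon> TmNeg X" by simp
  note X = presups(5)[OF redN_Pi(2)]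
  have t': "[] \<turnstile> t \<Colon> TmNeg (PiT B Y)" by (rule conv[OF t TmNeg_cong[OF redN_Pi(2)]])
  have "[] \<turnstile> Step X c t \<doteq> Step (PiT B Y) c t \<Colon> TmNeg X" by (rule Step_cong[OF redN_Pi(2) eq_refl[OF t]])
  note s = eq_conv[OF this TmNeg_cong[OF redN_Pi(2)]]
  show ?case
  proof (intro conjI allI impI)
    show "[] \<turnstile> Step X c t \<Colon> TmNeg X" by (rule Step[OF X t])
    fix a assume a: "S a"
    then have a': "[] \<turnstile> a \<Colon> TmPos B" using redN_Pi(5) red_typed(1) by blast
    have "[] \<turnstile> apT B Y (Step X c t) a \<doteq> Step (atNeg B Y a) c (apT B Y t a) \<Colon> TmNeg (atNeg B Y a)"
      by (rule eq_trans[OF apT_cong[OF redN_Pi(3,4) s eq_refl[OF a']] Ap_Step[OF redN_Pi(3,4) t' a']])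
    moreover have "T a (Step (atNeg B Y a) c (apT B Y t a))" using redN_Pi(8)[OF a] redN_Pi(10) a by blast
    ultimately show "T a (apT B Y (Step X c t) a)"
      using red_closed(2)[OF redN_Pi(7)[OF a]] eq_sym by blast
  qed
qed simp_all

section \<open>The logical relation on closed judgments\<close>

text \<open>Substitution does not change the shape of a judgment, so the relation can be defined by recursion on it.\<close>

fun jsz :: "'c jdg \<Rightarrow> nat" where
  "jsz (JPi A B) = Suc (jsz A + jsz B)"
| "jsz (JSigma A B) = Suc (jsz A + jsz B)"
| "jsz (JEq A a b) = Suc (jsz A)"
| "jsz J = 0"

lemma jsz_sub [simp]: "jsz (subJ s J) = jsz J"
  by (induct J arbitrary: s rule: jsz.induct) simp_all

text \<open>Related terms are judgmentally equal by construction; a clause adds only what evaluation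
  or computability contributes. At \<open>JEq\<close> the added part concerns the endpoints rather
  than the proof, which is exactly what validity of equality reflection needs. At
  \<open>TmPos\<close> testing \<open>t\<close> suffices, as \<open>red_closed\<close> carries
  computability over to \<open>u\<close>.\<close>

function (sequential) rel :: "('c::monoid_add) jdg \<Rightarrow> 'c tm \<Rightarrow> 'c tm \<Rightarrow> bool" where
  "rel JUnit t u \<longleftrightarrow> [] \<turnstile> t \<doteq> u \<Colon> JUnit"
| "rel (JPi A B) f g \<longleftrightarrow> [] \<turnstile> f \<doteq> g \<Colon> JPi A B \<and>
     (\<forall>a b. rel A a b \<longrightarrow> rel (instJ B a) (App A B f a) (App A B g b))"
| "rel (JSigma A B) p q \<longleftrightarrow> [] \<turnstile> p \<doteq> q \<Colon> JSigma A B \<and>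
     rel A (Fst A B p) (Fst A B q) \<and> rel (instJ B (Fst A B p)) (Snd A B p) (Snd A B q)"
| "rel (JEq A a b) p q \<longleftrightarrow> [] \<turnstile> p \<doteq> q \<Colon> JEq A a b \<and> rel A a b"
| "rel TpPos A B \<longleftrightarrow> [] \<turnstile> A \<doteq> B \<Colon> TpPos \<and> (\<exists>R. redP A R \<and> redP B R)"
| "rel TpNeg X Y \<longleftrightarrow> [] \<turnstile> X \<doteq> Y \<Colon> TpNeg \<and> (\<exists>R. redN X R \<and> redN Y R)"
| "rel (TmPos A) t u \<longleftrightarrow> [] \<turnstile> t \<doteq> u \<Colon> TmPos A \<and> (\<exists>R. redP A R \<and> R t)"
| "rel Beh t u \<longleftrightarrow> False"
  by pat_completeness auto
termination by (relation "measure (\<lambda>(J, _). jsz J)") auto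

text \<open>\<open>val J K\<close>: \<open>J\<close> and \<open>K\<close> are judgmentally equal, and \<open>rel\<close> is a partial equivalence relation on both, the same one.\<close>

function (sequential) val :: "('c::monoid_add) jdg \<Rightarrow> 'c jdg \<Rightarrow> bool" where
  "val JUnit K \<longleftrightarrow> K = JUnit"
| "val (JPi A B) K \<longleftrightarrow> (\<exists>A' B'. K = JPi A' B' \<and> [A] \<turnstile>\<^sub>J B \<doteq> B' \<and> val A A' \<and>
     (\<forall>a b. rel A a b \<longrightarrow> val (instJ B a) (instJ B' b)))"
| "val (JSigma A B) K \<longleftrightarrow> (\<exists>A' B'. K = JSigma A' B' \<and> [A] \<turnstile>\<^sub>J B \<doteq> B' \<and> val A A' \<and>
     (\<forall>a b. rel A a b \<longrightarrow> val (instJ B a) (instJ B' b)))"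
| "val (JEq A a b) K \<longleftrightarrow> (\<exists>A' a' b'. K = JEq A' a' b' \<and> val A A' \<and> rel A a a' \<and> rel A b b')"
| "val TpPos K \<longleftrightarrow> K = TpPos"
| "val TpNeg K \<longleftrightarrow> K = TpNeg"
| "val (TmPos A) K \<longleftrightarrow> (\<exists>A'. K = TmPos A' \<and> rel TpPos A A')"
| "val Beh K \<longleftrightarrow> K = Beh"
  by pat_completeness auto
termination by (relation "measure (\<lambda>(J, _). jsz J)") auto

section \<open>The relation as a partial equivalence relation\<close>

lemma rel_eq: "rel J t u \<Longrightarrow> [] \<turnstile> t \<doteq> u \<Colon> J"
  by (cases J) simp_all

text \<open>Equality of closed instances at related arguments would not yield equality of open
  codomains; the conjunct \<open>[A] \<turnstile>\<^sub>J B \<doteq> B'\<close> in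
  \<open>val\<close> provides it.\<close>

lemma val_eqJ: "val J K \<Longrightarrow> [] \<turnstile>\<^sub>J J \<doteq> K"
proof (induct J K rule: val.induct)
  case (2 A B K)
  then show ?case by (auto intro!: JPi_cong intro: presups)
next
  case (3 A B K)
  then show ?case by (auto intro!: JSigma_cong intro: presups)
next
  case (4 A a b K)
  then show ?case by (auto intro!: JEq_cong rel_eq)
qed (auto intro: eqJ_refl JUnit TpPos TpNeg Beh ctx_nil TmPos_cong)

text \<open>Nothing eliminates into judgments, so equations between them come from congruence and
  equivalence rules alone. Induction on size thereby reaches both members of a valid
  equality.\<close>

lemma eqJ_jsz:
  shows "\<turnstile>\<^sub>C \<Gamma> \<Longrightarrow> True" and "\<Gamma> \<turnstile>\<^sub>J J \<Longrightarrow> True" and "\<Gamma> \<turnstile>\<^sub>J J \<doteq> K \<Longrightarrow> jsz J = jsz K"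
    and "\<Gamma> \<turnstile> t \<Colon> J \<Longrightarrow> True" and "\<Gamma> \<turnstile> t \<doteq> u \<Colon> J \<Longrightarrow> True"
  by (induct rule: wf_ctx_is_jdg_eq_jdg_has_jdg_eq_tm.inducts) simp_all

lemma val_jsz: "val J K \<Longrightarrow> jsz K = jsz J"
  using eqJ_jsz(3)[OF val_eqJ] by metis

text \<open>The properties are bundled because at \<open>JPi\<close> and \<open>JSigma\<close> each
  one uses several of the others at the domain and at instances of the codomain. Those about a
  single judgment are conditional on \<open>val J J\<close>, since \<open>rel\<close> alone does not
  force a codomain to respect related arguments. The last clause is head expansion, for beta rules
  and changes of annotation.\<close>

definition PER :: "('c::monoid_add) jdg \<Rightarrow> bool" where
  "PER J \<longleftrightarrow>
     (\<forall>K t u. val J K \<longrightarrow> rel J t u \<longrightarrow> rel K t u) \<and>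
     (\<forall>K. val J K \<longrightarrow> val K J) \<and>
     (\<forall>K L. val J K \<longrightarrow> val K L \<longrightarrow> val J L) \<and>
     (val J J \<longrightarrow> (\<forall>t u. rel J t u \<longrightarrow> rel J u t)) \<and>
     (val J J \<longrightarrow> (\<forall>t u v. rel J t u \<longrightarrow> rel J u v \<longrightarrow> rel J t v)) \<and>
     (val J J \<longrightarrow> (\<forall>t t' u. rel J t u \<longrightarrow> [] \<turnstile> t' \<doteq> t \<Colon> J \<longrightarrow> ev_le t t' \<longrightarrow> rel J t' u))"

lemma PERD:
  assumes "PER J"
  shows "val J K \<Longrightarrow> rel J t u \<Longrightarrow> rel K t u"
    and "val J K \<Longrightarrow> val K J"
    and "val J K \<Longrightarrow> val K L \<Longrightarrow> val J L"
    and "val J J \<Longrightarrow> rel J t u \<Longrightarrow> rel J u t"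
    and "val J J \<Longrightarrow> rel J t u \<Longrightarrow> rel J u v \<Longrightarrow> rel J t v"
    and "val J J \<Longrightarrow> rel J t u \<Longrightarrow> [] \<turnstile> t' \<doteq> t \<Colon> J \<Longrightarrow> ev_le t t' \<Longrightarrow> rel J t' u"
  using assms unfolding PER_def by (elim conjE, blast)+

lemma PERD':
  assumes "PER J" "val J K"
  shows "val J J" and "rel J t u \<Longrightarrow> rel J t t" and "rel J t u \<Longrightarrow> rel J u u"
proof -
  show J: "val J J" using PERD(3)[OF assms(1,2) PERD(2)[OF assms]] .
  show "rel J t t" if "rel J t u" using PERD(5)[OF assms(1) J that PERD(4)[OF assms(1) J that]] .
  show "rel J u u" if "rel J t u" using PERD(5)[OF assms(1) J PERD(4)[OF assms(1) J that] that] .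
qed

lemma PER_expand2:
  assumes "PER J" "val J J" "rel J t u" "[] \<turnstile> t' \<doteq> t \<Colon> J" "ev_le t t'" "[] \<turnstile> u' \<doteq> u \<Colon> J" "ev_le u u'"
  shows "rel J t' u'"
  by (rule PERD(4)[OF assms(1,2) PERD(6)[OF assms(1,2) PERD(4)[OF assms(1,2) PERD(6)[OF assms(1-5)]] assms(6,7)]])

text \<open>Common induction step for \<open>JPi\<close> and \<open>JSigma\<close>. The hypothesis
  is phrased by size, so that it also covers \<open>A'\<close> and every instance of
  \<open>B\<close> and \<open>B'\<close>.\<close>

locale valid_fam =
  fixes A B A' B' :: "('c::monoid_add) jdg"
  assumes PER: "\<And>C :: 'c jdg. jsz C \<le> max (jsz A) (jsz B) \<Longrightarrow> PER C"
    and vA: "val A A'" and eB: "[A] \<turnstile>\<^sub>J B \<doteq> B'" and vB: "\<And>a b. rel A a b \<Longrightarrow> val (instJ B a) (instJ B' b)"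
begin

lemma P: "PER A" "PER A'" "PER (instJ B a)" "PER (instJ B' a)"
proof -
  have [simp]: "jsz A' = jsz A" "jsz B' = jsz B" using val_jsz[OF vA] eqJ_jsz(3)[OF eB] by simp_all
  show "PER A" "PER A'" "PER (instJ B a)" "PER (instJ B' a)" by - (rule PER, simp)+
qed

lemma eA: "[] \<turnstile>\<^sub>J A \<doteq> A'"
  by (rule val_eqJ[OF vA])

lemma tA: "[] \<turnstile>\<^sub>J A" "[] \<turnstile>\<^sub>J A'"
  by - (rule presups(1)[OF eA] presups(2)[OF eA])+

lemma tB: "[A] \<turnstile>\<^sub>J B" "[A] \<turnstile>\<^sub>J B'" "[A'] \<turnstile>\<^sub>J B \<doteq> B'" "[A'] \<turnstile>\<^sub>J B'"
  by - (rule eB presups(1)[OF eB] presups(2)[OF eB] ctx_conv(2)[OF eA tA(2) eB]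
      ctx_conv(1)[OF eA tA(2) presups(2)[OF eB]])+

lemma vA': "val A' A" "val A A" "val A' A'"
  by - (rule PERD(2)[OF P(1) vA] PERD'(1)[OF P(1) vA] PERD'(1)[OF P(2) PERD(2)[OF P(1) vA]])+

lemma relA: "rel A' a b \<longleftrightarrow> rel A a b" "rel A a b \<Longrightarrow> rel A b a" "rel A a b \<Longrightarrow> rel A a a" "rel A a b \<Longrightarrow> rel A b b"
  by - (rule iffI[OF PERD(1)[OF P(2) vA'(1)] PERD(1)[OF P(1) vA]] PERD(4)[OF P(1) vA'(2)]
      PERD'(2)[OF P(1) vA] PERD'(3)[OF P(1) vA]; assumption)+

lemma relA_trans: "rel A a b \<Longrightarrow> rel A b c \<Longrightarrow> rel A a c"
  by (rule PERD(5)[OF P(1) vA'(2)])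

lemma vB': "rel A a b \<Longrightarrow> val (instJ B' b) (instJ B a)" "rel A a b \<Longrightarrow> val (instJ B' a) (instJ B' a)"
    "rel A a b \<Longrightarrow> val (instJ B b) (instJ B a)" "rel A a b \<Longrightarrow> val (instJ B a) (instJ B b)"
    "rel A a b \<Longrightarrow> val (instJ B a) (instJ B a)"
proof -
  assume ab: "rel A a b"
  show 1: "val (instJ B' b) (instJ B a)" if "rel A a b" for a b by (rule PERD(2)[OF P(3) vB[OF that]])
  show "val (instJ B' a) (instJ B' a)" using PERD'(1)[OF P(4) 1[OF relA(3)[OF ab]]] .
  show 2: "val (instJ B a) (instJ B b)" using PERD(3)[OF P(3) vB[OF ab] 1[OF relA(4)[OF ab]]] .
  show "val (instJ B b) (instJ B a)" by (rule PERD(2)[OF P(3) 2])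
  show "val (instJ B a) (instJ B a)" by (rule PERD'(1)[OF P(3) 2])
qed

lemma vsym: "val A' A \<and> [A'] \<turnstile>\<^sub>J B' \<doteq> B \<and> (\<forall>a b. rel A' a b \<longrightarrow> val (instJ B' a) (instJ B b))"
  using vA'(1) eqJ_sym[OF tB(3)] vB'(1) relA(1,2) by blast

lemma vtrans:
  assumes "val A' A''" "[A'] \<turnstile>\<^sub>J B' \<doteq> B''" "\<And>a b. rel A' a b \<Longrightarrow> val (instJ B' a) (instJ B'' b)"
  shows "val A A'' \<and> [A] \<turnstile>\<^sub>J B \<doteq> B'' \<and> (\<forall>a b. rel A a b \<longrightarrow> val (instJ B a) (instJ B'' b))"
proof (intro conjI allI impI)
  show "val A A''" by (rule PERD(3)[OF P(1) vA assms(1)])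
  show "[A] \<turnstile>\<^sub>J B \<doteq> B''" by (rule eqJ_trans[OF eB ctx_conv(2)[OF eqJ_sym[OF eA] tA(1) assms(2)]])
  fix a b assume ab: "rel A a b"
  show "val (instJ B a) (instJ B'' b)"
    using PERD(3)[OF P(3) vB[OF ab] assms(3)] relA(1,4)[of a b] relA(1)[of b b] ab by blast
qed

lemma eqPi: "[] \<turnstile>\<^sub>J JPi A B \<doteq> JPi A' B'"
  by (rule JPi_cong[OF tA(1) eA eB])

lemma eqSigma: "[] \<turnstile>\<^sub>J JSigma A B \<doteq> JSigma A' B'"
  by (rule JSigma_cong[OF tA(1) eA eB])

lemma App_change:
  assumes "[] \<turnstile> f \<Colon> JPi A B" "rel A a b"
  shows "[] \<turnstile> App A' B' f a \<doteq> App A B f a \<Colon> instJ B' a"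
proof (rule eq_conv[OF eq_sym[OF App_cong[OF tA(1) eA eB eq_refl[OF assms(1)]]]])
  show "[] \<turnstile> a \<doteq> a \<Colon> A" using rel_eq[OF relA(3)[OF assms(2)]] .
  show "[] \<turnstile>\<^sub>J instJ B a \<doteq> instJ B' a" by (rule val_eqJ[OF vB[OF relA(3)[OF assms(2)]]])
qed

text \<open>The two judgments apply a function with different annotations. The two applications are
  judgmentally equal and have the same values, so \<open>PER_expand2\<close> exchanges them on both
  sides.\<close>

lemma conv_Pi:
  assumes "rel (JPi A B) f g"
  shows "rel (JPi A' B') f g"
proof -
  from assms have fg: "[] \<turnstile> f \<doteq> g \<Colon> JPi A B" by simp
  have "rel (instJ B' a) (App A' B' f a) (App A' B' g b)" if ab': "rel A' a b" for a b
  proof -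
    from ab' have ab: "rel A a b" by (simp add: relA)
    with assms have "rel (instJ B a) (App A B f a) (App A B g b)" by simp
    then have "rel (instJ B' a) (App A B f a) (App A B g b)"
      using PERD(1)[OF P(3) vB[OF relA(3)[OF ab]]] by blast
    moreover have "[] \<turnstile> App A' B' g b \<doteq> App A B g b \<Colon> instJ B' a"
      by (rule eq_conv[OF App_change[OF presups(6)[OF fg] relA(2)[OF ab]]])
        (use eqJ_trans[OF val_eqJ[OF vB'(1)[OF ab]] val_eqJ[OF vB[OF relA(3)[OF ab]]]] in blast)
    ultimately show ?thesis
      by (rule PER_expand2[OF P(4) vB'(2)[OF ab] _ App_change[OF presups(5)[OF fg] ab]
          ev_le_App[OF ev_le_refl] _ ev_le_App[OF ev_le_refl]])
  qed
  with eq_conv[OF fg eqPi] show ?thesis unfolding rel.simps by blast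
qed

lemma Fst_change:
  assumes "[] \<turnstile> p \<Colon> JSigma A B" shows "[] \<turnstile> Fst A' B' p \<doteq> Fst A B p \<Colon> A"
  by (rule eq_sym[OF Fst_cong[OF tA(1) eA eB eq_refl[OF assms]]])

lemma Snd_change:
  assumes "[] \<turnstile> p \<Colon> JSigma A B" shows "[] \<turnstile> Snd A' B' p \<doteq> Snd A B p \<Colon> instJ B (Fst A B p)"
  by (rule eq_sym[OF Snd_cong[OF tA(1) eA eB eq_refl[OF assms]]])

lemma conv_Sigma:
  assumes "rel (JSigma A B) p q"
  shows "rel (JSigma A' B') p q"
proof -
  from assms have pq: "[] \<turnstile> p \<doteq> q \<Colon> JSigma A B" and f: "rel A (Fst A B p) (Fst A B q)"
    and s: "rel (instJ B (Fst A B p)) (Snd A B p) (Snd A B q)" by simp_all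
  note p = presups(5)[OF pq] and q = presups(6)[OF pq]
  have f': "rel A (Fst A' B' p) (Fst A' B' q)"
    by (rule PER_expand2[OF P(1) vA'(2) f Fst_change[OF p] _ Fst_change[OF q]]) (intro ev_le_Fst ev_le_refl)+
  \<comment> \<open>The second components sit over the projection annotated by \<open>A\<close> and
    \<open>B\<close>; relating both projections yields the \<open>val\<close> that moves them over
    the primed one.\<close>
  have "rel A (Fst A' B' p) (Fst A B p)"
    by (rule PER_expand2[OF P(1) vA'(2) relA(3)[OF f] Fst_change[OF p] _ eq_refl])
      (use rel_eq[OF f] in \<open>blast intro: ev_le_Fst ev_le_refl presups\<close>)+
  then have v: "val (instJ B (Fst A B p)) (instJ B' (Fst A' B' p))" by (rule vB[OF relA(2)])
  have sq: "[] \<turnstile> Snd A' B' q \<doteq> Snd A B q \<Colon> instJ B (Fst A B p)"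
    by (rule eq_conv[OF Snd_change[OF q] val_eqJ[OF vB'(3)[OF f]]])
  have "rel (instJ B (Fst A B p)) (Snd A' B' p) (Snd A' B' q)"
    by (rule PER_expand2[OF P(3) vB'(5)[OF f] s Snd_change[OF p] _ sq]) (intro ev_le_Snd ev_le_refl)+
  from PERD(1)[OF P(3) v this] f' eq_conv[OF pq eqSigma] show ?thesis by (simp add: relA)
qed

end

text \<open>Transitivity at types meets two predicates for the middle type, which
  \<open>red_unique\<close> identifies. Head expansion is \<open>red_expand\<close> at types; at
  terms of a value type it follows from closure under judgmental equality alone.\<close>

lemma PER_atom:
  fixes A :: "('c::monoid_add) tm"
  shows "PER JUnit" and "PER TpPos" and "PER TpNeg" and "PER Beh" and "PER (TmPos A)"
proof -
  show "PER JUnit" unfolding PER_def by (auto intro: eq_sym eq_trans)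
  show "PER Beh" unfolding PER_def by simp
  show "PER TpPos" unfolding PER_def
    by (auto intro: eq_sym eq_trans) (blast intro: eq_trans dest: red_unique(1), blast intro: red_expand(1))
  show "PER TpNeg" unfolding PER_def
    by (auto intro: eq_sym eq_trans) (blast intro: eq_trans dest: red_unique(2), blast intro: red_expand(2))
  show "PER (TmPos A)"
    unfolding PER_def
  proof (intro conjI allI impI)
    fix K t u
    assume "val (TmPos A) K" and r: "rel (TmPos A) t u"
    then obtain A' R where K: "K = TmPos A'" "[] \<turnstile> A \<doteq> A' \<Colon> TpPos" "redP A R" "redP A' R" by auto
    from r K(3) have "R t" using red_unique(1) by auto
    with r K eq_conv[OF _ TmPos_cong[OF K(2)]] show "rel K t u" by auto
  next
    fix K
    assume "val (TmPos A) K"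
    then show "val K (TmPos A)" by (auto intro: eq_sym)
  next
    fix K L
    assume "val (TmPos A) K" "val K L"
    then show "val (TmPos A) L" using red_unique(1) by auto (blast intro: eq_trans, blast)
  next
    fix t u
    assume "rel (TmPos A) t u"
    then show "rel (TmPos A) u t" by auto (blast intro: eq_sym, blast intro: red_closed(1))
  next
    fix t u v
    assume "rel (TmPos A) t u" "rel (TmPos A) u v"
    then show "rel (TmPos A) t v" by auto (blast intro: eq_trans)
  next
    fix t t' u
    assume "rel (TmPos A) t u" "[] \<turnstile> t' \<doteq> t \<Colon> TmPos A"
    then show "rel (TmPos A) t' u" by auto (blast intro: eq_trans, blast intro: red_closed(1) eq_sym)
  qed
qed

lemma PER_JEq:
  fixes A :: "('c::monoid_add) jdg"
  assumes P: "\<And>C :: 'c jdg. jsz C \<le> jsz A \<Longrightarrow> PER C"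
  shows "PER (JEq A a b)"
proof -
  have PA: "PER A" by (simp add: P)
  show ?thesis
    unfolding PER_def
  proof (intro conjI allI impI)
    fix K
    assume v: "val (JEq A a b) K"
    then obtain A' a' b' where K: "K = JEq A' a' b'" and vA: "val A A'" and a: "rel A a a'" and b: "rel A b b'" by auto
    have PA': "PER A'" by (simp add: P val_jsz[OF vA])
    note vAA = PERD'(1)[OF PA vA] and vA' = PERD(2)[OF PA vA]
    show "val K (JEq A a b)"
      using K vA' PERD(1)[OF PA vA PERD(4)[OF PA vAA a]] PERD(1)[OF PA vA PERD(4)[OF PA vAA b]] by simp
    {
      fix t u
      assume "rel (JEq A a b) t u"
      then have ab: "rel A a b" and tu: "[] \<turnstile> t \<doteq> u \<Colon> JEq A a b" by simp_all
      have "rel A a' b'" by (rule PERD(5)[OF PA vAA PERD(5)[OF PA vAA PERD(4)[OF PA vAA a] ab] b])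
      then have "rel A' a' b'" by (rule PERD(1)[OF PA vA])
      with K eq_conv[OF tu val_eqJ[OF v]] show "rel K t u" by simp
    }
    fix L
    assume "val K L"
    then obtain A'' a'' b'' where L: "L = JEq A'' a'' b''" and vA2: "val A' A''" and a2: "rel A' a' a''" and b2: "rel A' b' b''"
      using K by auto
    from PERD(3)[OF PA vA vA2] PERD(5)[OF PA vAA a PERD(1)[OF PA' vA' a2]] PERD(5)[OF PA vAA b PERD(1)[OF PA' vA' b2]] L
    show "val (JEq A a b) L" by simp
  qed (auto, (blast intro: eq_sym eq_trans)+)
qed

lemma PER_JPi:
  fixes A B :: "('c::monoid_add) jdg"
  assumes P: "\<And>C :: 'c jdg. jsz C \<le> max (jsz A) (jsz B) \<Longrightarrow> PER C"
  shows "PER (JPi A B)"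
proof -
  have vf: "valid_fam A B A' B'" if "val (JPi A B) (JPi A' B')" for A' B'
    by unfold_locales (use that P in auto)
  show ?thesis
    unfolding PER_def
  proof (intro conjI allI impI)
    fix K
    assume v: "val (JPi A B) K"
    then obtain A' B' where K: "K = JPi A' B'" by auto
    interpret valid_fam A B A' B' by (rule vf) (use v K in simp)
    show "val K (JPi A B)" using vsym unfolding K val.simps by blast
    show "rel K t u" if "rel (JPi A B) t u" for t u using conv_Pi[OF that] K by simp
    fix L
    assume "val K L"
    then show "val (JPi A B) L" using vtrans unfolding K val.simps by blast
  next
    fix f g
    assume v: "val (JPi A B) (JPi A B)" and r: "rel (JPi A B) f g"
    interpret valid_fam A B A B by (rule vf[OF v])
    have r': "rel (instJ B a) (App A B f a) (App A B g b)" if "rel A a b" for a b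
      using r that by simp
    have "rel (instJ B a) (App A B g a) (App A B f b)" if ab: "rel A a b" for a b
    proof -
      have "rel (instJ B a) (App A B f b) (App A B g a)"
        by (rule PERD(1)[OF P(3) vB'(3)[OF ab] r'[OF relA(2)[OF ab]]])
      then show ?thesis by (rule PERD(4)[OF P(3) vB'(5)[OF ab]])
    qed
    with r show "rel (JPi A B) g f" unfolding rel.simps by (blast intro: eq_sym)
    {
      fix h
      assume s: "rel (JPi A B) g h"
      \<comment> \<open>The first link is taken at the pair of \<open>a\<close> with itself, so that
        both links live in \<open>instJ B a\<close>.\<close>
      have "rel (instJ B a) (App A B f a) (App A B h b)" if ab: "rel A a b" for a b
        using PERD(5)[OF P(3) vB'(5)[OF ab] r'[OF relA(3)[OF ab]]] s ab unfolding rel.simps by blast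
      with r s show "rel (JPi A B) f h" unfolding rel.simps by (blast intro: eq_trans)
    }
    fix f'
    assume eq: "[] \<turnstile> f' \<doteq> f \<Colon> JPi A B" and le: "ev_le f f'"
    have "rel (instJ B a) (App A B f' a) (App A B g b)" if ab: "rel A a b" for a b
    proof (rule PERD(6)[OF P(3) vB'(5)[OF ab] r'[OF ab] _ ev_le_App[OF le]])
      show "[] \<turnstile> App A B f' a \<doteq> App A B f a \<Colon> instJ B a"
        by (rule App_cong[OF tA(1) eA eB eq rel_eq[OF relA(3)[OF ab]]])
    qed
    with r eq show "rel (JPi A B) f' g" unfolding rel.simps by (blast intro: eq_trans)
  qed
qed

lemma PER_JSigma:
  fixes A B :: "('c::monoid_add) jdg"
  assumes P: "\<And>C :: 'c jdg. jsz C \<le> max (jsz A) (jsz B) \<Longrightarrow> PER C"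
  shows "PER (JSigma A B)"
proof -
  have vf: "valid_fam A B A' B'" if "val (JSigma A B) (JSigma A' B')" for A' B'
    by unfold_locales (use that P in auto)
  show ?thesis
    unfolding PER_def
  proof (intro conjI allI impI)
    fix K
    assume v: "val (JSigma A B) K"
    then obtain A' B' where K: "K = JSigma A' B'" by auto
    interpret valid_fam A B A' B' by (rule vf) (use v K in simp)
    show "val K (JSigma A B)" using vsym unfolding K val.simps by blast
    show "rel K t u" if "rel (JSigma A B) t u" for t u using conv_Sigma[OF that] K by simp
    fix L
    assume "val K L"
    then show "val (JSigma A B) L" using vtrans unfolding K val.simps by blast
  next
    fix p q
    assume v: "val (JSigma A B) (JSigma A B)" and r: "rel (JSigma A B) p q"
    interpret valid_fam A B A B by (rule vf[OF v])
    from r have pq: "[] \<turnstile> p \<doteq> q \<Colon> JSigma A B" and f: "rel A (Fst A B p) (Fst A B q)"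
      and s: "rel (instJ B (Fst A B p)) (Snd A B p) (Snd A B q)" by simp_all
    from PERD(1)[OF P(3) vB'(4)[OF f] PERD(4)[OF P(3) vB'(5)[OF f] s]] relA(2)[OF f] eq_sym[OF pq]
    show "rel (JSigma A B) q p" by simp
    {
      fix w
      assume r2: "rel (JSigma A B) q w"
      then have "rel (instJ B (Fst A B q)) (Snd A B q) (Snd A B w)" by simp
      from PERD(5)[OF P(3) vB'(5)[OF f] s PERD(1)[OF P(3) vB'(3)[OF f] this]] r2 relA_trans[OF f] eq_trans[OF pq]
      show "rel (JSigma A B) p w" by simp
    }
    fix p'
    assume eq: "[] \<turnstile> p' \<doteq> p \<Colon> JSigma A B" and le: "ev_le p p'"
    have ef: "[] \<turnstile> Fst A B p' \<doteq> Fst A B p \<Colon> A" by (rule Fst_cong[OF tA(1) eA eB eq])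
    have f': "rel A (Fst A B p') (Fst A B q)" if "rel A (Fst A B p) (Fst A B q)" for q
      by (rule PERD(6)[OF P(1) vA'(2) that ef ev_le_Fst[OF le]])
    note pp' = f'[OF relA(3)[OF f]]
    have "rel (instJ B (Fst A B p')) (Snd A B p) (Snd A B q)"
      by (rule PERD(1)[OF P(3) vB'(3)[OF pp'] s])
    then have "rel (instJ B (Fst A B p')) (Snd A B p') (Snd A B q)"
      by (rule PERD(6)[OF P(3) vB'(5)[OF pp'] _ Snd_cong[OF tA(1) eA eB eq] ev_le_Snd[OF le]])
    with f'[OF f] eq_trans[OF eq pq] show "rel (JSigma A B) p' q" by simp
  qed
qed

lemma PER: "PER (J :: ('c::monoid_add) jdg)"
proof (induct "jsz J" arbitrary: J rule: less_induct)
  case less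
  show ?case
  proof (cases J)
    case (JPi A B)
    with less show ?thesis by (auto intro!: PER_JPi)
  next
    case (JSigma A B)
    with less show ?thesis by (auto intro!: PER_JSigma)
  next
    case (JEq A a b)
    with less show ?thesis by (auto intro!: PER_JEq)
  qed (simp_all add: PER_atom)
qed

lemmas rel_conv = PERD(1)[OF PER] and val_sym = PERD(2)[OF PER] and val_trans = PERD(3)[OF PER]
  and rel_sym = PERD(4)[OF PER] and rel_trans = PERD(5)[OF PER] and rel_expand = PERD(6)[OF PER]
  and val_refl = PERD'(1)[OF PER] and rel_refl = PERD'(2,3)[OF PER]

section \<open>Semantic validity\<close>

lemma ev_le_beta:
  "ev_le (instT b a) (App A B (Lam A' B' b) a)" "ev_le a (Fst A B (Pair A' B' a b))" "ev_le b (Snd A B (Pair A' B' a b))"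
  unfolding ev_le_def by (auto intro: ev_App[OF ev_val] ev_Fst[OF ev_val] ev_Snd[OF ev_val])

lemma rel_expand2:
  assumes "val J J" "rel J t u" "[] \<turnstile> t' \<doteq> t \<Colon> J" "ev_le t t'" "[] \<turnstile> u' \<doteq> u \<Colon> J" "ev_le u u'"
  shows "rel J t' u'"
  by (rule PER_expand2[OF PER assms])

text \<open>Clauses of \<open>rel\<close> annotate both terms by the left judgment, whereas the
  right-hand side of a congruence rule has its own annotations. This exchanges them, taking the
  needed equation from the rule itself.\<close>

lemma rel_change_right:
  assumes "val J J" "rel J t u" "[] \<turnstile> t \<doteq> u' \<Colon> J" "ev_le u u'"
  shows "rel J t u'"
proof (rule rel_expand2[OF assms(1,2) eq_refl ev_le_refl _ assms(4)])
  show "[] \<turnstile> t \<Colon> J" using presups(5)[OF assms(3)] .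
  show "[] \<turnstile> u' \<doteq> u \<Colon> J" by (rule eq_trans[OF eq_sym[OF assms(3)] rel_eq[OF assms(2)]])
qed

section \<open>Related closing substitutions\<close>

primrec senv :: "('c::monoid_add) jdg list \<Rightarrow> (nat \<Rightarrow> 'c tm) \<Rightarrow> (nat \<Rightarrow> 'c tm) \<Rightarrow> bool" where
  "senv [] s q \<longleftrightarrow> True"
| "senv (A # \<Gamma>) s q \<longleftrightarrow> senv \<Gamma> (\<lambda>i. s (Suc i)) (\<lambda>i. q (Suc i)) \<and>
     val (subJ (\<lambda>i. s (Suc i)) A) (subJ (\<lambda>i. q (Suc i)) A) \<and> rel (subJ (\<lambda>i. s (Suc i)) A) (s 0) (q 0)"

text \<open>\<open>rel\<close> is taken at the instance of each judgment under \<open>s\<close>; the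
  \<open>val\<close> conjunct of \<open>senv\<close> moves it to the instance under
  \<open>q\<close>.\<close>

lemma senv_sym: "senv \<Gamma> s q \<Longrightarrow> senv \<Gamma> q s"
proof (induct \<Gamma> arbitrary: s q)
  case (Cons A \<Gamma>)
  then have v: "val (subJ (\<lambda>i. s (Suc i)) A) (subJ (\<lambda>i. q (Suc i)) A)"
    and r: "rel (subJ (\<lambda>i. s (Suc i)) A) (s 0) (q 0)" by simp_all
  from Cons val_sym[OF v] rel_conv[OF v rel_sym[OF val_refl[OF v] r]] show ?case by simp
qed simp

lemma senv_refl: "senv \<Gamma> s q \<Longrightarrow> senv \<Gamma> s s"
proof (induct \<Gamma> arbitrary: s q)
  case (Cons A \<Gamma>)
  then have v: "val (subJ (\<lambda>i. s (Suc i)) A) (subJ (\<lambda>i. q (Suc i)) A)"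
    and r: "rel (subJ (\<lambda>i. s (Suc i)) A) (s 0) (q 0)" by simp_all
  from Cons(2) have "senv \<Gamma> (\<lambda>i. s (Suc i)) (\<lambda>i. q (Suc i))" by simp
  from Cons(1)[OF this] val_refl[OF v] rel_refl(1)[OF v r] show ?case by simp
qed simp

lemma case_nat_eta: "case_nat (s 0) (\<lambda>i. s (Suc i)) = s"
  by (rule nat_fun_eqI) simp_all

lemma senv_eq_sub: "senv \<Gamma> s q \<Longrightarrow> eq_sub [] s q \<Gamma>"
proof (induct \<Gamma> arbitrary: s q)
  case Nil
  show ?case by (simp add: eq_sub_def typed_sub_def ctx_nil)
next
  case (Cons A \<Gamma>)
  then have "eq_sub [] (\<lambda>i. s (Suc i)) (\<lambda>i. q (Suc i)) \<Gamma>"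
    and e: "[] \<turnstile> s 0 \<doteq> q 0 \<Colon> subJ (\<lambda>i. s (Suc i)) A" by (simp_all add: rel_eq)
  then have "eq_sub [] (case_nat (s 0) (\<lambda>i. s (Suc i))) (case_nat (q 0) (\<lambda>i. q (Suc i))) (A # \<Gamma>)"
    using presups(5)[OF e] by (simp add: eq_sub_Cons)
  then show ?case by (simp only: case_nat_eta)
qed

lemma senv_typed_sub: "senv \<Gamma> s q \<Longrightarrow> typed_sub [] s \<Gamma>"
  using senv_eq_sub unfolding eq_sub_def by blast

text \<open>Stability changes the term under \<open>s\<close>, functionality changes
  \<open>s\<close> into \<open>q\<close>. This settles the judgmental part of every validity
  claim.\<close>

lemma eqT_senv:
  assumes "\<Gamma> \<turnstile> t \<doteq> u \<Colon> J" "senv \<Gamma> s q"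
  shows "[] \<turnstile> subT s t \<doteq> subT q u \<Colon> subJ s J"
  by (rule eq_trans[OF sub.stable(5)[OF assms(1) senv_typed_sub[OF assms(2)]]
        functionality(4)[OF presups(6)[OF assms(1)] senv_eq_sub[OF assms(2)]]])

text \<open>Supplies the open equation between codomains that \<open>val\<close> demands at
  \<open>JPi\<close> and \<open>JSigma\<close>.\<close>

lemma eqJ_up_senv:
  assumes "A # \<Gamma> \<turnstile>\<^sub>J B \<doteq> B'" "senv \<Gamma> s q"
  shows "[subJ s A] \<turnstile>\<^sub>J subJ (up_sub s) B \<doteq> subJ (up_sub q) B'"
proof -
  have "\<Gamma> \<turnstile>\<^sub>J A" using ctx_of(3)[OF assms(1)] by (simp add: ctx_of_Cons)
  from eq_sub_up[OF this senv_eq_sub[OF assms(2)]]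
  have e: "eq_sub [subJ s A] (up_sub s) (up_sub q) (A # \<Gamma>)" .
  show ?thesis
    by (rule eqJ_trans[OF eq_sub_stable(2)[OF e assms(1)] functionality(2)[OF presups(2)[OF assms(1)] e]])
qed

text \<open>Semantic counterparts of the equality judgments; validity of a judgment or of a term is equality with itself.\<close>

definition vJ :: "('c::monoid_add) jdg list \<Rightarrow> 'c jdg \<Rightarrow> 'c jdg \<Rightarrow> bool" where
  "vJ \<Gamma> J K \<longleftrightarrow> \<Gamma> \<turnstile>\<^sub>J J \<doteq> K \<and> (\<forall>s q. senv \<Gamma> s q \<longrightarrow> val (subJ s J) (subJ q K))"

definition vT :: "('c::monoid_add) jdg list \<Rightarrow> 'c tm \<Rightarrow> 'c tm \<Rightarrow> 'c jdg \<Rightarrow> bool" where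
  "vT \<Gamma> t u J \<longleftrightarrow> \<Gamma> \<turnstile> t \<doteq> u \<Colon> J \<and> vJ \<Gamma> J J \<and>
     (\<forall>s q. senv \<Gamma> s q \<longrightarrow> rel (subJ s J) (subT s t) (subT q u))"

lemma vJ_I: "\<lbrakk>\<Gamma> \<turnstile>\<^sub>J J \<doteq> K; \<And>s q. senv \<Gamma> s q \<Longrightarrow> val (subJ s J) (subJ q K)\<rbrakk> \<Longrightarrow> vJ \<Gamma> J K"
  by (simp add: vJ_def)

lemma vT_I: "\<lbrakk>\<Gamma> \<turnstile> t \<doteq> u \<Colon> J; vJ \<Gamma> J J; \<And>s q. senv \<Gamma> s q \<Longrightarrow> rel (subJ s J) (subT s t) (subT q u)\<rbrakk> \<Longrightarrow> vT \<Gamma> t u J"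
  by (simp add: vT_def)

lemma vJ_eq: "vJ \<Gamma> J K \<Longrightarrow> \<Gamma> \<turnstile>\<^sub>J J \<doteq> K" "vJ \<Gamma> J K \<Longrightarrow> \<Gamma> \<turnstile>\<^sub>J J" "vJ \<Gamma> J K \<Longrightarrow> \<Gamma> \<turnstile>\<^sub>J K"
  unfolding vJ_def by (blast intro: presups)+

lemma vT_eq: "vT \<Gamma> t u J \<Longrightarrow> \<Gamma> \<turnstile> t \<doteq> u \<Colon> J" "vT \<Gamma> t u J \<Longrightarrow> \<Gamma> \<turnstile> t \<Colon> J" "vT \<Gamma> t u J \<Longrightarrow> \<Gamma> \<turnstile> u \<Colon> J"
  unfolding vT_def by (blast intro: presups)+

lemma vJ_D: "vJ \<Gamma> J K \<Longrightarrow> senv \<Gamma> s q \<Longrightarrow> val (subJ s J) (subJ q K)"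
  by (simp add: vJ_def)

lemma vT_D: "vT \<Gamma> t u J \<Longrightarrow> senv \<Gamma> s q \<Longrightarrow> rel (subJ s J) (subT s t) (subT q u)"
  by (simp add: vT_def)

lemma vT_vJ: "vT \<Gamma> t u J \<Longrightarrow> vJ \<Gamma> J J"
  by (simp add: vT_def)

lemma vJ_sym: "vJ \<Gamma> J K \<Longrightarrow> vJ \<Gamma> K J"
  by (rule vJ_I[OF eqJ_sym[OF vJ_eq(1)] val_sym[OF vJ_D[OF _ senv_sym]]])

text \<open>The passage from \<open>s\<close> to \<open>q\<close> is made in the first link; the
  second one is taken at \<open>q\<close> on both sides.\<close>

lemma vJ_trans:
  assumes "vJ \<Gamma> J K" "vJ \<Gamma> K L"
  shows "vJ \<Gamma> J L"
proof (rule vJ_I[OF eqJ_trans[OF vJ_eq(1)[OF assms(1)] vJ_eq(1)[OF assms(2)]]])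
  fix s q assume "senv \<Gamma> s q"
  then show "val (subJ s J) (subJ q L)"
    using val_trans[OF vJ_D[OF assms(1)] vJ_D[OF assms(2) senv_refl[OF senv_sym]]] by blast
qed

lemma vJ_refl: "vJ \<Gamma> J K \<Longrightarrow> vJ \<Gamma> J J" "vJ \<Gamma> J K \<Longrightarrow> vJ \<Gamma> K K"
  by (blast intro: vJ_sym vJ_trans)+

lemma vJ_self: "vJ \<Gamma> J J \<Longrightarrow> senv \<Gamma> s q \<Longrightarrow> val (subJ s J) (subJ s J)"
  by (rule vJ_D[OF _ senv_refl])

lemma vT_sym:
  assumes "vT \<Gamma> t u J"
  shows "vT \<Gamma> u t J"
proof (rule vT_I[OF eq_sym[OF vT_eq(1)[OF assms]] vT_vJ[OF assms]])
  fix s q assume e: "senv \<Gamma> s q"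
  note v = vJ_D[OF vT_vJ[OF assms] senv_sym[OF e]]
  show "rel (subJ s J) (subT s u) (subT q t)"
    by (rule rel_conv[OF v rel_sym[OF val_refl[OF v] vT_D[OF assms senv_sym[OF e]]]])
qed

lemma vT_trans:
  assumes "vT \<Gamma> t u J" "vT \<Gamma> u w J"
  shows "vT \<Gamma> t w J"
proof (rule vT_I[OF eq_trans[OF vT_eq(1)[OF assms(1)] vT_eq(1)[OF assms(2)]] vT_vJ[OF assms(1)]])
  fix s q assume e: "senv \<Gamma> s q"
  note v = vJ_D[OF vT_vJ[OF assms(1)] senv_sym[OF e]]
  show "rel (subJ s J) (subT s t) (subT q w)"
    by (rule rel_trans[OF vJ_self[OF vT_vJ[OF assms(1)] e] vT_D[OF assms(1) e]
          rel_conv[OF v vT_D[OF assms(2) senv_refl[OF senv_sym[OF e]]]]])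
qed

lemma vT_refl: "vT \<Gamma> t u J \<Longrightarrow> vT \<Gamma> t t J" "vT \<Gamma> t u J \<Longrightarrow> vT \<Gamma> u u J"
  by (blast intro: vT_sym vT_trans)+

lemma vT_conv:
  assumes "vT \<Gamma> t u J" "vJ \<Gamma> J K"
  shows "vT \<Gamma> t u K"
proof (rule vT_I[OF eq_conv[OF vT_eq(1)[OF assms(1)] vJ_eq(1)[OF assms(2)]] vJ_refl(2)[OF assms(2)]])
  fix s q assume e: "senv \<Gamma> s q"
  show "rel (subJ s K) (subT s t) (subT q u)"
    by (rule rel_conv[OF vJ_D[OF assms(2) senv_refl[OF e]] vT_D[OF assms(1) e]])
qed

section \<open>Validity of the rules of the framework\<close>

lemma senv_nth:
  "\<lbrakk>senv \<Gamma> s q; i < length \<Gamma>\<rbrakk> \<Longrightarrow>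
     val (subJ s (renJ (\<lambda>k. k + Suc i) (\<Gamma> ! i))) (subJ q (renJ (\<lambda>k. k + Suc i) (\<Gamma> ! i))) \<and>
     rel (subJ s (renJ (\<lambda>k. k + Suc i) (\<Gamma> ! i))) (s i) (q i)"
proof (induct \<Gamma> arbitrary: i s q)
  case (Cons A \<Gamma>)
  show ?case
  proof (cases i)
    case 0
    with Cons(2) show ?thesis by (simp add: sub_ren)
  next
    case (Suc j)
    with Cons(1)[of "\<lambda>i. s (Suc i)" "\<lambda>i. q (Suc i)" j] Cons(2,3) show ?thesis by (simp add: sub_ren)
  qed
qed simp

lemma v_var:
  assumes "\<turnstile>\<^sub>C \<Gamma>" "i < length \<Gamma>"
  shows "vT \<Gamma> (Var i) (Var i) (renJ (\<lambda>k. k + Suc i) (\<Gamma> ! i))"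
  by (rule vT_I[OF eq_refl[OF var[OF assms]] vJ_I[OF eqJ_refl[OF ctx_nth[OF assms]]]])
    (use senv_nth[OF _ assms(2)] in auto)

lemma senv_Cons:
  assumes "senv \<Gamma> s q" "vJ \<Gamma> A A" "rel (subJ s A) a b"
  shows "senv (A # \<Gamma>) (case_nat a s) (case_nat b q)"
  using assms vJ_D by simp

lemma v_atom:
  assumes "\<turnstile>\<^sub>C \<Gamma>"
  shows "vJ \<Gamma> JUnit JUnit" "vJ \<Gamma> TpPos TpPos" "vJ \<Gamma> TpNeg TpNeg" "vJ \<Gamma> Beh Beh"
  using assms by (auto intro!: vJ_I eqJ_refl JUnit TpPos TpNeg Beh)

context
  fixes \<Gamma> :: "('c::monoid_add) jdg list" and A A' B B' :: "'c jdg"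
  assumes A: "vJ \<Gamma> A A'" and B: "vJ (A # \<Gamma>) B B'"
begin

private lemma v_fam:
  assumes "senv \<Gamma> s q"
  shows "[subJ s A] \<turnstile>\<^sub>J subJ (up_sub s) B \<doteq> subJ (up_sub q) B'" "val (subJ s A) (subJ q A')"
    "rel (subJ s A) a b \<Longrightarrow> val (instJ (subJ (up_sub s) B) a) (instJ (subJ (up_sub q) B') b)"
  using eqJ_up_senv[OF vJ_eq(1)[OF B] assms] vJ_D[OF A assms] vJ_D[OF B senv_Cons[OF assms vJ_refl(1)[OF A]]]
  by (auto simp: inst_up)

lemma v_JPi: "vJ \<Gamma> (JPi A B) (JPi A' B')"
  by (rule vJ_I[OF JPi_cong[OF vJ_eq(2,1)[OF A] vJ_eq(1)[OF B]]]) (simp add: v_fam)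

lemma v_JSigma: "vJ \<Gamma> (JSigma A B) (JSigma A' B')"
  by (rule vJ_I[OF JSigma_cong[OF vJ_eq(2,1)[OF A] vJ_eq(1)[OF B]]]) (simp add: v_fam)

end

lemma v_JEq:
  assumes A: "vJ \<Gamma> A A'" and a: "vT \<Gamma> a a' A" and b: "vT \<Gamma> b b' A"
  shows "vJ \<Gamma> (JEq A a b) (JEq A' a' b')"
  by (rule vJ_I[OF JEq_cong[OF vJ_eq(1)[OF A] vT_eq(1)[OF a] vT_eq(1)[OF b]]])
    (simp add: vJ_D[OF A] vT_D[OF a] vT_D[OF b])

lemma v_TmPos:
  assumes A: "vT \<Gamma> A A' TpPos"
  shows "vJ \<Gamma> (TmPos A) (TmPos A')"
  by (rule vJ_I[OF TmPos_cong[OF vT_eq(1)[OF A]]]) (use vT_D[OF A] in simp)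

lemma vJ_wk:
  assumes A: "\<Gamma> \<turnstile>\<^sub>J A" and B: "vJ \<Gamma> B B'"
  shows "vJ (A # \<Gamma>) (wkJ B) (wkJ B')"
  by (rule vJ_I[OF weakening(2)[OF A vJ_eq(1)[OF B]]]) (use vJ_D[OF B] in \<open>simp add: sub_ren\<close>)

lemma vT_wk:
  assumes A: "\<Gamma> \<turnstile>\<^sub>J A" and t: "vT \<Gamma> t u J"
  shows "vT (A # \<Gamma>) (wkT t) (wkT u) (wkJ J)"
  by (rule vT_I[OF weakening(4)[OF A vT_eq(1)[OF t]] vJ_wk[OF A vT_vJ[OF t]]])
    (use vT_D[OF t] in \<open>simp add: sub_ren\<close>)

lemma v_Arr:
  assumes "vJ \<Gamma> A A'" "vJ \<Gamma> B B'"
  shows "vJ \<Gamma> (Arr A B) (Arr A' B')"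
  by (rule v_JPi[OF assms(1) vJ_wk[OF vJ_eq(2)[OF assms(1)] assms(2)]])

lemma vT_var_0:
  assumes "vJ \<Gamma> A A"
  shows "vT (A # \<Gamma>) (Var 0) (Var 0) (wkJ A)"
  using v_var[of "A # \<Gamma>" 0] vJ_eq(2)[OF assms] by (simp add: wk_add_0[simplified] ctx_of_Cons ctx_of)

lemma vJ_inst:
  assumes "vJ (A # \<Gamma>) B B'" "vT \<Gamma> a a' A"
  shows "vJ \<Gamma> (instJ B a) (instJ B' a')"
proof (rule vJ_I)
  show "\<Gamma> \<turnstile>\<^sub>J instJ B a \<doteq> instJ B' a'"
    by (rule inst_eqJ2[OF vT_eq(2,1)[OF assms(2)] vJ_eq(2,1)[OF assms(1)] vT_eq(3)[OF assms(2)]])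
  fix s q assume e: "senv \<Gamma> s q"
  show "val (subJ s (instJ B a)) (subJ q (instJ B' a'))"
    using vJ_D[OF assms(1) senv_Cons[OF e vT_vJ[OF assms(2)] vT_D[OF assms(2) e]]]
    by (simp add: sub_inst inst_up)
qed

context
  fixes \<Gamma> :: "('c::monoid_add) jdg list" and A A' B B' :: "'c jdg"
  assumes A: "vJ \<Gamma> A A'" and B: "vJ (A # \<Gamma>) B B'"
begin

private lemmas wfA = vJ_eq(2)[OF A] and eA = vJ_eq(1)[OF A] and wfB = vJ_eq(2)[OF B] and eB = vJ_eq(1)[OF B]

text \<open>The contracta are related by validity of the body under the substitutions extended by
  \<open>a\<close> and \<open>a'\<close>, and head expansion on both sides leads back to the
  applications.\<close>

lemma v_Lam:
  assumes b: "vT (A # \<Gamma>) b b' B"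
  shows "vT \<Gamma> (Lam A B b) (Lam A' B' b') (JPi A B)"
proof (rule vT_I[OF Lam_cong[OF wfA eA eB vT_eq(1)[OF b]] v_JPi[OF vJ_refl(1)[OF A] vJ_refl(1)[OF B]]])
  fix s q assume e: "senv \<Gamma> s q"
  let ?A = "subJ s A" and ?B = "subJ (up_sub s) B"
  let ?f = "Lam ?A ?B (subT (up_sub s) b)" and ?g = "subT q (Lam A' B' b')"
  have fg: "[] \<turnstile> ?f \<doteq> ?g \<Colon> JPi ?A ?B"
    using eqT_senv[OF Lam_cong[OF wfA eA eB vT_eq(1)[OF b]] e] by simp
  note wfs = sub.stable(2)[OF wfA senv_typed_sub[OF e]]
  note up = typed_sub_up[OF senv_typed_sub[OF e] wfs]
  have "rel (instJ ?B a) (App ?A ?B ?f a) (App ?A ?B ?g a')" if r: "rel ?A a a'" for a a'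
  proof -
    note e' = senv_Cons[OF e vJ_refl(1)[OF A] r]
    have J: "instJ ?B a = subJ (case_nat a s) B" by (simp add: inst_up)
    have v: "val (instJ ?B a) (instJ ?B a)" unfolding J by (rule vJ_self[OF vJ_refl(1)[OF B] e'])
    have IH: "rel (instJ ?B a) (instT (subT (up_sub s) b) a) (instT (subT (up_sub q) b') a')"
      using vT_D[OF b e'] by (simp add: inst_up)
    note a = rel_eq[OF r]
    have beta: "[] \<turnstile> App ?A ?B ?f a \<doteq> instT (subT (up_sub s) b) a \<Colon> instJ ?B a"
      by (rule App_beta[OF wfs sub.stable(2)[OF wfB up] sub.stable(4)[OF vT_eq(2)[OF b] up] presups(5)[OF a]])
    \<comment> \<open>The right redex mixes annotations of both sides, so \<open>App_beta\<close>
      does not fit it. Its equation is obtained through the left redex and the equality of the two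
      abstractions.\<close>
    have "[] \<turnstile> App ?A ?B ?f a \<doteq> App ?A ?B ?g a' \<Colon> instJ ?B a"
      by (rule App_cong[OF wfs eqJ_refl[OF wfs] eqJ_refl[OF sub.stable(2)[OF wfB up]] fg a])
    then have "[] \<turnstile> App ?A ?B ?g a' \<doteq> instT (subT (up_sub q) b') a' \<Colon> instJ ?B a"
      using beta rel_eq[OF IH] by (blast intro: eq_sym eq_trans)
    then show ?thesis
      by (intro rel_expand2[OF v IH beta]) (simp_all add: ev_le_beta)
  qed
  with fg show "rel (subJ s (JPi A B)) (subT s (Lam A B b)) (subT q (Lam A' B' b'))" by simp
qed

lemma v_App:
  assumes f: "vT \<Gamma> f f' (JPi A B)" and a: "vT \<Gamma> a a' A"
  shows "vT \<Gamma> (App A B f a) (App A' B' f' a') (instJ B a)"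
proof (rule vT_I[OF App_cong[OF wfA eA eB vT_eq(1)[OF f] vT_eq(1)[OF a]] vJ_inst[OF vJ_refl(1)[OF B] vT_refl(1)[OF a]]])
  fix s q assume e: "senv \<Gamma> s q"
  note E = eqT_senv[OF App_cong[OF wfA eA eB vT_eq(1)[OF f] vT_eq(1)[OF a]] e]
  have "rel (subJ s (instJ B a)) (subT s (App A B f a)) (App (subJ s A) (subJ (up_sub s) B) (subT q f') (subT q a'))"
    using vT_D[OF f e] vT_D[OF a e] by (simp add: sub_inst)
  then show "rel (subJ s (instJ B a)) (subT s (App A B f a)) (subT q (App A' B' f' a'))"
    by (rule rel_change_right[OF vJ_self[OF vJ_inst[OF vJ_refl(1)[OF B] vT_refl(1)[OF a]] e] _ E])
      (simp add: ev_le_App ev_le_refl)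
qed

lemma v_Pair:
  assumes a: "vT \<Gamma> a a' A" and b: "vT \<Gamma> b b' (instJ B a)"
  shows "vT \<Gamma> (Pair A B a b) (Pair A' B' a' b') (JSigma A B)"
proof (rule vT_I[OF Pair_cong[OF wfA eA eB vT_eq(1)[OF a] vT_eq(1)[OF b]] v_JSigma[OF vJ_refl(1)[OF A] vJ_refl(1)[OF B]]])
  fix s q assume e: "senv \<Gamma> s q"
  let ?A = "subJ s A" and ?B = "subJ (up_sub s) B"
  let ?p = "Pair ?A ?B (subT s a) (subT s b)" and ?p' = "subT q (Pair A' B' a' b')"
  have pp': "[] \<turnstile> ?p \<doteq> ?p' \<Colon> JSigma ?A ?B"
    using eqT_senv[OF Pair_cong[OF wfA eA eB vT_eq(1)[OF a] vT_eq(1)[OF b]] e] by simp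
  note wfs = sub.stable(2)[OF wfA senv_typed_sub[OF e]]
  note wfBs = sub.stable(2)[OF wfB typed_sub_up[OF senv_typed_sub[OF e] wfs]]
  note ra = vT_D[OF a e] and vA = vJ_self[OF vJ_refl(1)[OF A] e]
  have rb: "rel (instJ ?B (subT s a)) (subT s b) (subT q b')" using vT_D[OF b e] by (simp add: sub_inst)
  note ab = presups(5)[OF rel_eq[OF ra]] presups(5)[OF rel_eq[OF rb]]
  note beta1 = Fst_beta[OF wfs wfBs ab] and beta2 = Snd_beta[OF wfs wfBs ab]
  have le: "ev_le (subT s a) (Fst ?A ?B ?p)" "ev_le (subT q a') (Fst ?A ?B ?p')"
    "ev_le (subT s b) (Snd ?A ?B ?p)" "ev_le (subT q b') (Snd ?A ?B ?p')"
    by (simp_all add: ev_le_beta)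
  note c1 = Fst_cong[OF wfs eqJ_refl[OF wfs] eqJ_refl[OF wfBs] pp'] and c2 = Snd_cong[OF wfs eqJ_refl[OF wfs] eqJ_refl[OF wfBs] pp']
  have r1: "rel ?A (Fst ?A ?B ?p) (Fst ?A ?B ?p')"
    by (rule rel_expand2[OF vA ra beta1 le(1) eq_trans[OF eq_trans[OF eq_sym[OF c1] beta1] rel_eq[OF ra]] le(2)])
  \<comment> \<open>Moves the judgment of the second component from the instance at \<open>a\<close>
    to the instance at the first projection of the pair.\<close>
  have "rel ?A (subT s a) (Fst ?A ?B ?p)"
    by (rule rel_expand2[OF vA rel_refl(1)[OF vA ra] eq_refl[OF ab(1)] ev_le_refl beta1 le(1)])
  from vJ_D[OF vJ_refl(1)[OF B] senv_Cons[OF senv_refl[OF e] vJ_refl(1)[OF A] this]]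
  have v: "val (instJ ?B (subT s a)) (instJ ?B (Fst ?A ?B ?p))" by (simp add: inst_up)
  note bb = eq_conv[OF beta2 val_eqJ[OF v]] and rb' = rel_conv[OF v rb]
  have "rel (instJ ?B (Fst ?A ?B ?p)) (Snd ?A ?B ?p) (Snd ?A ?B ?p')"
    by (rule rel_expand2[OF val_refl[OF val_sym[OF v]] rb' bb le(3)
          eq_trans[OF eq_trans[OF eq_sym[OF c2] bb] rel_eq[OF rb']] le(4)])
  with r1 pp' show "rel (subJ s (JSigma A B)) (subT s (Pair A B a b)) (subT q (Pair A' B' a' b'))" by simp
qed

lemma v_Fst:
  assumes p: "vT \<Gamma> p p' (JSigma A B)"
  shows "vT \<Gamma> (Fst A B p) (Fst A' B' p') A"
proof (rule vT_I[OF Fst_cong[OF wfA eA eB vT_eq(1)[OF p]] vJ_refl(1)[OF A]])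
  fix s q assume e: "senv \<Gamma> s q"
  have "rel (subJ s A) (subT s (Fst A B p)) (Fst (subJ s A) (subJ (up_sub s) B) (subT q p'))"
    using vT_D[OF p e] by simp
  then show "rel (subJ s A) (subT s (Fst A B p)) (subT q (Fst A' B' p'))"
    by (rule rel_change_right[OF vJ_self[OF vJ_refl(1)[OF A] e] _ eqT_senv[OF Fst_cong[OF wfA eA eB vT_eq(1)[OF p]] e]])
      (simp add: ev_le_Fst ev_le_refl)
qed

end

lemma v_Snd:
  assumes A: "vJ \<Gamma> A A'" and B: "vJ (A # \<Gamma>) B B'" and p: "vT \<Gamma> p p' (JSigma A B)"
  shows "vT \<Gamma> (Snd A B p) (Snd A' B' p') (instJ B (Fst A B p))"
proof -
  note v = vJ_inst[OF vJ_refl(1)[OF B] v_Fst[OF vJ_refl(1)[OF A] vJ_refl(1)[OF B] vT_refl(1)[OF p]]]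
  note E = Snd_cong[OF vJ_eq(2,1)[OF A] vJ_eq(1)[OF B] vT_eq(1)[OF p]]
  show ?thesis
  proof (rule vT_I[OF E v])
    fix s q assume e: "senv \<Gamma> s q"
    have "rel (subJ s (instJ B (Fst A B p))) (subT s (Snd A B p)) (Snd (subJ s A) (subJ (up_sub s) B) (subT q p'))"
      using vT_D[OF p e] by (simp add: sub_inst)
    then show "rel (subJ s (instJ B (Fst A B p))) (subT s (Snd A B p)) (subT q (Snd A' B' p'))"
      by (rule rel_change_right[OF vJ_self[OF v e] _ eqT_senv[OF E e]]) (simp add: ev_le_Snd ev_le_refl)
  qed
qed

lemma v_App_beta:
  assumes A: "vJ \<Gamma> A A" and B: "vJ (A # \<Gamma>) B B" and b: "vT (A # \<Gamma>) b b B" and a: "vT \<Gamma> a a A"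
  shows "vT \<Gamma> (App A B (Lam A B b) a) (instT b a) (instJ B a)"
proof -
  note E = App_beta[OF vJ_eq(2)[OF A] vJ_eq(2)[OF B] vT_eq(2)[OF b] vT_eq(2)[OF a]]
  show ?thesis
  proof (rule vT_I[OF E vJ_inst[OF B a]])
    fix s q assume e: "senv \<Gamma> s q"
    have r: "rel (subJ s (instJ B a)) (subT s (instT b a)) (subT q (instT b a))"
      using vT_D[OF b senv_Cons[OF e A vT_D[OF a e]]] by (simp add: sub_inst inst_up)
    show "rel (subJ s (instJ B a)) (subT s (App A B (Lam A B b) a)) (subT q (instT b a))"
      by (rule rel_expand[OF vJ_self[OF vJ_inst[OF B a] e] r])
        (use eqT_senv[OF E senv_refl[OF e]] in \<open>simp_all add: ev_le_beta sub_inst\<close>)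
  qed
qed

text \<open>At \<open>JPi\<close> functions are compared through application, and the expanded
  function applied to \<open>a\<close> contracts to the application of \<open>f\<close> to
  \<open>a\<close>.\<close>

lemma v_Lam_eta:
  assumes A: "vJ \<Gamma> A A" and B: "vJ (A # \<Gamma>) B B" and f: "vT \<Gamma> f f (JPi A B)"
  shows "vT \<Gamma> (Lam A B (App (wkJ A) (renJ (up_ren Suc) B) (wkT f) (Var 0))) f (JPi A B)"
proof -
  note E = Lam_eta[OF vJ_eq(2)[OF A] vJ_eq(2)[OF B] vT_eq(2)[OF f]]
  show ?thesis
  proof (rule vT_I[OF E v_JPi[OF A B]])
    fix s q assume e: "senv \<Gamma> s q"
    let ?A = "subJ s A" and ?B = "subJ (up_sub s) B" and ?l = "subT s (Lam A B (App (wkJ A) (renJ (up_ren Suc) B) (wkT f) (Var 0)))"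
    note wfs = sub.stable(2)[OF vJ_eq(2)[OF A] senv_typed_sub[OF e]]
    note wfBs = sub.stable(2)[OF vJ_eq(2)[OF B] typed_sub_up[OF senv_typed_sub[OF e] wfs]]
    have l: "[] \<turnstile> ?l \<doteq> subT s f \<Colon> JPi ?A ?B" using eqT_senv[OF E senv_refl[OF e]] by simp
    have "rel (instJ ?B a) (App ?A ?B ?l a) (App ?A ?B (subT q f) a')" if r: "rel ?A a a'" for a a'
    proof (rule rel_expand)
      show "rel (instJ ?B a) (App ?A ?B (subT s f) a) (App ?A ?B (subT q f) a')"
        using vT_D[OF f e] r by simp
      show "val (instJ ?B a) (instJ ?B a)"
        using vJ_self[OF B senv_Cons[OF e A r]] by (simp add: inst_up)
      show "[] \<turnstile> App ?A ?B ?l a \<doteq> App ?A ?B (subT s f) a \<Colon> instJ ?B a"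
        by (rule App_cong[OF wfs eqJ_refl[OF wfs] eqJ_refl[OF wfBs] l eq_refl[OF presups(5)[OF rel_eq[OF r]]]])
      have "instT (App (wkJ ?A) (renJ (up_ren Suc) ?B) (wkT (subT s f)) (Var 0)) a
          = App ?A ?B (subT s f) a"
        by (simp add: sub_ren up_sub_up_ren up_sub_Var_id)
      then show "ev_le (App ?A ?B (subT s f) a) (App ?A ?B ?l a)"
        using ev_le_beta(1)[where b="App (wkJ ?A) (renJ (up_ren Suc) ?B) (wkT (subT s f)) (Var 0)" and a=a] by simp
    qed
    with eqT_senv[OF E e] show "rel (subJ s (JPi A B)) ?l (subT q f)" by simp
  qed
qed

lemma v_Fst_beta:
  assumes A: "vJ \<Gamma> A A" and B: "vJ (A # \<Gamma>) B B" and a: "vT \<Gamma> a a A" and b: "vT \<Gamma> b b (instJ B a)"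
  shows "vT \<Gamma> (Fst A B (Pair A B a b)) a A"
proof -
  note E = Fst_beta[OF vJ_eq(2)[OF A] vJ_eq(2)[OF B] vT_eq(2)[OF a] vT_eq(2)[OF b]]
  show ?thesis
  proof (rule vT_I[OF E A])
    fix s q assume e: "senv \<Gamma> s q"
    show "rel (subJ s A) (subT s (Fst A B (Pair A B a b))) (subT q a)"
      by (rule rel_expand[OF vJ_self[OF A e] vT_D[OF a e] eqT_senv[OF E senv_refl[OF e]]])
        (simp add: ev_le_beta)
  qed
qed

lemma v_Snd_beta:
  assumes A: "vJ \<Gamma> A A" and B: "vJ (A # \<Gamma>) B B" and a: "vT \<Gamma> a a A" and b: "vT \<Gamma> b b (instJ B a)"
  shows "vT \<Gamma> (Snd A B (Pair A B a b)) b (instJ B a)"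
proof -
  note E = Snd_beta[OF vJ_eq(2)[OF A] vJ_eq(2)[OF B] vT_eq(2)[OF a] vT_eq(2)[OF b]]
  show ?thesis
  proof (rule vT_I[OF E vT_vJ[OF b]])
    fix s q assume e: "senv \<Gamma> s q"
    show "rel (subJ s (instJ B a)) (subT s (Snd A B (Pair A B a b))) (subT q b)"
      by (rule rel_expand[OF vJ_self[OF vT_vJ[OF b] e] vT_D[OF b e] eqT_senv[OF E senv_refl[OF e]]])
        (simp add: ev_le_beta)
  qed
qed

lemma v_Pair_eta:
  assumes A: "vJ \<Gamma> A A" and B: "vJ (A # \<Gamma>) B B" and p: "vT \<Gamma> p p (JSigma A B)"
  shows "vT \<Gamma> (Pair A B (Fst A B p) (Snd A B p)) p (JSigma A B)"
proof -
  let ?p = "Pair A B (Fst A B p) (Snd A B p)"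
  note E = Pair_eta[OF vJ_eq(2)[OF A] vJ_eq(2)[OF B] vT_eq(2)[OF p]]
  note f = v_Fst[OF A B p] and s = v_Snd[OF A B p]
  note f' = v_Fst_beta[OF A B f s] and s' = v_Snd_beta[OF A B f s]
  note s'' = vT_conv[OF s' vJ_inst[OF B vT_sym[OF f']]]
  show ?thesis
  proof (rule vT_I[OF E v_JSigma[OF A B]])
    fix s q assume e: "senv \<Gamma> s q"
    let ?A = "subJ s A" and ?B = "subJ (up_sub s) B"
    note wfs = sub.stable(2)[OF vJ_eq(2)[OF A] senv_typed_sub[OF e]]
    note wfBs = sub.stable(2)[OF vJ_eq(2)[OF B] typed_sub_up[OF senv_typed_sub[OF e] wfs]]
    have E': "[] \<turnstile> subT s ?p \<doteq> subT q p \<Colon> JSigma ?A ?B" using eqT_senv[OF E e] by simp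
    have "rel ?A (Fst ?A ?B (subT s ?p)) (Fst ?A ?B (subT q p))"
      by (rule rel_change_right[OF vJ_self[OF A e] _ Fst_cong[OF wfs eqJ_refl[OF wfs] eqJ_refl[OF wfBs] E']])
        (use vT_D[OF f' e] in \<open>simp, simp add: ev_le_Fst ev_le_refl\<close>)
    moreover have "rel (instJ ?B (Fst ?A ?B (subT s ?p))) (Snd ?A ?B (subT s ?p)) (Snd ?A ?B (subT q p))"
      by (rule rel_change_right[OF _ _ Snd_cong[OF wfs eqJ_refl[OF wfs] eqJ_refl[OF wfBs] E']])
        (use vT_D[OF s'' e] vJ_self[OF vT_vJ[OF s''] e] in \<open>simp add: sub_inst, simp add: sub_inst, simp add: ev_le_Snd ev_le_refl\<close>)
    ultimately show "rel (subJ s (JSigma A B)) (subT s ?p) (subT q p)" using E' by simp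
  qed
qed

lemma v_Refl:
  assumes A: "vJ \<Gamma> A A'" and a: "vT \<Gamma> a a' A"
  shows "vT \<Gamma> (Refl A a) (Refl A' a') (JEq A a a)"
proof -
  note E = Refl_cong[OF vJ_eq(1)[OF A] vT_eq(1)[OF a]]
  show ?thesis
    by (rule vT_I[OF E v_JEq[OF vJ_refl(1)[OF A] vT_refl(1)[OF a] vT_refl(1)[OF a]]])
      (use eqT_senv[OF E] vT_D[OF vT_refl(1)[OF a] senv_refl] in simp)
qed

text \<open>Relatedness at \<open>JEq\<close> stores relatedness of the endpoints under
  \<open>s\<close>; validity of \<open>b\<close> then carries the right one from \<open>s\<close> to
  \<open>q\<close>.\<close>

lemma v_reflection:
  assumes A: "vJ \<Gamma> A A" and a: "vT \<Gamma> a a A" and b: "vT \<Gamma> b b A" and p: "vT \<Gamma> p p (JEq A a b)"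
  shows "vT \<Gamma> a b A" and "vT \<Gamma> p (Refl A a) (JEq A a b)"
proof -
  note wf = vJ_eq(2)[OF A] vT_eq(2)[OF a] vT_eq(2)[OF b] vT_eq(2)[OF p]
  show "vT \<Gamma> a b A"
  proof (rule vT_I[OF reflection[OF wf] A])
    fix s q assume e: "senv \<Gamma> s q"
    from vT_D[OF p e] have "rel (subJ s A) (subT s a) (subT s b)" by simp
    then show "rel (subJ s A) (subT s a) (subT q b)"
      by (rule rel_trans[OF vJ_self[OF A e] _ vT_D[OF b e]])
  qed
  show "vT \<Gamma> p (Refl A a) (JEq A a b)"
    by (rule vT_I[OF Refl_eta[OF wf] v_JEq[OF A a b]]) (use eqT_senv[OF Refl_eta[OF wf]] vT_D[OF p] in simp)
qed

lemma v_Triv: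
  assumes "\<Gamma> \<turnstile> t \<doteq> u \<Colon> JUnit"
  shows "vT \<Gamma> t u JUnit"
  by (rule vT_I[OF assms v_atom(1)[OF ctx_of(5)[OF assms]]]) (use eqT_senv[OF assms] in simp)

section \<open>Validity of the constants of the signature\<close>

declare rel.simps [simp del] val.simps [simp del]

text \<open>Turns the graph \<open>redP\<close> into a function: by \<open>red_unique\<close> this
  is the predicate of \<open>A\<close> if there is one, and it is empty otherwise.\<close>

definition cmp :: "('c::monoid_add) tm \<Rightarrow> 'c tm \<Rightarrow> bool" where
  "cmp A t \<longleftrightarrow> (\<exists>R. redP A R \<and> R t)"

definition cmpN :: "('c::monoid_add) tm \<Rightarrow> 'c tm \<Rightarrow> bool" where
  "cmpN X t \<longleftrightarrow> (\<exists>R. redN X R \<and> R t)"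

lemma redP_cmp: "redP A R \<Longrightarrow> cmp A = R"
  unfolding cmp_def by (rule ext) (blast dest: red_unique(1))

lemma redN_cmp: "redN X R \<Longrightarrow> cmpN X = R"
  unfolding cmpN_def by (rule ext) (blast dest: red_unique(2))

lemma rel_TmPos: "rel (TmPos A) t u \<longleftrightarrow> [] \<turnstile> t \<doteq> u \<Colon> TmPos A \<and> cmp A t"
  by (simp add: rel.simps cmp_def)

lemma rel_TpPos: "rel TpPos A B \<longleftrightarrow> [] \<turnstile> A \<doteq> B \<Colon> TpPos \<and> redP A (cmp A) \<and> redP B (cmp A)"
  unfolding rel.simps by (auto simp: redP_cmp)

lemma rel_TpNeg: "rel TpNeg X Y \<longleftrightarrow> [] \<turnstile> X \<doteq> Y \<Colon> TpNeg \<and> redN X (cmpN X) \<and> redN Y (cmpN X)"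
  unfolding rel.simps by (auto simp: redN_cmp)

lemma cmp_rel: "rel TpPos A B \<Longrightarrow> cmp B = cmp A"
  unfolding rel_TpPos using redP_cmp by blast

lemma cmpN_rel: "rel TpNeg X Y \<Longrightarrow> cmpN Y = cmpN X"
  unfolding rel_TpNeg using redN_cmp by blast

lemma cmp_typed: "cmp A t \<Longrightarrow> [] \<turnstile> t \<Colon> TmPos A"
  unfolding cmp_def using red_typed(1) by blast

lemma cmp_eq: "\<lbrakk>cmp A t; [] \<turnstile> t \<doteq> u \<Colon> TmPos A\<rbrakk> \<Longrightarrow> cmp A u"
  unfolding cmp_def using red_closed(1) by blast

lemma cmpN_eq: "\<lbrakk>cmpN X t; [] \<turnstile> t \<doteq> u \<Colon> TmNeg X\<rbrakk> \<Longrightarrow> cmpN X u"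
  unfolding cmpN_def using red_closed(2) by blast

lemma cmpN_step: "cmpN X t \<Longrightarrow> cmpN X (Step X c t)"
  unfolding cmpN_def using red_step(2) by blast

lemma rel_TpPos_typed: "rel TpPos A B \<Longrightarrow> [] \<turnstile> A \<Colon> TpPos" "rel TpPos A B \<Longrightarrow> [] \<turnstile> B \<Colon> TpPos"
  using rel_eq presups(5,6) by blast+

lemma red_U: "rel TpNeg X X \<Longrightarrow> redP (U X) (cmpN X)"
  by (rule redP_U[OF ev_val eq_refl]) (auto simp: rel_TpNeg intro: U presups)

lemma red_Open: "[] \<turnstile> A \<Colon> TpPos \<Longrightarrow> redP (Open A) (\<lambda>t. [] \<turnstile> t \<Colon> TmPos (Open A))"
  by (rule redP_Open[OF ev_val eq_refl]) (auto intro: Open)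

lemma red_Closed: "rel TpPos A A \<Longrightarrow> redP (Closed A) (\<lambda>t. \<exists>a. cmp A a \<and> [] \<turnstile> t \<doteq> Eta A a \<Colon> TmPos (Closed A))"
  by (rule redP_Closed[OF ev_val eq_refl]) (auto simp: rel_TpPos intro: Closed presups)

lemma red_F: "rel TpPos A A \<Longrightarrow> redN (F A) (\<lambda>t. \<exists>c a. cmp A a \<and> [] \<turnstile> t \<doteq> Step (F A) c (Ret A a) \<Colon> TmNeg (F A))"
  by (rule redN_F[OF ev_val eq_refl]) (auto simp: rel_TpPos intro: F presups)

lemma red_EqT: "[] \<turnstile> EqT A a b \<Colon> TpPos \<Longrightarrow> redP (EqT A a b) (\<lambda>t. [] \<turnstile> t \<Colon> TmPos (EqT A a b))"
  by (rule redP_Eq[OF ev_val eq_refl]) auto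

lemma red_NatT: "redP NatT (\<lambda>t. \<exists>n. [] \<turnstile> t \<doteq> (Succ ^^ n) Zero \<Colon> TmPos NatT)"
  by (rule redP_Nat[OF ev_val eq_refl]) (auto intro: NatT ctx_nil)

lemma val_TpPos: "val TpPos TpPos" and val_TpNeg: "val TpNeg TpNeg"
  by (simp_all add: val.simps)

text \<open>Relatedness of \<open>X\<close> and \<open>X'\<close> gives the fibres with annotation
  \<open>A\<close> on both sides; \<open>rel_change_right\<close> puts \<open>A'\<close> on the
  right.\<close>

lemma rel_atNeg:
  assumes "rel TpPos A A'" "rel (Arr (TmPos A) TpNeg) X X'" "rel (TmPos A) a b"
  shows "rel TpNeg (atNeg A X a) (atNeg A' X' b)"
proof -
  have "rel TpNeg (atNeg A X a) (atNeg A X' b)"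
    using assms(2,3) by (simp add: rel.simps(2))
  moreover have "[] \<turnstile> atNeg A X a \<doteq> atNeg A' X' b \<Colon> TpNeg"
    using assms by (intro atNeg_cong) (auto simp: rel_eq dest: rel_TpPos_typed)
  ultimately show ?thesis
    by (rule rel_change_right[OF val_TpNeg _ _ ev_le_App[OF ev_le_refl]])
qed

lemma rel_atPos:
  assumes "rel TpPos A A'" "rel (Arr (TmPos A) TpPos) X X'" "rel (TmPos A) a b"
  shows "rel TpPos (atPos A X a) (atPos A' X' b)"
proof -
  have "rel TpPos (atPos A X a) (atPos A X' b)"
    using assms(2,3) by (simp add: rel.simps(2))
  moreover have "[] \<turnstile> atPos A X a \<doteq> atPos A' X' b \<Colon> TpPos"
    using assms by (intro atPos_cong) (auto simp: rel_eq dest: rel_TpPos_typed)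
  ultimately show ?thesis
    by (rule rel_change_right[OF val_TpPos _ _ ev_le_App[OF ev_le_refl]])
qed

lemma cmp_rel_TmPos: "cmp A a \<Longrightarrow> rel (TmPos A) a a"
  by (simp add: rel_TmPos cmp_typed eq_refl)

context
  fixes A A' X X' :: "('c::monoid_add) tm"
  assumes A: "rel TpPos A A'" and X: "rel (Arr (TmPos A) TpNeg) X X'"
begin

text \<open>Related types must have literally the same predicate. The one that
  \<open>redN_Pi\<close> builds for \<open>PiT A' X'\<close> mentions primed annotations;
  applications under either annotation are judgmentally equal, so it coincides with that of
  \<open>PiT A X\<close>.\<close>

lemma red_PiT:
  "redN (PiT A X) (\<lambda>t. [] \<turnstile> t \<Colon> TmNeg (PiT A X) \<and> (\<forall>a. cmp A a \<longrightarrow> cmpN (atNeg A X a) (apT A X t a)))"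
  "redN (PiT A' X') (\<lambda>t. [] \<turnstile> t \<Colon> TmNeg (PiT A X) \<and> (\<forall>a. cmp A a \<longrightarrow> cmpN (atNeg A X a) (apT A X t a)))"
proof -
  note eA = rel_eq[OF A] and eX = rel_eq[OF X]
  note tA = presups(5,6)[OF eA] and tX = presups(5,6)[OF eX]
  have eP: "[] \<turnstile> PiT A X \<doteq> PiT A' X' \<Colon> TpNeg" by (rule PiT_cong[OF eA eX])
  have X': "[] \<turnstile> X' \<Colon> Arr (TmPos A') TpNeg"
    by (rule conv[OF tX(2) Arr_TpNeg_cong[OF tA(1) eA]])
  have red: "redP A (cmp A)" "redP A' (cmp A)" using A by (simp_all add: rel_TpPos)
  have redX: "redN (atNeg A X a) (cmpN (atNeg A X a))" "redN (atNeg A' X' a) (cmpN (atNeg A X a))" if "cmp A a" for a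
    using rel_atNeg[OF A X cmp_rel_TmPos[OF that]] by (simp_all add: rel_TpNeg)
  have T: "cmpN (atNeg A X a) = cmpN (atNeg A X b)" if a: "cmp A a" and ab: "[] \<turnstile> a \<doteq> b \<Colon> TmPos A" for a b
  proof -
    have "rel (TmPos A) a b" using a ab by (simp add: rel_TmPos)
    from cmpN_rel[OF rel_atNeg[OF A X this]] cmpN_rel[OF rel_atNeg[OF A X cmp_rel_TmPos[OF cmp_eq[OF a ab]]]]
    show ?thesis by simp
  qed
  have T': "cmpN (atNeg A X a) = cmpN (atNeg A X b)" if a: "cmp A a" and ab: "[] \<turnstile> a \<doteq> b \<Colon> TmPos A'" for a b
    using T[OF a eq_conv[OF ab eqJ_sym[OF TmPos_cong[OF eA]]]] .
  show "redN (PiT A X) (\<lambda>t. [] \<turnstile> t \<Colon> TmNeg (PiT A X) \<and> (\<forall>a. cmp A a \<longrightarrow> cmpN (atNeg A X a) (apT A X t a)))"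
    by (rule redN_Pi[OF ev_val eq_refl[OF PiT[OF tA(1) tX(1)]] tA(1) tX(1) red(1) redX(1) T]) simp_all
  have "redN (PiT A' X') (\<lambda>t. [] \<turnstile> t \<Colon> TmNeg (PiT A' X') \<and> (\<forall>a. cmp A a \<longrightarrow> cmpN (atNeg A X a) (apT A' X' t a)))"
    by (rule redN_Pi[OF ev_val eq_refl[OF PiT[OF tA(2) X']] tA(2) X' red(2) redX(2) T']) simp_all
  moreover have "(\<lambda>t. [] \<turnstile> t \<Colon> TmNeg (PiT A' X') \<and> (\<forall>a. cmp A a \<longrightarrow> cmpN (atNeg A X a) (apT A' X' t a)))
      = (\<lambda>t. [] \<turnstile> t \<Colon> TmNeg (PiT A X) \<and> (\<forall>a. cmp A a \<longrightarrow> cmpN (atNeg A X a) (apT A X t a)))"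
  proof (intro ext conj_cong)
    fix t
    show "[] \<turnstile> t \<Colon> TmNeg (PiT A' X') \<longleftrightarrow> [] \<turnstile> t \<Colon> TmNeg (PiT A X)"
      by (rule jdg_conv_iff(1)[OF eqJ_sym[OF TmNeg_cong[OF eP]]])
    assume t: "[] \<turnstile> t \<Colon> TmNeg (PiT A X)"
    have "[] \<turnstile> apT A X t a \<doteq> apT A' X' t a \<Colon> TmNeg (atNeg A X a)" if "cmp A a" for a
      using App_cong[OF TmPos[OF tA(1)] TmPos_cong[OF eA] famNeg_cong[OF tA(1) eA eX] Ap_cong[OF eA eX eq_refl[OF t]]
          eq_refl[OF cmp_typed[OF that]]] by simp
    then show "(\<forall>a. cmp A a \<longrightarrow> cmpN (atNeg A X a) (apT A' X' t a)) \<longleftrightarrow> (\<forall>a. cmp A a \<longrightarrow> cmpN (atNeg A X a) (apT A X t a))"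
      by (blast intro: cmpN_eq eq_sym)
  qed
  ultimately show "redN (PiT A' X') (\<lambda>t. [] \<turnstile> t \<Colon> TmNeg (PiT A X) \<and> (\<forall>a. cmp A a \<longrightarrow> cmpN (atNeg A X a) (apT A X t a)))"
    by simp
qed

end

context
  fixes A A' B B' :: "('c::monoid_add) tm"
  assumes A: "rel TpPos A A'" and B: "rel (Arr (TmPos A) TpPos) B B'"
begin

lemma red_SigmaT:
  "redP (SigmaT A B) (\<lambda>t. [] \<turnstile> t \<Colon> TmPos (SigmaT A B) \<and> cmp A (fstT A B t) \<and> cmp (atPos A B (fstT A B t)) (sndT A B t))"
  "redP (SigmaT A' B') (\<lambda>t. [] \<turnstile> t \<Colon> TmPos (SigmaT A B) \<and> cmp A (fstT A B t) \<and> cmp (atPos A B (fstT A B t)) (sndT A B t))"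
proof -
  note eA = rel_eq[OF A] and eB = rel_eq[OF B]
  note tA = presups(5,6)[OF eA] and tB = presups(5,6)[OF eB]
  have eP: "[] \<turnstile> SigmaT A B \<doteq> SigmaT A' B' \<Colon> TpPos" by (rule SigmaT_cong[OF eA eB])
  have B': "[] \<turnstile> B' \<Colon> Arr (TmPos A') TpPos"
    by (rule conv[OF tB(2) Arr_TpPos_cong[OF tA(1) eA]])
  have red: "redP A (cmp A)" "redP A' (cmp A)" using A by (simp_all add: rel_TpPos)
  have redB: "redP (atPos A B a) (cmp (atPos A B a))" "redP (atPos A' B' a) (cmp (atPos A B a))" if "cmp A a" for a
    using rel_atPos[OF A B cmp_rel_TmPos[OF that]] by (simp_all add: rel_TpPos)
  have T: "cmp (atPos A B a) = cmp (atPos A B b)" if a: "cmp A a" and ab: "[] \<turnstile> a \<doteq> b \<Colon> TmPos A" for a b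
  proof -
    have "rel (TmPos A) a b" using a ab by (simp add: rel_TmPos)
    from cmp_rel[OF rel_atPos[OF A B this]] cmp_rel[OF rel_atPos[OF A B cmp_rel_TmPos[OF cmp_eq[OF a ab]]]]
    show ?thesis by simp
  qed
  have T': "cmp (atPos A B a) = cmp (atPos A B b)" if a: "cmp A a" and ab: "[] \<turnstile> a \<doteq> b \<Colon> TmPos A'" for a b
    using T[OF a eq_conv[OF ab eqJ_sym[OF TmPos_cong[OF eA]]]] .
  show "redP (SigmaT A B) (\<lambda>t. [] \<turnstile> t \<Colon> TmPos (SigmaT A B) \<and> cmp A (fstT A B t) \<and> cmp (atPos A B (fstT A B t)) (sndT A B t))"
    by (rule redP_Sigma[where T="\<lambda>a. cmp (atPos A B a)", OF ev_val eq_refl[OF SigmaT[OF tA(1) tB(1)]] tA(1) tB(1) red(1) redB(1) T]) simp_all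
  have "redP (SigmaT A' B') (\<lambda>t. [] \<turnstile> t \<Colon> TmPos (SigmaT A' B') \<and> cmp A (fstT A' B' t) \<and> cmp (atPos A B (fstT A' B' t)) (sndT A' B' t))"
    by (rule redP_Sigma[where T="\<lambda>a. cmp (atPos A B a)", OF ev_val eq_refl[OF SigmaT[OF tA(2) B']] tA(2) B' red(2) redB(2) T']) simp_all
  moreover have "(\<lambda>t. [] \<turnstile> t \<Colon> TmPos (SigmaT A' B') \<and> cmp A (fstT A' B' t) \<and> cmp (atPos A B (fstT A' B' t)) (sndT A' B' t))
      = (\<lambda>t. [] \<turnstile> t \<Colon> TmPos (SigmaT A B) \<and> cmp A (fstT A B t) \<and> cmp (atPos A B (fstT A B t)) (sndT A B t))"
  proof (intro ext conj_cong)
    fix t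
    show "[] \<turnstile> t \<Colon> TmPos (SigmaT A' B') \<longleftrightarrow> [] \<turnstile> t \<Colon> TmPos (SigmaT A B)"
      by (rule jdg_conv_iff(1)[OF eqJ_sym[OF TmPos_cong[OF eP]]])
    assume t: "[] \<turnstile> t \<Colon> TmPos (SigmaT A B)"
    note c = TmPos[OF tA(1)] TmPos_cong[OF eA] famPos_cong[OF tA(1) eA eB] Unpair_cong[OF eA eB eq_refl[OF t]]
    have f: "[] \<turnstile> fstT A B t \<doteq> fstT A' B' t \<Colon> TmPos A" by (rule Fst_cong[OF c])
    then show "cmp A (fstT A' B' t) \<longleftrightarrow> cmp A (fstT A B t)" by (blast intro: cmp_eq eq_sym)
    assume "cmp A (fstT A B t)"
    from T[OF this f] have "cmp (atPos A B (fstT A' B' t)) = cmp (atPos A B (fstT A B t))" by simp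
    moreover have "[] \<turnstile> sndT A B t \<doteq> sndT A' B' t \<Colon> TmPos (atPos A B (fstT A B t))" using Snd_cong[OF c] by simp
    ultimately show "cmp (atPos A B (fstT A' B' t)) (sndT A' B' t) \<longleftrightarrow> cmp (atPos A B (fstT A B t)) (sndT A B t)"
      by (metis cmp_eq eq_sym)
  qed
  ultimately show "redP (SigmaT A' B') (\<lambda>t. [] \<turnstile> t \<Colon> TmPos (SigmaT A B) \<and> cmp A (fstT A B t) \<and> cmp (atPos A B (fstT A B t)) (sndT A B t))"
    by simp
qed

end

section \<open>Validity of the type constants\<close>

lemma v_TpPos_I:
  assumes "\<Gamma> \<turnstile> A \<doteq> B \<Colon> TpPos" "\<And>s q. senv \<Gamma> s q \<Longrightarrow> \<exists>R. redP (subT s A) R \<and> redP (subT q B) R"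
  shows "vT \<Gamma> A B TpPos"
  by (rule vT_I[OF assms(1) v_atom(2)[OF ctx_of(5)[OF assms(1)]]])
    (use eqT_senv[OF assms(1)] assms(2) in \<open>simp add: rel.simps\<close>)

lemma v_TpNeg_I:
  assumes "\<Gamma> \<turnstile> A \<doteq> B \<Colon> TpNeg" "\<And>s q. senv \<Gamma> s q \<Longrightarrow> \<exists>R. redN (subT s A) R \<and> redN (subT q B) R"
  shows "vT \<Gamma> A B TpNeg"
  by (rule vT_I[OF assms(1) v_atom(3)[OF ctx_of(5)[OF assms(1)]]])
    (use eqT_senv[OF assms(1)] assms(2) in \<open>simp add: rel.simps\<close>)

text \<open>Type constants are treated with different arguments on the two sides. Relatedness of
  types depends on their evaluation, so their congruence rules cannot be deduced from validity of
  one side.\<close>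

lemma v_U:
  assumes X: "vT \<Gamma> X X' TpNeg"
  shows "vT \<Gamma> (U X) (U X') TpPos"
proof (rule v_TpPos_I[OF U_cong[OF vT_eq(1)[OF X]]])
  fix s q assume e: "senv \<Gamma> s q"
  have "rel TpNeg (subT s X) (subT q X')" using vT_D[OF X e] by simp
  moreover have "rel TpNeg (subT s X) (subT s X)" "rel TpNeg (subT q X') (subT q X')"
    using vT_D[OF vT_refl(1)[OF X] senv_refl[OF e]] vT_D[OF vT_refl(2)[OF X] senv_refl[OF senv_sym[OF e]]] by simp_all
  ultimately show "\<exists>R. redP (subT s (U X)) R \<and> redP (subT q (U X')) R"
    using red_U cmpN_rel by (metis subT.simps(9))
qed

text \<open>Canonical forms annotated by the two instances of the value type are judgmentally equal,
  and the types share their predicate; so the predicates at \<open>F\<close> are equal as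
  well.\<close>

lemma v_F:
  assumes A: "vT \<Gamma> A A' TpPos"
  shows "vT \<Gamma> (F A) (F A') TpNeg"
proof (rule v_TpNeg_I[OF F_cong[OF vT_eq(1)[OF A]]])
  fix s q assume e: "senv \<Gamma> s q"
  let ?A = "subT s A" and ?A' = "subT q A'"
  have r: "rel TpPos ?A ?A'" "rel TpPos ?A ?A" "rel TpPos ?A' ?A'"
    using vT_D[OF A e] vT_D[OF vT_refl(1)[OF A] senv_refl[OF e]] vT_D[OF vT_refl(2)[OF A] senv_refl[OF senv_sym[OF e]]]
    by simp_all
  note eA = rel_eq[OF r(1)]
  have "[] \<turnstile> Step (F ?A) c (Ret ?A a) \<doteq> Step (F ?A') c (Ret ?A' a) \<Colon> TmNeg (F ?A)" if "cmp ?A a" for c a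
    by (rule Step_cong[OF F_cong[OF eA] Ret_cong[OF eA eq_refl[OF cmp_typed[OF that]]]])
  then have "(\<lambda>t. \<exists>c a. cmp ?A' a \<and> [] \<turnstile> t \<doteq> Step (F ?A') c (Ret ?A' a) \<Colon> TmNeg (F ?A'))
      = (\<lambda>t. \<exists>c a. cmp ?A a \<and> [] \<turnstile> t \<doteq> Step (F ?A) c (Ret ?A a) \<Colon> TmNeg (F ?A))"
    unfolding cmp_rel[OF r(1)] jdg_conv_iff(2)[OF TmNeg_cong[OF F_cong[OF eA]], symmetric]
    by (intro ext iff_exI conj_cong refl) (blast intro: eq_trans eq_sym)
  then have eq: "redN (F ?A') (\<lambda>t. \<exists>c a. cmp ?A a \<and> [] \<turnstile> t \<doteq> Step (F ?A) c (Ret ?A a) \<Colon> TmNeg (F ?A))"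
    using red_F[OF r(3)] by (simp only:)
  show "\<exists>R. redN (subT s (F A)) R \<and> redN (subT q (F A')) R"
    unfolding subT.simps by (rule exI, rule conjI[OF red_F[OF r(2)] eq])
qed

lemma v_Closed:
  assumes A: "vT \<Gamma> A A' TpPos"
  shows "vT \<Gamma> (Closed A) (Closed A') TpPos"
proof (rule v_TpPos_I[OF Closed_cong[OF vT_eq(1)[OF A]]])
  fix s q assume e: "senv \<Gamma> s q"
  let ?A = "subT s A" and ?A' = "subT q A'"
  have r: "rel TpPos ?A ?A'" "rel TpPos ?A ?A" "rel TpPos ?A' ?A'"
    using vT_D[OF A e] vT_D[OF vT_refl(1)[OF A] senv_refl[OF e]] vT_D[OF vT_refl(2)[OF A] senv_refl[OF senv_sym[OF e]]]
    by simp_all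
  note eA = rel_eq[OF r(1)]
  have "[] \<turnstile> Eta ?A a \<doteq> Eta ?A' a \<Colon> TmPos (Closed ?A)" if "cmp ?A a" for a
    by (rule Eta_cong[OF eA eq_refl[OF cmp_typed[OF that]]])
  then have "(\<lambda>t. \<exists>a. cmp ?A' a \<and> [] \<turnstile> t \<doteq> Eta ?A' a \<Colon> TmPos (Closed ?A'))
      = (\<lambda>t. \<exists>a. cmp ?A a \<and> [] \<turnstile> t \<doteq> Eta ?A a \<Colon> TmPos (Closed ?A))"
    unfolding cmp_rel[OF r(1)] jdg_conv_iff(2)[OF TmPos_cong[OF Closed_cong[OF eA]], symmetric]
    by (intro ext iff_exI conj_cong refl) (blast intro: eq_trans eq_sym)
  then have eq: "redP (Closed ?A') (\<lambda>t. \<exists>a. cmp ?A a \<and> [] \<turnstile> t \<doteq> Eta ?A a \<Colon> TmPos (Closed ?A))"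
    using red_Closed[OF r(3)] by (simp only:)
  show "\<exists>R. redP (subT s (Closed A)) R \<and> redP (subT q (Closed A')) R"
    unfolding subT.simps by (rule exI, rule conjI[OF red_Closed[OF r(2)] eq])
qed

lemma v_Open:
  assumes A: "vT \<Gamma> A A' TpPos"
  shows "vT \<Gamma> (Open A) (Open A') TpPos"
proof (rule v_TpPos_I[OF Open_cong[OF vT_eq(1)[OF A]]])
  fix s q assume e: "senv \<Gamma> s q"
  have r: "[] \<turnstile> subT s A \<doteq> subT q A' \<Colon> TpPos" using eqT_senv[OF vT_eq(1)[OF A] e] by simp
  show "\<exists>R. redP (subT s (Open A)) R \<and> redP (subT q (Open A')) R"
    using red_Open[OF presups(5)[OF r]] red_Open[OF presups(6)[OF r]]
    unfolding jdg_conv_iff(1)[OF TmPos_cong[OF Open_cong[OF r]]] by auto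
qed

lemma v_EqT:
  assumes A: "vT \<Gamma> A A' TpPos" and a: "vT \<Gamma> a a' (TmPos A)" and b: "vT \<Gamma> b b' (TmPos A)"
  shows "vT \<Gamma> (EqT A a b) (EqT A' a' b') TpPos"
proof (rule v_TpPos_I)
  show E: "\<Gamma> \<turnstile> EqT A a b \<doteq> EqT A' a' b' \<Colon> TpPos"
    by (rule EqT_cong[OF vT_eq(1)[OF A] vT_eq(1)[OF a] vT_eq(1)[OF b]])
  fix s q assume e: "senv \<Gamma> s q"
  have r: "[] \<turnstile> EqT (subT s A) (subT s a) (subT s b) \<doteq> EqT (subT q A') (subT q a') (subT q b') \<Colon> TpPos"
    using eqT_senv[OF E e] by simp
  show "\<exists>R. redP (subT s (EqT A a b)) R \<and> redP (subT q (EqT A' a' b')) R"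
    using red_EqT[OF presups(5)[OF r]] red_EqT[OF presups(6)[OF r]]
    unfolding jdg_conv_iff(1)[OF TmPos_cong[OF r]] by auto
qed

lemma v_NatT: "\<turnstile>\<^sub>C \<Gamma> \<Longrightarrow> vT \<Gamma> NatT NatT TpPos"
  by (rule v_TpPos_I[OF eq_refl[OF NatT]]) (use red_NatT in auto)

lemma v_PiT:
  assumes A: "vT \<Gamma> A A' TpPos" and X: "vT \<Gamma> X X' (Arr (TmPos A) TpNeg)"
  shows "vT \<Gamma> (PiT A X) (PiT A' X') TpNeg"
proof (rule v_TpNeg_I[OF PiT_cong[OF vT_eq(1)[OF A] vT_eq(1)[OF X]]])
  fix s q assume e: "senv \<Gamma> s q"
  show "\<exists>R. redN (subT s (PiT A X)) R \<and> redN (subT q (PiT A' X')) R"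
    using red_PiT[of "subT s A" "subT q A'" "subT s X" "subT q X'"] vT_D[OF A e] vT_D[OF X e] by auto
qed

lemma v_SigmaT:
  assumes A: "vT \<Gamma> A A' TpPos" and B: "vT \<Gamma> B B' (Arr (TmPos A) TpPos)"
  shows "vT \<Gamma> (SigmaT A B) (SigmaT A' B') TpPos"
proof (rule v_TpPos_I[OF SigmaT_cong[OF vT_eq(1)[OF A] vT_eq(1)[OF B]]])
  fix s q assume e: "senv \<Gamma> s q"
  show "\<exists>R. redP (subT s (SigmaT A B)) R \<and> redP (subT q (SigmaT A' B')) R"
    using red_SigmaT[of "subT s A" "subT q A'" "subT s B" "subT q B'"] vT_D[OF A e] vT_D[OF B e] by auto
qed

text \<open>Judgments whose elements contain no types: on them the relation depends on its arguments only up to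
  judgmental equality, so an equation between their elements is valid as soon as one side is.\<close>

fun small :: "'c jdg \<Rightarrow> bool" where
  "small (JPi A B) \<longleftrightarrow> small B"
| "small (JSigma A B) \<longleftrightarrow> small A \<and> small B"
| "small TpPos \<longleftrightarrow> False"
| "small TpNeg \<longleftrightarrow> False"
| "small J \<longleftrightarrow> True"

lemma small_sub [simp]: "small (subJ s J) = small J"
  by (induct J arbitrary: s rule: small.induct) simp_all

text \<open>At \<open>JPi\<close> the domain may well contain types: \<open>u\<close> and
  \<open>u'\<close> are applied to the same argument, so only the codomain has to be small.\<close>

lemma small_rel:
  fixes J :: "('c::monoid_add) jdg"
  shows "\<lbrakk>small J; val J J; rel J t u; [] \<turnstile> u \<doteq> u' \<Colon> J\<rbrakk> \<Longrightarrow> rel J t u'"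
proof (induct "jsz J" arbitrary: J t u u' rule: less_induct)
  case less
  note e = rel_eq[OF less(4)]
  have tu': "[] \<turnstile> t \<doteq> u' \<Colon> J" by (rule eq_trans[OF e less(5)])
  show ?case
  proof (cases J)
    case (JPi A B)
    interpret valid_fam A B A B
      by unfold_locales (use less(3) JPi PER in \<open>auto simp: val.simps\<close>)
    have "rel (instJ B a) (App A B t a) (App A B u' b)" if ab: "rel A a b" for a b
    proof (rule less(1))
      show "rel (instJ B a) (App A B t a) (App A B u b)" using less(4) ab by (simp add: JPi rel.simps)
      have "[] \<turnstile> App A B u b \<doteq> App A B u' b \<Colon> instJ B b"
        by (rule App_cong[OF tA(1) eA eB _ rel_eq[OF relA(4)[OF ab]]]) (use less(5) JPi in simp)
      then show "[] \<turnstile> App A B u b \<doteq> App A B u' b \<Colon> instJ B a"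
        by (rule eq_conv[OF _ val_eqJ[OF vB'(3)[OF ab]]])
    qed (use JPi less(2) vB'(5)[OF ab] in simp_all)
    with tu' show ?thesis by (simp add: JPi rel.simps)
  next
    case (JSigma A B)
    interpret valid_fam A B A B
      by unfold_locales (use less(3) JSigma PER in \<open>auto simp: val.simps\<close>)
    have uu: "[] \<turnstile> u \<doteq> u' \<Colon> JSigma A B" using less(5) JSigma by simp
    have f: "rel A (Fst A B t) (Fst A B u)" and s: "rel (instJ B (Fst A B t)) (Snd A B t) (Snd A B u)"
      using less(4) by (simp_all add: JSigma rel.simps)
    have "rel A (Fst A B t) (Fst A B u')"
      by (rule less(1)[OF _ _ vA f Fst_cong[OF tA(1) eA eB uu]]) (use less(2) JSigma in simp_all)
    moreover have "rel (instJ B (Fst A B t)) (Snd A B t) (Snd A B u')"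
      by (rule less(1)[OF _ _ vB'(5)[OF f] s eq_conv[OF Snd_cong[OF tA(1) eA eB uu] val_eqJ[OF vB'(3)[OF f]]]])
        (use less(2) JSigma in simp_all)
    ultimately show ?thesis using tu' by (simp add: JSigma rel.simps)
  qed (use less tu' in \<open>simp_all add: rel.simps\<close>)
qed

text \<open>Besides the equations of calf this yields the congruence rules of all term constants,
  which is why those constants are treated only with equal arguments on both sides.\<close>

lemma v_small:
  assumes t: "vT \<Gamma> t t J" and J: "small J" and eq: "\<Gamma> \<turnstile> t \<doteq> u \<Colon> J"
  shows "vT \<Gamma> t u J"
proof (rule vT_I[OF eq vT_vJ[OF t]])
  fix s q assume e: "senv \<Gamma> s q"
  show "rel (subJ s J) (subT s t) (subT q u)"
  proof (rule small_rel[OF _ vJ_self[OF vT_vJ[OF t] e] vT_D[OF t e]])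
    show "[] \<turnstile> subT q t \<doteq> subT q u \<Colon> subJ s J"
      by (rule eq_trans[OF eq_sym[OF eqT_senv[OF eq_refl[OF vT_eq(2)[OF t]] e]] eqT_senv[OF eq e]])
  qed (simp add: J)
qed

lemma v_TmPos_I:
  assumes "\<Gamma> \<turnstile> t \<Colon> TmPos A" "vT \<Gamma> A A TpPos" "\<And>s. senv \<Gamma> s s \<Longrightarrow> cmp (subT s A) (subT s t)"
  shows "vT \<Gamma> t t (TmPos A)"
  by (rule vT_I[OF eq_refl[OF assms(1)] v_TmPos[OF assms(2)]])
    (use eqT_senv[OF eq_refl[OF assms(1)]] assms(3)[OF senv_refl] in \<open>auto simp: rel_TmPos\<close>)

lemma vT_cmp: "vT \<Gamma> t u (TmPos A) \<Longrightarrow> senv \<Gamma> s s \<Longrightarrow> cmp (subT s A) (subT s t)"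
  using vT_D rel_TmPos by fastforce

lemma vT_rel_TpPos: "vT \<Gamma> A A' TpPos \<Longrightarrow> senv \<Gamma> s q \<Longrightarrow> rel TpPos (subT s A) (subT q A')"
  using vT_D by fastforce

lemma vT_rel_TpNeg: "vT \<Gamma> A A' TpNeg \<Longrightarrow> senv \<Gamma> s q \<Longrightarrow> rel TpNeg (subT s A) (subT q A')"
  using vT_D by fastforce

lemma vT_rel_fam:
  "vT \<Gamma> X X' (Arr (TmPos A) TpNeg) \<Longrightarrow> senv \<Gamma> s q \<Longrightarrow> rel (Arr (TmPos (subT s A)) TpNeg) (subT s X) (subT q X')"
  "vT \<Gamma> B B' (Arr (TmPos A) TpPos) \<Longrightarrow> senv \<Gamma> s q \<Longrightarrow> rel (Arr (TmPos (subT s A)) TpPos) (subT s B) (subT q B')"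
  using vT_D by fastforce+

lemma vT_typed: "vT \<Gamma> t u J \<Longrightarrow> senv \<Gamma> s q \<Longrightarrow> [] \<turnstile> subT s t \<Colon> subJ s J"
  using presups(5)[OF eqT_senv[OF vT_eq(1)]] by blast

lemma cmp_U: "rel TpNeg X X \<Longrightarrow> cmp (U X) = cmpN X"
  by (rule redP_cmp[OF red_U])

lemma cmp_U_senv: "vT \<Gamma> X X TpNeg \<Longrightarrow> senv \<Gamma> s s \<Longrightarrow> cmp (U (subT s X)) = cmpN (subT s X)"
  by (rule cmp_U[OF vT_rel_TpNeg])

section \<open>Validity of the term constants\<close>

lemma v_atNeg:
  assumes "vT \<Gamma> A A' TpPos" "vT \<Gamma> X X' (Arr (TmPos A) TpNeg)" "vT \<Gamma> a a' (TmPos A)"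
  shows "vT \<Gamma> (atNeg A X a) (atNeg A' X' a') TpNeg"
  using v_App[OF v_TmPos[OF assms(1)] vJ_wk[OF TmPos v_atom(3)[OF ctx_of(4)]] assms(2,3)] vT_eq(2)[OF assms(1)] by simp

lemma v_atPos:
  assumes "vT \<Gamma> A A' TpPos" "vT \<Gamma> X X' (Arr (TmPos A) TpPos)" "vT \<Gamma> a a' (TmPos A)"
  shows "vT \<Gamma> (atPos A X a) (atPos A' X' a') TpPos"
  using v_App[OF v_TmPos[OF assms(1)] vJ_wk[OF TmPos v_atom(2)[OF ctx_of(4)]] assms(2,3)] vT_eq(2)[OF assms(1)] by simp

lemma v_TmNeg: "vT \<Gamma> X X' TpNeg \<Longrightarrow> vJ \<Gamma> (TmNeg X) (TmNeg X')"
  by (rule v_TmPos[OF v_U])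

lemma vT_wk_TpPos:
  assumes "\<Gamma> \<turnstile>\<^sub>J B"
  shows "vT \<Gamma> A A' TpPos \<Longrightarrow> vT (B # \<Gamma>) (wkT A) (wkT A') TpPos"
    and "vT \<Gamma> X X' (Arr (TmPos A) TpNeg) \<Longrightarrow> vT (B # \<Gamma>) (wkT X) (wkT X') (Arr (TmPos (wkT A)) TpNeg)"
    and "vT \<Gamma> X X' (Arr (TmPos A) TpPos) \<Longrightarrow> vT (B # \<Gamma>) (wkT X) (wkT X') (Arr (TmPos (wkT A)) TpPos)"
  using vT_wk[OF assms] by fastforce+

lemma vT_var_TmPos: "vT \<Gamma> A A TpPos \<Longrightarrow> vT (TmPos A # \<Gamma>) (Var 0) (Var 0) (TmPos (wkT A))"
  using vT_var_0[OF v_TmPos] by fastforce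

lemma v_famNeg:
  assumes "vT \<Gamma> A A TpPos" "vT \<Gamma> X X (Arr (TmPos A) TpNeg)"
  shows "vJ (TmPos A # \<Gamma>) (famNeg A X) (famNeg A X)"
  using assms vT_eq(2)[OF assms(1)]
  by (intro v_TmNeg v_atNeg vT_wk_TpPos vT_var_TmPos TmPos)

lemma v_famPos:
  assumes "vT \<Gamma> A A TpPos" "vT \<Gamma> X X (Arr (TmPos A) TpPos)"
  shows "vJ (TmPos A # \<Gamma>) (famPos A X) (famPos A X)"
  using assms vT_eq(2)[OF assms(1)]
  by (intro v_TmPos v_atPos vT_wk_TpPos vT_var_TmPos TmPos)

text \<open>By \<open>Step_0\<close>, \<open>ret\<close> has the required form with cost 0, the unit
  of the monoid.\<close>

lemma v_Ret:
  assumes A: "vT \<Gamma> A A TpPos" and a: "vT \<Gamma> a a (TmPos A)"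
  shows "vT \<Gamma> (Ret A a) (Ret A a) (TmNeg (F A))"
proof (rule v_TmPos_I[OF Ret[OF vT_eq(2)[OF A] vT_eq(2)[OF a]] v_U[OF v_F[OF A]]])
  fix s assume e: "senv \<Gamma> s s"
  have tA: "[] \<turnstile> subT s A \<Colon> TpPos" and ta: "[] \<turnstile> subT s a \<Colon> TmPos (subT s A)"
    using vT_typed[OF A e] vT_typed[OF a e] by simp_all
  have "cmpN (F (subT s A)) (Ret (subT s A) (subT s a))"
    unfolding redN_cmp[OF red_F[OF vT_rel_TpPos[OF A e]]]
    using vT_cmp[OF a e] eq_sym[OF Step_0[OF F[OF tA] Ret[OF tA ta]]] by blast
  then show "cmp (subT s (U (F A))) (subT s (Ret A a))"
    using cmp_U_senv[OF v_F[OF A] e] by simp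
qed

lemma v_Step:
  assumes X: "vT \<Gamma> X X TpNeg" and t: "vT \<Gamma> t t (TmNeg X)"
  shows "vT \<Gamma> (Step X c t) (Step X c t) (TmNeg X)"
  by (rule v_TmPos_I[OF Step[OF vT_eq(2)[OF X] vT_eq(2)[OF t]] v_U[OF X]])
    (use cmp_U_senv[OF X] vT_cmp[OF t] cmpN_step in fastforce)

lemma rel_JPi_app:
  assumes "rel (JPi A B) f f" "rel A a a"
  shows "rel (instJ B a) (App A B f a) (App A B f a)"
  using assms by (simp add: rel.simps)

text \<open>Under a closing substitution \<open>t\<close> equals step^c(ret(a)), so
  \<open>Bind_Step\<close> and \<open>Bind_Ret\<close> turn the whole into step^c(f(a)). This is
  computable at \<open>X\<close> because \<open>f\<close> is valid and \<open>X\<close> is closed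
  under steps.\<close>

lemma v_Bind:
  assumes A: "vT \<Gamma> A A TpPos" and X: "vT \<Gamma> X X TpNeg" and t: "vT \<Gamma> t t (TmNeg (F A))"
    and f: "vT \<Gamma> f f (Arr (TmPos A) (TmNeg X))"
  shows "vT \<Gamma> (Bind A X t f) (Bind A X t f) (TmNeg X)"
proof (rule v_TmPos_I[OF Bind[OF vT_eq(2)[OF A] vT_eq(2)[OF X] vT_eq(2)[OF t] vT_eq(2)[OF f]] v_U[OF X]])
  fix s assume e: "senv \<Gamma> s s"
  let ?A = "subT s A" and ?X = "subT s X" and ?t = "subT s t" and ?f = "subT s f"
  have tA: "[] \<turnstile> ?A \<Colon> TpPos" and tX: "[] \<turnstile> ?X \<Colon> TpNeg" and tf: "[] \<turnstile> ?f \<Colon> Arr (TmPos ?A) (TmNeg ?X)"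
    using vT_typed[OF A e] vT_typed[OF X e] vT_typed[OF f e] by simp_all
  have "cmpN (F ?A) ?t" using vT_cmp[OF t e] cmp_U_senv[OF v_F[OF A] e] by simp
  then obtain c a where a: "cmp ?A a" and eq: "[] \<turnstile> ?t \<doteq> Step (F ?A) c (Ret ?A a) \<Colon> TmNeg (F ?A)"
    unfolding redN_cmp[OF red_F[OF vT_rel_TpPos[OF A e]]] by blast
  note ta = cmp_typed[OF a]
  have rf: "rel (Arr (TmPos ?A) (TmNeg ?X)) ?f ?f" using vT_D[OF f e] by simp
  have "rel (TmNeg ?X) (app (TmPos ?A) (TmNeg ?X) ?f a) (app (TmPos ?A) (TmNeg ?X) ?f a)"
    using rel_JPi_app[OF rf cmp_rel_TmPos[OF a]] by simp
  then have "cmpN ?X (Step ?X c (app (TmPos ?A) (TmNeg ?X) ?f a))"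
    unfolding rel_TmPos using cmp_U_senv[OF X e] by (auto intro: cmpN_step)
  moreover have "[] \<turnstile> Bind ?A ?X ?t ?f \<doteq> Step ?X c (app (TmPos ?A) (TmNeg ?X) ?f a) \<Colon> TmNeg ?X"
    by (rule eq_trans[OF eq_trans[OF Bind_cong[OF eq_refl[OF tA] eq_refl[OF tX] eq eq_refl[OF tf]]
            Bind_Step[OF tA tX Ret[OF tA ta] tf]] Step_cong[OF eq_refl[OF tX] Bind_Ret[OF tA tX ta tf]]])
  ultimately show "cmp (subT s (U X)) (subT s (Bind A X t f))"
    using cmp_U_senv[OF X e] cmpN_eq eq_sym by fastforce
qed

text \<open>\<open>rel Beh\<close> is empty, so a context with a valid term of \<open>Beh\<close>
  has no closing substitution. This settles \<open>Star\<close>.\<close>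

lemma v_Beh_vacuous: "vT \<Gamma> z z Beh \<Longrightarrow> \<not> senv \<Gamma> s q"
  using vT_D by (fastforce simp: rel.simps)

lemma v_LamOpen:
  assumes A: "vT \<Gamma> A A TpPos" and f: "vT \<Gamma> f f (Arr Beh (TmPos A))"
  shows "vT \<Gamma> (LamOpen A f) (LamOpen A f) (TmPos (Open A))"
proof -
  note t = LamOpen[OF vT_eq(2)[OF A] vT_eq(2)[OF f]]
  show ?thesis
  proof (rule v_TmPos_I[OF t v_Open[OF A]])
    fix s assume e: "senv \<Gamma> s s"
    have "[] \<turnstile> subT s A \<Colon> TpPos" "[] \<turnstile> subT s (LamOpen A f) \<Colon> TmPos (Open (subT s A))"
      using vT_typed[OF A e] presups(5)[OF eqT_senv[OF eq_refl[OF t] e]] by simp_all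
    then show "cmp (subT s (Open A)) (subT s (LamOpen A f))"
      by (simp add: redP_cmp[OF red_Open])
  qed
qed

text \<open>No arguments are related at \<open>Beh\<close>, so at a function judgment out of
  \<open>Beh\<close> only the judgmental part of \<open>rel\<close> remains.\<close>

lemma v_ApOpen:
  assumes A: "vT \<Gamma> A A TpPos" and u: "vT \<Gamma> u u (TmPos (Open A))"
  shows "vT \<Gamma> (ApOpen A u) (ApOpen A u) (Arr Beh (TmPos A))"
proof -
  note t = eq_refl[OF ApOpen[OF vT_eq(2)[OF A] vT_eq(2)[OF u]]]
  show ?thesis
    by (rule vT_I[OF t v_Arr[OF v_atom(4)[OF ctx_of(5)[OF t]] v_TmPos[OF A]]])
      (use eqT_senv[OF t] in \<open>simp add: rel.simps\<close>)
qed

lemma v_Eta: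
  assumes A: "vT \<Gamma> A A TpPos" and a: "vT \<Gamma> a a (TmPos A)"
  shows "vT \<Gamma> (Eta A a) (Eta A a) (TmPos (Closed A))"
proof (rule v_TmPos_I[OF Eta[OF vT_eq(2)[OF A] vT_eq(2)[OF a]] v_Closed[OF A]])
  fix s assume e: "senv \<Gamma> s s"
  have "[] \<turnstile> subT s A \<Colon> TpPos" "[] \<turnstile> subT s a \<Colon> TmPos (subT s A)"
    using vT_typed[OF A e] vT_typed[OF a e] by simp_all
  then have "[] \<turnstile> Eta (subT s A) (subT s a) \<doteq> Eta (subT s A) (subT s a) \<Colon> TmPos (Closed (subT s A))"
    by (blast intro: eq_refl Eta)
  then show "cmp (subT s (Closed A)) (subT s (Eta A a))"
    using vT_cmp[OF a e] by (auto simp: redP_cmp[OF red_Closed[OF vT_rel_TpPos[OF A e]]])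
qed

lemma v_Star:
  assumes A: "vT \<Gamma> A A TpPos" and z: "vT \<Gamma> z z Beh"
  shows "vT \<Gamma> (Star A z) (Star A z) (TmPos (Closed A))"
  by (rule v_TmPos_I[OF Star[OF vT_eq(2)[OF A] vT_eq(2)[OF z]] v_Closed[OF A]])
    (use v_Beh_vacuous[OF z] in blast)

text \<open>A computable \<open>b\<close> equals \<open>Eta A a\<close> with \<open>a\<close>
  computable, so the eliminator always reduces to \<open>x0\<close> at \<open>a\<close>.\<close>

lemma v_IndClosed:
  assumes A: "vT \<Gamma> A A TpPos" and b: "vT \<Gamma> b b (TmPos (Closed A))" and X: "vT \<Gamma> X X (Arr (TmPos (Closed A)) TpNeg)"
    and x0: "vT \<Gamma> x0 x0 (JPi (TmPos A) (atEta A X))" and x1: "vT \<Gamma> x1 x1 (JPi Beh (atStar A X))"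
    and h: "vT \<Gamma> h h (glue A X x0 x1)"
  shows "vT \<Gamma> (IndClosed A b X x0 x1 h) (IndClosed A b X x0 x1 h) (TmNeg (atNeg (Closed A) X b))"
proof -
  note t = IndClosed[OF vT_eq(2)[OF A] vT_eq(2)[OF b] vT_eq(2)[OF X] vT_eq(2)[OF x0] vT_eq(2)[OF x1] vT_eq(2)[OF h]]
  note vX = v_atNeg[OF v_Closed[OF A] X b]
  show ?thesis
  proof (rule v_TmPos_I[OF t v_U[OF vX]])
    fix s assume e: "senv \<Gamma> s s"
    let ?A = "subT s A" and ?X = "subT s X" and ?b = "subT s b" and ?x0 = "subT s x0" and ?x1 = "subT s x1" and ?h = "subT s h"
    have ty: "[] \<turnstile> ?A \<Colon> TpPos" "[] \<turnstile> ?X \<Colon> Arr (TmPos (Closed ?A)) TpNeg" "[] \<turnstile> ?x0 \<Colon> JPi (TmPos ?A) (atEta ?A ?X)"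
      "[] \<turnstile> ?x1 \<Colon> JPi Beh (atStar ?A ?X)" "[] \<turnstile> ?h \<Colon> glue ?A ?X ?x0 ?x1"
      using vT_typed[OF A e] vT_typed[OF X e] vT_typed[OF x0 e] vT_typed[OF x1 e] vT_typed[OF h e] by simp_all
    have rA: "rel TpPos (Closed ?A) (Closed ?A)" using vT_rel_TpPos[OF v_Closed[OF A] e] by simp
    have rX: "rel (Arr (TmPos (Closed ?A)) TpNeg) ?X ?X" using vT_rel_fam(1)[OF X e] by simp
    have cb: "cmp (Closed ?A) ?b" using vT_cmp[OF b e] by simp
    then obtain a where a: "cmp ?A a" and eq: "[] \<turnstile> ?b \<doteq> Eta ?A a \<Colon> TmPos (Closed ?A)"
      unfolding redP_cmp[OF red_Closed[OF vT_rel_TpPos[OF A e]]] by blast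
    have "rel (TmPos (Closed ?A)) ?b (Eta ?A a)" using cb eq by (simp add: rel_TmPos)
    \<comment> \<open>The fibres over \<open>b\<close> and over \<open>Eta A a\<close> share one
      predicate; the result found over the latter counts over the former.\<close>
    note at = rel_atNeg[OF rA rX this]
    have "rel (JPi (TmPos ?A) (atEta ?A ?X)) ?x0 ?x0" using vT_D[OF x0 e] by simp
    from rel_JPi_app[OF this cmp_rel_TmPos[OF a]]
    have "cmp (U (atNeg (Closed ?A) ?X (Eta ?A a))) (App (TmPos ?A) (atEta ?A ?X) ?x0 a)" by (simp add: rel_TmPos)
    then have c: "cmpN (atNeg (Closed ?A) ?X ?b) (App (TmPos ?A) (atEta ?A ?X) ?x0 a)"
      using cmp_U cmpN_rel[OF at] at val_TpNeg rel_refl(2)[OF val_TpNeg at] by metis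
    have "[] \<turnstile> IndClosed ?A ?b ?X ?x0 ?x1 ?h \<doteq> IndClosed ?A (Eta ?A a) ?X ?x0 ?x1 ?h \<Colon> TmNeg (atNeg (Closed ?A) ?X ?b)"
      by (rule IndClosed_cong[OF eq_refl[OF ty(1)] eq eq_refl[OF ty(2)] eq_refl[OF ty(3)] eq_refl[OF ty(4)] eq_refl[OF ty(5)]])
    moreover have "[] \<turnstile> IndClosed ?A (Eta ?A a) ?X ?x0 ?x1 ?h \<doteq> App (TmPos ?A) (atEta ?A ?X) ?x0 a \<Colon> TmNeg (atNeg (Closed ?A) ?X ?b)"
      by (rule eq_conv[OF IndClosed_Eta[OF ty(1) cmp_typed[OF a] ty(2-5)] eqJ_sym[OF TmNeg_cong[OF rel_eq[OF at]]]])
    ultimately have "cmpN (atNeg (Closed ?A) ?X ?b) (IndClosed ?A ?b ?X ?x0 ?x1 ?h)"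
      using c by (blast intro: cmpN_eq eq_sym eq_trans)
    then show "cmp (subT s (U (atNeg (Closed A) X b))) (subT s (IndClosed A b X x0 x1 h))"
      using cmp_U_senv[OF vX e] by simp
  qed
qed

lemma v_Ap:
  assumes A: "vT \<Gamma> A A TpPos" and X: "vT \<Gamma> X X (Arr (TmPos A) TpNeg)" and u: "vT \<Gamma> u u (TmNeg (PiT A X))"
  shows "vT \<Gamma> (Ap A X u) (Ap A X u) (JPi (TmPos A) (famNeg A X))"
proof -
  note t = eq_refl[OF Ap[OF vT_eq(2)[OF A] vT_eq(2)[OF X] vT_eq(2)[OF u]]]
  show ?thesis
  proof (rule vT_I[OF t v_JPi[OF v_TmPos[OF A] v_famNeg[OF A X]]])
    fix s q assume e: "senv \<Gamma> s q"
    note e' = senv_refl[OF e]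
    let ?A = "subT s A" and ?X = "subT s X" and ?u = "subT s u" and ?u' = "subT q (Ap A X u)"
    have E: "[] \<turnstile> Ap ?A ?X ?u \<doteq> ?u' \<Colon> JPi (TmPos ?A) (famNeg ?A ?X)"
      using eqT_senv[OF t e] by simp
    have rA: "rel TpPos ?A ?A" and rX: "rel (Arr (TmPos ?A) TpNeg) ?X ?X"
      using vT_rel_TpPos[OF A e'] vT_rel_fam(1)[OF X e'] by simp_all
    note tA = rel_TpPos_typed(1)[OF rA] and tX = presups(5)[OF rel_eq[OF rX]]
    have c: "cmpN (PiT ?A ?X) ?u" using vT_cmp[OF u e'] cmp_U_senv[OF v_PiT[OF A X] e'] by simp
    have "rel (instJ (famNeg ?A ?X) a) (App (TmPos ?A) (famNeg ?A ?X) (Ap ?A ?X ?u) a) (App (TmPos ?A) (famNeg ?A ?X) ?u' b)"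
      if r: "rel (TmPos ?A) a b" for a b
    proof -
      from r have a: "cmp ?A a" by (simp add: rel_TmPos)
      note rXa = rel_atNeg[OF rA rX cmp_rel_TmPos[OF a]]
      have "cmpN (atNeg ?A ?X a) (apT ?A ?X ?u a)"
        using c a unfolding redN_cmp[OF red_PiT(1)[OF rA rX]] by blast
      then have "cmp (U (atNeg ?A ?X a)) (apT ?A ?X ?u a)" by (simp only: cmp_U[OF rXa])
      moreover have "[] \<turnstile> apT ?A ?X ?u a \<doteq> App (TmPos ?A) (famNeg ?A ?X) ?u' b \<Colon> instJ (famNeg ?A ?X) a"
        by (rule App_cong[OF TmPos[OF tA] eqJ_refl[OF TmPos[OF tA]] eqJ_refl[OF famNeg[OF tA tX]] E rel_eq[OF r]])
      ultimately show ?thesis by (simp add: rel_TmPos)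
    qed
    with E have "rel (JPi (TmPos ?A) (famNeg ?A ?X)) (Ap ?A ?X ?u) ?u'" unfolding rel.simps(2) by blast
    then show "rel (subJ s (JPi (TmPos A) (famNeg A X))) (subT s (Ap A X u)) ?u'" by simp
  qed
qed

lemma v_LamT:
  assumes A: "vT \<Gamma> A A TpPos" and X: "vT \<Gamma> X X (Arr (TmPos A) TpNeg)" and f: "vT \<Gamma> f f (JPi (TmPos A) (famNeg A X))"
  shows "vT \<Gamma> (LamT A X f) (LamT A X f) (TmNeg (PiT A X))"
proof -
  note vP = v_PiT[OF A X]
  show ?thesis
  proof (rule v_TmPos_I[OF LamT[OF vT_eq(2)[OF A] vT_eq(2)[OF X] vT_eq(2)[OF f]] v_U[OF vP]])
    fix s assume e: "senv \<Gamma> s s"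
    let ?A = "subT s A" and ?X = "subT s X" and ?f = "subT s f"
    have rA: "rel TpPos ?A ?A" and rX: "rel (Arr (TmPos ?A) TpNeg) ?X ?X" and rf: "rel (JPi (TmPos ?A) (famNeg ?A ?X)) ?f ?f"
      using vT_rel_TpPos[OF A e] vT_rel_fam(1)[OF X e] vT_D[OF f e] by simp_all
    note tA = rel_TpPos_typed(1)[OF rA] and tX = presups(5)[OF rel_eq[OF rX]] and tf = presups(5)[OF rel_eq[OF rf]]
    have "cmpN (atNeg ?A ?X a) (apT ?A ?X (LamT ?A ?X ?f) a)" if a: "cmp ?A a" for a
    proof -
      have "cmp (U (atNeg ?A ?X a)) (App (TmPos ?A) (famNeg ?A ?X) ?f a)"
        using rel_JPi_app[OF rf cmp_rel_TmPos[OF a]] by (simp add: rel_TmPos)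
      then have "cmpN (atNeg ?A ?X a) (App (TmPos ?A) (famNeg ?A ?X) ?f a)"
        by (simp only: cmp_U[OF rel_atNeg[OF rA rX cmp_rel_TmPos[OF a]]])
      moreover have "[] \<turnstile> apT ?A ?X (LamT ?A ?X ?f) a \<doteq> App (TmPos ?A) (famNeg ?A ?X) ?f a \<Colon> instJ (famNeg ?A ?X) a"
        by (rule App_cong[OF TmPos[OF tA] eqJ_refl[OF TmPos[OF tA]] eqJ_refl[OF famNeg[OF tA tX]]
              PiT_beta[OF tA tX tf] eq_refl[OF cmp_typed[OF a]]])
      ultimately show ?thesis using cmpN_eq eq_sym by fastforce
    qed
    with LamT[OF tA tX tf] have "cmpN (PiT ?A ?X) (LamT ?A ?X ?f)"
      unfolding redN_cmp[OF red_PiT(1)[OF rA rX]] by blast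
    then show "cmp (subT s (U (PiT A X))) (subT s (LamT A X f))"
      using cmp_U_senv[OF vP e] by simp
  qed
qed

lemma v_Unpair:
  assumes A: "vT \<Gamma> A A TpPos" and B: "vT \<Gamma> B B (Arr (TmPos A) TpPos)" and u: "vT \<Gamma> u u (TmPos (SigmaT A B))"
  shows "vT \<Gamma> (Unpair A B u) (Unpair A B u) (JSigma (TmPos A) (famPos A B))"
proof -
  note t = eq_refl[OF Unpair[OF vT_eq(2)[OF A] vT_eq(2)[OF B] vT_eq(2)[OF u]]]
  show ?thesis
  proof (rule vT_I[OF t v_JSigma[OF v_TmPos[OF A] v_famPos[OF A B]]])
    fix s q assume e: "senv \<Gamma> s q"
    note e' = senv_refl[OF e]
    let ?A = "subT s A" and ?B = "subT s B" and ?u = "subT s u" and ?u' = "subT q (Unpair A B u)"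
    have E: "[] \<turnstile> Unpair ?A ?B ?u \<doteq> ?u' \<Colon> JSigma (TmPos ?A) (famPos ?A ?B)"
      using eqT_senv[OF t e] by simp
    have rA: "rel TpPos ?A ?A" and rB: "rel (Arr (TmPos ?A) TpPos) ?B ?B"
      using vT_rel_TpPos[OF A e'] vT_rel_fam(2)[OF B e'] by simp_all
    note tA = rel_TpPos_typed(1)[OF rA] and tB = presups(5)[OF rel_eq[OF rB]]
    have c: "cmp ?A (fstT ?A ?B ?u)" "cmp (atPos ?A ?B (fstT ?A ?B ?u)) (sndT ?A ?B ?u)"
      using vT_cmp[OF u e'] redP_cmp[OF red_SigmaT(1)[OF rA rB]] by simp_all
    note co = TmPos[OF tA] eqJ_refl[OF TmPos[OF tA]] eqJ_refl[OF famPos[OF tA tB]] E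
    have "rel (TmPos ?A) (fstT ?A ?B ?u) (Fst (TmPos ?A) (famPos ?A ?B) ?u')"
      using c(1) Fst_cong[OF co] by (simp only: rel_TmPos)
    moreover have "rel (instJ (famPos ?A ?B) (fstT ?A ?B ?u)) (sndT ?A ?B ?u) (Snd (TmPos ?A) (famPos ?A ?B) ?u')"
      using c(2) Snd_cong[OF co] by (simp add: rel_TmPos)
    ultimately have "rel (JSigma (TmPos ?A) (famPos ?A ?B)) (Unpair ?A ?B ?u) ?u'"
      using E unfolding rel.simps(3) by blast
    then show "rel (subJ s (JSigma (TmPos A) (famPos A B))) (subT s (Unpair A B u)) ?u'" by simp
  qed
qed

lemma v_PairT:
  assumes A: "vT \<Gamma> A A TpPos" and B: "vT \<Gamma> B B (Arr (TmPos A) TpPos)" and p: "vT \<Gamma> p p (JSigma (TmPos A) (famPos A B))"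
  shows "vT \<Gamma> (PairT A B p) (PairT A B p) (TmPos (SigmaT A B))"
proof (rule v_TmPos_I[OF PairT[OF vT_eq(2)[OF A] vT_eq(2)[OF B] vT_eq(2)[OF p]] v_SigmaT[OF A B]])
  fix s assume e: "senv \<Gamma> s s"
  let ?A = "subT s A" and ?B = "subT s B" and ?p = "subT s p"
  have rA: "rel TpPos ?A ?A" and rB: "rel (Arr (TmPos ?A) TpPos) ?B ?B" and rp: "rel (JSigma (TmPos ?A) (famPos ?A ?B)) ?p ?p"
    using vT_rel_TpPos[OF A e] vT_rel_fam(2)[OF B e] vT_D[OF p e] by simp_all
  note tA = rel_TpPos_typed(1)[OF rA] and tB = presups(5)[OF rel_eq[OF rB]] and tp = presups(5)[OF rel_eq[OF rp]]
  let ?a = "Fst (TmPos ?A) (famPos ?A ?B) ?p" and ?b = "Snd (TmPos ?A) (famPos ?A ?B) ?p" and ?t = "PairT ?A ?B ?p"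
  have a: "cmp ?A ?a" and b: "cmp (atPos ?A ?B ?a) ?b" using rp by (simp_all add: rel.simps(3) rel_TmPos)
  note co = TmPos[OF tA] eqJ_refl[OF TmPos[OF tA]] eqJ_refl[OF famPos[OF tA tB]] eq_sym[OF SigmaT_beta[OF tA tB tp]]
  have f: "[] \<turnstile> ?a \<doteq> fstT ?A ?B ?t \<Colon> TmPos ?A" by (rule Fst_cong[OF co])
  have g: "[] \<turnstile> ?b \<doteq> sndT ?A ?B ?t \<Colon> TmPos (atPos ?A ?B ?a)" using Snd_cong[OF co] by simp
  \<comment> \<open>The second component is known to be computable over the projection of
    \<open>p\<close>; this moves it over the projection of the new pair.\<close>
  have "rel (TmPos ?A) ?a (fstT ?A ?B ?t)" using a f by (simp only: rel_TmPos)
  from cmp_rel[OF rel_atPos[OF rA rB this]] cmp_eq[OF b g]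
  have "cmp (atPos ?A ?B (fstT ?A ?B ?t)) (sndT ?A ?B ?t)" by simp
  with cmp_eq[OF a f] PairT[OF tA tB tp] show "cmp (subT s (SigmaT A B)) (subT s (PairT A B p))"
    using redP_cmp[OF red_SigmaT(1)[OF rA rB]] by simp
qed

lemma v_RefT:
  assumes A: "vT \<Gamma> A A TpPos" and a: "vT \<Gamma> a a (TmPos A)" and b: "vT \<Gamma> b b (TmPos A)" and p: "vT \<Gamma> p p (JEq (TmPos A) a b)"
  shows "vT \<Gamma> (RefT A a b p) (RefT A a b p) (TmPos (EqT A a b))"
proof -
  note t = RefT[OF vT_eq(2)[OF A] vT_eq(2)[OF a] vT_eq(2)[OF b] vT_eq(2)[OF p]]
  note vE = v_EqT[OF A a b]
  show ?thesis
  proof (rule v_TmPos_I[OF t vE])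
    fix s assume e: "senv \<Gamma> s s"
    have "[] \<turnstile> EqT (subT s A) (subT s a) (subT s b) \<Colon> TpPos" using vT_typed[OF vE e] by simp
    from redP_cmp[OF red_EqT[OF this]] presups(5)[OF eqT_senv[OF eq_refl[OF t] e]]
    show "cmp (subT s (EqT A a b)) (subT s (RefT A a b p))" by simp
  qed
qed

text \<open>The predicate of \<open>EqT\<close> says only that \<open>u\<close> is typed, so
  relatedness of the endpoints is drawn from syntax: \<open>SelfT\<close> with reflection derives
  the equation, and \<open>v_small\<close> makes it valid because \<open>TmPos A\<close> is
  small.\<close>

lemma v_SelfT:
  assumes A: "vT \<Gamma> A A TpPos" and a: "vT \<Gamma> a a (TmPos A)" and b: "vT \<Gamma> b b (TmPos A)" and u: "vT \<Gamma> u u (TmPos (EqT A a b))"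
  shows "vT \<Gamma> (SelfT A a b u) (SelfT A a b u) (JEq (TmPos A) a b)"
proof -
  note t = SelfT[OF vT_eq(2)[OF A] vT_eq(2)[OF a] vT_eq(2)[OF b] vT_eq(2)[OF u]]
  have ab: "vT \<Gamma> a b (TmPos A)"
    by (rule v_small[OF a _ reflection[OF vJ_eq(2)[OF v_TmPos[OF A]] vT_eq(2)[OF a] vT_eq(2)[OF b] t]]) simp
  show ?thesis
    by (rule vT_I[OF eq_refl[OF t] v_JEq[OF v_TmPos[OF A] a b]])
      (use eqT_senv[OF eq_refl[OF t]] vT_D[OF ab senv_refl] in \<open>auto simp: rel.simps(4)\<close>)
qed

lemma cmp_NatT: "cmp NatT = (\<lambda>t. \<exists>n. [] \<turnstile> t \<doteq> (Succ ^^ n) Zero \<Colon> TmPos NatT)"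
  by (rule redP_cmp[OF red_NatT])

lemma numeral_typed: "\<turnstile>\<^sub>C \<Gamma> \<Longrightarrow> \<Gamma> \<turnstile> (Succ ^^ n) Zero \<Colon> TmPos NatT"
  by (induct n) (auto intro: Zero Succ)

lemma cmp_numeral: "cmp NatT ((Succ ^^ n) Zero)"
  unfolding cmp_NatT using numeral_typed[OF ctx_nil] eq_refl by blast

lemma v_Zero: "\<turnstile>\<^sub>C \<Gamma> \<Longrightarrow> vT \<Gamma> Zero Zero (TmPos NatT)"
  using v_TmPos_I[OF Zero v_NatT] cmp_numeral[of 0] by auto

lemma v_Succ:
  assumes n: "vT \<Gamma> n n (TmPos NatT)"
  shows "vT \<Gamma> (Succ n) (Succ n) (TmPos NatT)"
proof (rule v_TmPos_I[OF Succ[OF vT_eq(2)[OF n]] v_NatT[OF ctx_of(4)[OF vT_eq(2)[OF n]]]])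
  fix s assume e: "senv \<Gamma> s s"
  from vT_cmp[OF n e] obtain k where "[] \<turnstile> subT s n \<doteq> (Succ ^^ k) Zero \<Colon> TmPos NatT" by (auto simp: cmp_NatT)
  from Succ_cong[OF this] have "[] \<turnstile> Succ (subT s n) \<doteq> (Succ ^^ Suc k) Zero \<Colon> TmPos NatT" by simp
  then show "cmp (subT s NatT) (subT s (Succ n))" unfolding subT.simps cmp_NatT by blast
qed

text \<open>Under a closing substitution \<open>n\<close> equals a numeral, and the recursion is
  unfolded by induction on that numeral. The result is transported between the fibres over the
  numeral and over \<open>n\<close>, which have the same predicate.\<close>

lemma v_IndNat:
  fixes X :: "('c::monoid_add) tm"
  assumes n: "vT \<Gamma> n n (TmPos NatT)" and X: "vT \<Gamma> X X (Arr (TmPos NatT) TpNeg)"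
    and e0: "vT \<Gamma> e0 e0 (TmNeg (atNeg NatT X Zero))" and e1: "vT \<Gamma> e1 e1 (JPi (TmPos NatT) (indStep X))"
  shows "vT \<Gamma> (IndNat n X e0 e1) (IndNat n X e0 e1) (TmNeg (atNeg NatT X n))"
proof -
  note vN = v_NatT[OF ctx_of(4)[OF vT_eq(2)[OF n]]]
  note vX = v_atNeg[OF vN X n]
  show ?thesis
  proof (rule v_TmPos_I[OF IndNat[OF vT_eq(2)[OF n] vT_eq(2)[OF X] vT_eq(2)[OF e0] vT_eq(2)[OF e1]] v_U[OF vX]])
    fix s assume e: "senv \<Gamma> s s"
    let ?n = "subT s n" and ?X = "subT s X" and ?e0 = "subT s e0" and ?e1 = "subT s e1"
    have rN: "rel TpPos (NatT :: 'c tm) NatT" using vT_rel_TpPos[OF vN e] by simp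
    have rX: "rel (Arr (TmPos NatT) TpNeg) ?X ?X" and r1: "rel (JPi (TmPos NatT) (indStep ?X)) ?e1 ?e1"
      using vT_rel_fam(1)[OF X e] vT_D[OF e1 e] by simp_all
    note tX = presups(5)[OF rel_eq[OF rX]] and t1 = presups(5)[OF rel_eq[OF r1]]
    have c0: "cmp (U (atNeg NatT ?X Zero)) ?e0" using vT_cmp[OF e0 e] by simp
    note t0 = cmp_typed[OF c0]
    have num: "cmp (U (atNeg NatT ?X ((Succ ^^ k) Zero))) (IndNat ((Succ ^^ k) Zero) ?X ?e0 ?e1)" for k
    proof (induct k)
      case 0
      show ?case using cmp_eq[OF c0 eq_sym[OF IndNat_Zero[OF tX t0 t1]]] by simp
    next
      case (Suc k)
      let ?k = "(Succ ^^ k) Zero"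
      have "rel (instJ (indStep ?X) ?k) (App (TmPos NatT) (indStep ?X) ?e1 ?k) (App (TmPos NatT) (indStep ?X) ?e1 ?k)"
        by (rule rel_JPi_app[OF r1 cmp_rel_TmPos[OF cmp_numeral]])
      then have "rel (Arr (TmNeg (atNeg NatT ?X ?k)) (TmNeg (atNeg NatT ?X (Succ ?k))))
          (App (TmPos NatT) (indStep ?X) ?e1 ?k) (App (TmPos NatT) (indStep ?X) ?e1 ?k)" by simp
      from rel_JPi_app[OF this cmp_rel_TmPos[OF Suc]]
      have "cmp (U (atNeg NatT ?X (Succ ?k))) (app (TmNeg (atNeg NatT ?X ?k)) (TmNeg (atNeg NatT ?X (Succ ?k)))
          (App (TmPos NatT) (indStep ?X) ?e1 ?k) (IndNat ?k ?X ?e0 ?e1))"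
        by (simp add: rel_TmPos)
      from cmp_eq[OF this eq_sym[OF IndNat_Succ[OF cmp_typed[OF cmp_numeral] tX t0 t1]]] show ?case by simp
    qed
    from vT_cmp[OF n e] obtain k where k: "[] \<turnstile> ?n \<doteq> (Succ ^^ k) Zero \<Colon> TmPos NatT" by (auto simp: cmp_NatT)
    have rk: "rel (TmPos NatT) ?n ((Succ ^^ k) Zero)" using k vT_cmp[OF n e] by (simp add: rel_TmPos)
    note at = rel_atNeg[OF rN rX rk]
    have "cmpN (atNeg NatT ?X ?n) (IndNat ((Succ ^^ k) Zero) ?X ?e0 ?e1)"
      using num[of k] cmp_U[OF rel_refl(2)[OF val_TpNeg at]] cmpN_rel[OF at] by simp
    moreover have "[] \<turnstile> IndNat ?n ?X ?e0 ?e1 \<doteq> IndNat ((Succ ^^ k) Zero) ?X ?e0 ?e1 \<Colon> TmNeg (atNeg NatT ?X ?n)"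
      by (rule IndNat_cong[OF k eq_refl[OF tX] eq_refl[OF t0] eq_refl[OF t1]])
    ultimately have "cmpN (atNeg NatT ?X ?n) (IndNat ?n ?X ?e0 ?e1)" by (blast intro: cmpN_eq eq_sym)
    then show "cmp (subT s (U (atNeg NatT X n))) (subT s (IndNat n X e0 e1))"
      using cmp_U_senv[OF vX e] by simp
  qed
qed

section \<open>Fundamental theorem and canonicity\<close>

lemma v_small':
  assumes u: "vT \<Gamma> u u J" and J: "small J" and eq: "\<Gamma> \<turnstile> t \<doteq> u \<Colon> J"
  shows "vT \<Gamma> t u J"
  by (rule vT_sym[OF v_small[OF u J eq_sym[OF eq]]])

lemma v_apT:
  assumes "vT \<Gamma> A A TpPos" "vT \<Gamma> X X (Arr (TmPos A) TpNeg)" "vT \<Gamma> f f (TmNeg (PiT A X))" "vT \<Gamma> a a (TmPos A)"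
  shows "vT \<Gamma> (apT A X f a) (apT A X f a) (TmNeg (atNeg A X a))"
  using v_App[OF v_TmPos[OF assms(1)] v_famNeg[OF assms(1,2)] v_Ap[OF assms(1-3)] assms(4)] by simp

lemmas v_rules = v_var v_atom v_JPi v_JSigma v_JEq v_TmPos v_Lam v_App v_Pair v_Fst v_Snd v_Refl v_Triv[OF eq_refl[OF Triv]]
  v_Triv[OF Triv_eta] v_App_beta v_Lam_eta v_Fst_beta v_Snd_beta v_Pair_eta v_reflection
  v_U v_F v_Open v_Closed v_PiT v_SigmaT v_EqT v_NatT
  v_Ret v_Bind v_Step v_ApOpen v_LamOpen v_Eta v_Star v_IndClosed v_Ap v_LamT v_Unpair v_PairT v_RefT v_SelfT
  v_Zero v_Succ v_IndNat

lemmas v_structural = vJ_sym vJ_trans vT_sym vT_trans vT_conv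

text \<open>Rules of the framework and type constants have their own validity lemma. For the other
  equations \<open>v_small'\<close> serves when validity of the right side is an induction
  hypothesis, and \<open>v_small\<close> when the left side is assembled from valid constants, which
  includes all congruences of term constants. \<open>Ap_Step\<close> is done from the right, where
  \<open>v_Step\<close> and \<open>v_apT\<close> build the term directly.\<close>

lemma fundamental:
  shows "\<turnstile>\<^sub>C \<Gamma> \<Longrightarrow> True"
    and "\<Gamma> \<turnstile>\<^sub>J J \<Longrightarrow> vJ \<Gamma> J J"
    and "\<Gamma> \<turnstile>\<^sub>J J \<doteq> K \<Longrightarrow> vJ \<Gamma> J K"
    and "\<Gamma> \<turnstile> t \<Colon> J \<Longrightarrow> vT \<Gamma> t t J"
    and "\<Gamma> \<turnstile> t \<doteq> u \<Colon> J \<Longrightarrow> vT \<Gamma> t u J"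
  by (induct rule: wf_ctx_is_jdg_eq_jdg_has_jdg_eq_tm.inducts)
    ((rule TrueI
    | (assumption | (rule v_rules; assumption) | (rule v_structural; assumption)
    | (rule v_small', assumption, (simp; fail), (rule cg_rules Step_Beh; assumption))
    | (rule v_small, (rule v_rules; (assumption | (rule vT_refl(1), assumption) | (rule v_rules; (assumption | (rule v_F, assumption)))))[1],
        (simp; fail), (rule cg_rules; assumption))
    | (rule v_small', (rule v_Step[OF v_atNeg v_apT]; assumption)[1], (simp; fail), (rule Ap_Step; assumption))))[1])+

section \<open>Canonicity over the unit context\<close>

lemma wk_numeral [simp]: "renT r ((Succ ^^ n) Zero) = (Succ ^^ n) Zero"
  by (induct n) simp_all

text \<open>A morphism from the terminal object is a term in one variable of \<open>JUnit\<close>.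
  Putting \<open>Triv\<close> for the variable gives a closed term to which validity applies, and
  the resulting equation is weakened back.\<close>

lemma canonicity:
  assumes "[JUnit] \<turnstile> t \<Colon> TmNeg (F NatT)"
  shows "\<exists>c n. [JUnit] \<turnstile> t \<doteq> Step (F NatT) c (Ret NatT ((Succ ^^ n) Zero)) \<Colon> TmNeg (F NatT)"
proof -
  let ?s = "single Triv" and ?N = "NatT :: 'a tm"
  have U: "[] \<turnstile>\<^sub>J JUnit" and T: "[] \<turnstile> Triv \<Colon> JUnit" by (intro JUnit Triv ctx_nil)+
  have N: "[] \<turnstile> NatT \<Colon> TpPos" by (rule NatT[OF ctx_nil])
  have e: "senv [JUnit] ?s ?s"
    using eq_refl[OF T] by (simp add: rel.simps val.simps)
  have vN: "vT [] NatT ?N TpPos" by (rule v_NatT[OF ctx_nil])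
  have rN: "rel TpPos NatT ?N" using vT_rel_TpPos[OF vN, of ?s ?s] by simp
  have "cmp (U (F NatT)) (instT t Triv)"
    using vT_cmp[OF fundamental(4)[OF assms] e] by simp
  then have "cmpN (F NatT) (instT t Triv)"
    using cmp_U_senv[OF v_F[OF vN], of ?s] by simp
  then obtain c a where a: "cmp NatT a" and eq: "[] \<turnstile> instT t Triv \<doteq> Step (F NatT) c (Ret NatT a) \<Colon> TmNeg (F NatT)"
    unfolding redN_cmp[OF red_F[OF rN]] by blast
  from a obtain n where n: "[] \<turnstile> a \<doteq> (Succ ^^ n) Zero \<Colon> TmPos NatT" by (auto simp: cmp_NatT)
  have "[] \<turnstile> instT t Triv \<doteq> Step (F NatT) c (Ret NatT ((Succ ^^ n) Zero)) \<Colon> TmNeg (F NatT)"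
    by (rule eq_trans[OF eq Step_cong[OF eq_refl[OF F[OF N]] Ret_cong[OF eq_refl[OF N] n]]])
  from weakening(4)[OF U this]
  have closed: "[JUnit] \<turnstile> wkT (instT t Triv) \<doteq> Step (F NatT) c (Ret NatT ((Succ ^^ n) Zero)) \<Colon> TmNeg (F NatT)" by simp
  have v0: "[JUnit] \<turnstile> Var 0 \<Colon> JUnit" using var_0[OF U] by simp
  \<comment> \<open>By \<open>Triv_eta\<close> the variable equals \<open>Triv\<close>, so
    functionality identifies \<open>t\<close> with the weakening of its closed instance.\<close>
  have "eq_sub [JUnit] Var (\<lambda>i. wkT (?s i)) [JUnit]"
    using typed_sub_Var[OF ctx_of(4)[OF v0]] Triv_eta[OF v0] by (simp add: eq_sub_def)
  from functionality(4)[OF assms this]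
  have "[JUnit] \<turnstile> t \<doteq> wkT (instT t Triv) \<Colon> TmNeg (F NatT)" by (simp add: ren_sub)
  from eq_trans[OF this closed] show ?thesis by blast
qed

theorem theorem1p1:
  fixes e :: "('c :: {monoid_add, preorder}) tm set"
  assumes "e \<in> hom JUnit (TmNeg (F NatT))"
  shows "\<exists>(c :: 'c) (n :: nat).
           e = morphism JUnit (TmNeg (F NatT)) (Step (F NatT) c (Ret NatT ((Succ ^^ n) Zero)))"
proof -
  from assms obtain t where t: "[JUnit] \<turnstile> t \<Colon> TmNeg (F NatT)"
    and e: "e = judgmental_eq JUnit (TmNeg (F NatT)) `` {t}"
    unfolding hom_def by (auto elim: quotientE)
  from canonicity[OF t] obtain c n
    where eq: "[JUnit] \<turnstile> t \<doteq> Step (F NatT) c (Ret NatT ((Succ ^^ n) Zero)) \<Colon> TmNeg (F NatT)" by blast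
  \<comment> \<open>Judgmentally equal representatives determine the same class.\<close>
  have "e = morphism JUnit (TmNeg (F NatT)) (Step (F NatT) c (Ret NatT ((Succ ^^ n) Zero)))"
    unfolding e morphism_def judgmental_eq_def
    by (simp add: set_eq_iff) (blast intro: eq_trans[OF eq] eq_trans[OF eq_sym[OF eq]])
  then show ?thesis by blast
qed

end
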